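(* Let $W$ be a $2$-dimensional real subspace of $V_{\mathbb R}$, where $V_{\mathbb R}$ is a finite-dimensional real vector space with a non-degenerate scalar product, Euclidean or of Lorentzian signature $(+-\cdots-)$. Consider a real Landau singularity with momenta in $W$, given by a real Landau graph $(\widetilde\Gamma,\widetilde{\boldsymbol\phi}:\widetilde\Gamma\to W)$ together with a scattering diagram $\sigma$ with values in $W$ collinear with it. This real Landau singularity is polygonal if and only if the Landau graph is planar, i.e. $\widetilde{\boldsymbol\phi}$ is an embedding (the image $\widetilde{\boldsymbol\phi}(\widetilde\Gamma)$ has no self-intersections).
   Context: Graphs. $\widetilde\Gamma$ is a finite connected graph with legs (a leg is an edge with one free end), without loop edges, each vertex of valence $\ge3$ (counting legs), with at least two legs. It is viewed as a $1$-dimensional cell complex glued from intervals $[0,1]$ (non-leg edges) and half-lines $[0,\infty)$ (legs), so each edge has an affine structure. For a leg $l$ denote by $\varepsilon(l)$ its vertex. A map $\widetilde\Gamma\to W$ is piecewise-affine if it is affine-linear on each edge and leg; it is an immersion if its restriction to each sufficiently small part of $\widetilde\Gamma$ is an embedding. Scattering diagrams. A scattering diagram labelled by $\widetilde\Gamma$ with values in $W$ is a collection of vectors $\sigma(v,e)\in W$ for all incident pairs (vertex $v$, edge or leg $e$) such that $\sigma(v,e)=-\sigma(w,e)$ for each non-leg edge $e=[v,w]$, and $\sum_{e\ni v}\sigma(v,e)=0$ for each vertex $v$. Real Landau graphs. A real Landau graph with values in $W$ is a finite connected graph $\widetilde\Gamma$ with legs, without loop edges, with each vertex of valence $\ge3$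 (counting legs) and with at least two legs, together with a piecewise-affine immersion $\widetilde{\boldsymbol\phi}:\widetilde\Gamma\to W$ for which there is a scattering diagram $\sigma$ collinear with it, meaning: (1) for each leg $l$, $\sigma(\varepsilon(l),l)$ is a positive multiple of the direction of the half-line $\widetilde{\boldsymbol\phi}(l)$ going away from $\widetilde{\boldsymbol\phi}(\varepsilon(l))$; (2) for each non-leg edge $e=[v,w]$, $\sigma(v,e)$ is a positive multiple of $\widetilde{\boldsymbol\phi}(w)-\widetilde{\boldsymbol\phi}(v)$. The real Landau singularity given by these data is the collection of external momenta $p_l=\sigma(\varepsilon(l),l)$, with intermediate momenta $\sigma(v,e)$ satisfying $(\sigma(v,e),\sigma(v,e))=m_e^2$, where $m_e\ge0$ are the masses assigned to the non-leg edges. Polygonal subdivisions. Put $E=W^*$, so $E^*=W$, and fix a translation-invariant area form $\mathrm{vol}$ on $E$. For a convex polygon $P\subset E$ with nonempty interior and a side $F$ of $P$, the weighted normal $\nu_P(F)\in E^*=W$ is $\nu_P(F)(x)=\int_F\iota_x\mathrm{vol}$, $x\in E$, with $F$ oriented as part of the boundary of $P$; it vanishes on the direction of $F$ and is positive on vectors pointing out of $P$ through $F$. A polygonal subdivision $\mathcal P$ of a convex polygon $Q\subset E$ with nonempty interior is a finite collection of convex polygons with nonempty interior and with union $Q$ such that any two distinct members intersect in a (possibly empty) proper face of both. Its dual graph $\widetilde\Gamma_{\mathcal P}$ has the polygons $P\in\mathcal P$ as vertices and the sides of these polygons as edges, an internal side joining the two polygons containing it, and a side contained in the boundary of $Q$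 being a leg at the unique polygon containing it. A strictly convex PL-function for $\mathcal P$ is a continuous convex function $f:Q\to\mathbb R$, affine-linear on each $P\in\mathcal P$, whose affine-linear pieces on any two polygons sharing a side are different. $\mathcal P$ is regular if such $f$ exists; $d(f|_P)\in E^*=W$ denotes the linear part of $f|_P$. Polygonal singularities. The real Landau singularity given by $(\widetilde\Gamma,\widetilde{\boldsymbol\phi},\sigma)$ is polygonal if it comes from a regular polygonal subdivision: there are a convex polygon $Q\subset W^*$, a regular polygonal subdivision $\mathcal P$ of $Q$, a strictly convex PL-function $f$ for $\mathcal P$, and an isomorphism of graphs with legs $\widetilde\Gamma\simeq\widetilde\Gamma_{\mathcal P}$, $v\mapsto P_v$, $e\mapsto F_e$, such that $\sigma(v,e)=\nu_{P_v}(F_e)$ for all incident $(v,e)$ and $\widetilde{\boldsymbol\phi}(v)=d(f|_{P_v})$ for all vertices $v$. *)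

theory Defs
  imports "HOL-Analysis.Analysis"
begin

section \<open>Scalar products\<close>

text \<open>The ambient space is a type of class \<open>euclidean_space\<close>, which serves only as a
  finite-dimensional real vector space with its usual topology: the inner product of the type class
  plays no role. The scalar product is a separate bilinear form \<open>B\<close>.\<close>

definition nondegenerate_scalar_product :: "('a::euclidean_space \<Rightarrow> 'a \<Rightarrow> real) \<Rightarrow> bool" where
  "nondegenerate_scalar_product B \<longleftrightarrow>
     bilinear B \<and> (\<forall>x y. B x y = B y x) \<and> (\<forall>x. (\<forall>y. B x y = 0) \<longrightarrow> x = 0)"

definition euclidean_signature :: "('a::euclidean_space \<Rightarrow> 'a \<Rightarrow> real) \<Rightarrow> bool" where
  "euclidean_signature B \<longleftrightarrow> (\<forall>x. x \<noteq> 0 \<longrightarrow> B x x > 0)"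

definition lorentzian_signature :: "('a::euclidean_space \<Rightarrow> 'a \<Rightarrow> real) \<Rightarrow> bool" where
  "lorentzian_signature B \<longleftrightarrow>
     (\<exists>u T. u \<notin> T \<and> independent (insert u T) \<and> span (insert u T) = UNIV \<and>
        (\<forall>x \<in> insert u T. \<forall>y \<in> insert u T. x \<noteq> y \<longrightarrow> B x y = 0) \<and>
        B u u = 1 \<and> (\<forall>x \<in> T. B x x = - 1))"


section \<open>Graphs with legs and their realizations\<close>

text \<open>\<open>edges\<close> are the non-leg edges; \<open>ends\<close> gives the set of end vertices of an edge or leg, so
  that \<open>ends G l = {\<epsilon>(l)}\<close> for a leg \<open>l\<close>. Multiple edges are allowed.\<close>

record ('v, 'e) legged_graph =
  verts :: "'v set"
  edges :: "'e set"
  legs :: "'e set"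
  ends :: "'e \<Rightarrow> 'v set"

definition connected_legged_graph :: "('v, 'e) legged_graph \<Rightarrow> bool" where
  "connected_legged_graph G \<longleftrightarrow> verts G \<noteq> {} \<and>
     (\<forall>v \<in> verts G. \<forall>w \<in> verts G. (v, w) \<in> {(a, b). \<exists>e \<in> edges G. ends G e = {a, b}}\<^sup>*)"

text \<open>The condition \<open>card (ends G e) = 2\<close> for non-leg edges says that there are no loop edges.\<close>

definition landau_type_graph :: "('v, 'e) legged_graph \<Rightarrow> bool" where
  "landau_type_graph G \<longleftrightarrow>
     finite (verts G) \<and> finite (edges G) \<and> finite (legs G) \<and> edges G \<inter> legs G = {} \<and>
     (\<forall>e \<in> edges G. ends G e \<subseteq> verts G \<and> card (ends G e) = 2) \<and>
     (\<forall>l \<in> legs G. ends G l \<subseteq> verts G \<and> card (ends G l) = 1) \<and>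
     connected_legged_graph G \<and>
     (\<forall>v \<in> verts G. 3 \<le> card {e \<in> edges G \<union> legs G. v \<in> ends G e}) \<and>
     2 \<le> card (legs G)"

definition cell_domain :: "('v, 'e) legged_graph \<Rightarrow> 'e \<Rightarrow> real set" where
  "cell_domain G e = (if e \<in> edges G then {0..1} else {0..})"

text \<open>The parameter \<open>0\<close> of an edge is glued to an arbitrarily chosen end; for a leg \<open>l\<close> this is
  \<open>\<epsilon>(l)\<close>. The choice affects neither the affine structure of the edge nor, up to
  homeomorphism, the realization.\<close>

definition start :: "('v, 'e) legged_graph \<Rightarrow> 'e \<Rightarrow> 'v" where
  "start G e = (SOME v. v \<in> ends G e)"

definition finish :: "('v, 'e) legged_graph \<Rightarrow> 'e \<Rightarrow> 'v" where
  "finish G e = (SOME v. v \<in> ends G e - {start G e})"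

definition cell :: "('v, 'e) legged_graph \<Rightarrow> 'e \<Rightarrow> real \<Rightarrow> 'v + 'e \<times> real" where
  "cell G e t =
     (if t = 0 then Inl (start G e)
      else if e \<in> edges G \<and> t = 1 then Inl (finish G e)
      else Inr (e, t))"

definition realization_points :: "('v, 'e) legged_graph \<Rightarrow> ('v + 'e \<times> real) set" where
  "realization_points G =
     Inl ` verts G \<union> (\<Union>e \<in> edges G \<union> legs G. cell G e ` cell_domain G e)"

text \<open>The cell complex carries the finest topology for which all characteristic maps \<open>cell G e\<close>
  are continuous.\<close>

definition realization :: "('v, 'e) legged_graph \<Rightarrow> ('v + 'e \<times> real) topology" where
  "realization G = topology (\<lambda>U. U \<subseteq> realization_points G \<and>
     (\<forall>e \<in> edges G \<union> legs G.
        openin (top_of_set (cell_domain G e)) {t \<in> cell_domain G e. cell G e t \<in> U}))"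

lemma openin_realization:
  "openin (realization G) U \<longleftrightarrow> U \<subseteq> realization_points G \<and>
     (\<forall>e \<in> edges G \<union> legs G.
        openin (top_of_set (cell_domain G e)) {t \<in> cell_domain G e. cell G e t \<in> U})"
proof -
  let ?O = "\<lambda>U. U \<subseteq> realization_points G \<and>
     (\<forall>e \<in> edges G \<union> legs G.
        openin (top_of_set (cell_domain G e)) {t \<in> cell_domain G e. cell G e t \<in> U})"
  have "istopology ?O"
    unfolding istopology_def
  proof (intro conjI allI impI ballI)
    fix S T e
    assume S: "?O S" and T: "?O T" and e: "e \<in> edges G \<union> legs G"
    have "{t \<in> cell_domain G e. cell G e t \<in> S \<inter> T} =
        {t \<in> cell_domain G e. cell G e t \<in> S} \<inter> {t \<in> cell_domain G e. cell G e t \<in> T}"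
      by blast
    with S T e show "openin (top_of_set (cell_domain G e))
        {t \<in> cell_domain G e. cell G e t \<in> S \<inter> T}"
      by auto
  next
    fix K e
    assume K: "\<forall>U \<in> K. ?O U" and e: "e \<in> edges G \<union> legs G"
    have "{t \<in> cell_domain G e. cell G e t \<in> \<Union>K} =
        (\<Union>U \<in> K. {t \<in> cell_domain G e. cell G e t \<in> U})"
      by blast
    moreover have "openin (top_of_set (cell_domain G e))
        (\<Union>U \<in> K. {t \<in> cell_domain G e. cell G e t \<in> U})"
      by (intro openin_Union) (use K e in auto)
    ultimately show "openin (top_of_set (cell_domain G e))
        {t \<in> cell_domain G e. cell G e t \<in> \<Union>K}"
      by simp
  qed blast+
  then show ?thesis
    unfolding realization_def by (simp add: topology_inverse')
qed

lemma topspace_realization: "topspace (realization G) = realization_points G"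
proof (rule equalityI)
  show "topspace (realization G) \<subseteq> realization_points G"
    using openin_realization openin_topspace by blast
  have "openin (top_of_set (cell_domain G e))
      {t \<in> cell_domain G e. cell G e t \<in> realization_points G}" if "e \<in> edges G \<union> legs G" for e
  proof -
    have "{t \<in> cell_domain G e. cell G e t \<in> realization_points G} = cell_domain G e"
      using that by (auto simp: realization_points_def)
    then show ?thesis
      by simp
  qed
  then show "realization_points G \<subseteq> topspace (realization G)"
    by (simp add: openin_realization openin_subset)
qed

definition piecewise_affine ::
    "('v, 'e) legged_graph \<Rightarrow> ('v + 'e \<times> real \<Rightarrow> 'a::real_vector) \<Rightarrow> bool" where
  "piecewise_affine G \<phi> \<longleftrightarrow>
     (\<forall>e \<in> edges G \<union> legs G. \<exists>a d. \<forall>t \<in> cell_domain G e. \<phi> (cell G e t) = a + t *\<^sub>R d)"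

definition graph_embedding ::
    "'a::euclidean_space set \<Rightarrow> ('v, 'e) legged_graph \<Rightarrow> ('v + 'e \<times> real \<Rightarrow> 'a) \<Rightarrow> bool" where
  "graph_embedding W G \<phi> \<longleftrightarrow> embedding_map (realization G) (top_of_set W) \<phi>"

definition graph_immersion ::
    "'a::euclidean_space set \<Rightarrow> ('v, 'e) legged_graph \<Rightarrow> ('v + 'e \<times> real \<Rightarrow> 'a) \<Rightarrow> bool" where
  "graph_immersion W G \<phi> \<longleftrightarrow>
     (\<forall>p \<in> realization_points G. \<exists>U. openin (realization G) U \<and> p \<in> U \<and>
        embedding_map (subtopology (realization G) U) (top_of_set W) \<phi>)"


section \<open>Scattering diagrams and real Landau singularities\<close>

text \<open>Only the values \<open>\<sigma> v e\<close> at incident pairs matter.\<close>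

definition scattering_diagram ::
    "'a::real_vector set \<Rightarrow> ('v, 'e) legged_graph \<Rightarrow> ('v \<Rightarrow> 'e \<Rightarrow> 'a) \<Rightarrow> bool" where
  "scattering_diagram W G \<sigma> \<longleftrightarrow>
     (\<forall>e \<in> edges G \<union> legs G. \<forall>v \<in> ends G e. \<sigma> v e \<in> W) \<and>
     (\<forall>e \<in> edges G. \<forall>v w. ends G e = {v, w} \<longrightarrow> \<sigma> v e = - \<sigma> w e) \<and>
     (\<forall>v \<in> verts G. (\<Sum>e \<in> {e \<in> edges G \<union> legs G. v \<in> ends G e}. \<sigma> v e) = 0)"

definition positive_multiple :: "'a::real_vector \<Rightarrow> 'a \<Rightarrow> bool" where
  "positive_multiple x y \<longleftrightarrow> (\<exists>c > 0. x = c *\<^sub>R y)"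

definition collinear_diagram ::
    "('v, 'e) legged_graph \<Rightarrow> ('v + 'e \<times> real \<Rightarrow> 'a::real_vector) \<Rightarrow> ('v \<Rightarrow> 'e \<Rightarrow> 'a) \<Rightarrow> bool"
  where
  "collinear_diagram G \<phi> \<sigma> \<longleftrightarrow>
     (\<forall>l \<in> legs G. \<forall>v. ends G l = {v} \<longrightarrow>
        positive_multiple (\<sigma> v l) (\<phi> (cell G l 1) - \<phi> (Inl v))) \<and>
     (\<forall>e \<in> edges G. \<forall>v w. ends G e = {v, w} \<longrightarrow>
        positive_multiple (\<sigma> v e) (\<phi> (Inl w) - \<phi> (Inl v)))"

definition real_landau_graph ::
    "'a::euclidean_space set \<Rightarrow> ('v, 'e) legged_graph \<Rightarrow> ('v + 'e \<times> real \<Rightarrow> 'a) \<Rightarrow> bool" where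
  "real_landau_graph W G \<phi> \<longleftrightarrow>
     landau_type_graph G \<and> \<phi> ` realization_points G \<subseteq> W \<and>
     piecewise_affine G \<phi> \<and> graph_immersion W G \<phi> \<and>
     (\<exists>\<sigma>. scattering_diagram W G \<sigma> \<and> collinear_diagram G \<phi> \<sigma>)"

definition real_landau_singularity ::
    "('a::euclidean_space \<Rightarrow> 'a \<Rightarrow> real) \<Rightarrow> 'a set \<Rightarrow> ('v, 'e) legged_graph \<Rightarrow>
     ('v + 'e \<times> real \<Rightarrow> 'a) \<Rightarrow> ('v \<Rightarrow> 'e \<Rightarrow> 'a) \<Rightarrow> ('e \<Rightarrow> real) \<Rightarrow> bool" where
  "real_landau_singularity B W G \<phi> \<sigma> m \<longleftrightarrow>
     real_landau_graph W G \<phi> \<and> scattering_diagram W G \<sigma> \<and> collinear_diagram G \<phi> \<sigma> \<and>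
     (\<forall>e \<in> edges G. m e \<ge> 0 \<and> (\<forall>v \<in> ends G e. B (\<sigma> v e) (\<sigma> v e) = (m e)\<^sup>2))"


section \<open>The dual plane\<close>

definition dual_space :: "'a::real_vector set \<Rightarrow> ('a \<Rightarrow> real) set" where
  "dual_space W = {g \<in> extensional W.
     (\<forall>x \<in> W. \<forall>y \<in> W. g (x + y) = g x + g y) \<and> (\<forall>c. \<forall>x \<in> W. g (c *\<^sub>R x) = c * g x)}"

text \<open>The dual \<open>E = W\<^sup>*\<close> of a subspace \<open>W\<close> is a type \<open>'b\<close> together with an evaluation pairing
  \<open>ev :: 'b \<Rightarrow> 'a \<Rightarrow> real\<close> for which \<open>\<xi> \<mapsto> ev \<xi>\<close> (restricted to \<open>W\<close>) is a linear isomorphism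
  onto the space of linear functionals on \<open>W\<close>. An element \<open>w \<in> W\<close> is then identified with the
  linear functional \<open>\<lambda>\<xi>. ev \<xi> w\<close> on \<open>E\<close>.\<close>

definition dual_evaluation ::
    "'a::real_vector set \<Rightarrow> ('b::euclidean_space \<Rightarrow> 'a \<Rightarrow> real) \<Rightarrow> bool" where
  "dual_evaluation W ev \<longleftrightarrow>
     (\<forall>x \<in> W. linear (\<lambda>\<xi>. ev \<xi> x)) \<and>
     bij_betw (\<lambda>\<xi>. restrict (ev \<xi>) W) UNIV (dual_space W)"

definition area_form :: "('b::real_vector \<Rightarrow> 'b \<Rightarrow> real) \<Rightarrow> bool" where
  "area_form vol \<longleftrightarrow> bilinear vol \<and> (\<forall>x. vol x x = 0) \<and> (\<exists>x y. vol x y \<noteq> 0)"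


section \<open>Polygonal subdivisions\<close>

definition convex_polygon :: "'b::euclidean_space set \<Rightarrow> bool" where
  "convex_polygon P \<longleftrightarrow> polytope P \<and> interior P \<noteq> {}"

text \<open>\<open>a, b\<close> are the endpoints of a side of \<open>P\<close>, traversed as part of the boundary of \<open>P\<close> in the
  orientation given by \<open>vol\<close>: for \<open>c\<close> in the interior, \<open>a - c\<close> points out of \<open>P\<close> through the side,
  and (outward vector, tangent vector) is a positive frame.\<close>

definition boundary_oriented ::
    "('b::euclidean_space \<Rightarrow> 'b \<Rightarrow> real) \<Rightarrow> 'b set \<Rightarrow> 'b \<Rightarrow> 'b \<Rightarrow> bool" where
  "boundary_oriented vol P a b \<longleftrightarrow> (\<forall>c \<in> interior P. vol (a - c) (b - a) > 0)"

definition weighted_normal ::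
    "'a::euclidean_space set \<Rightarrow> ('b::euclidean_space \<Rightarrow> 'a \<Rightarrow> real) \<Rightarrow> ('b \<Rightarrow> 'b \<Rightarrow> real) \<Rightarrow>
     'b set \<Rightarrow> 'b set \<Rightarrow> 'a" where
  "weighted_normal W ev vol P F =
     (THE u. u \<in> W \<and> (\<exists>a b. F = closed_segment a b \<and> boundary_oriented vol P a b \<and>
        (\<forall>x. ev x u = integral {0..1} (\<lambda>t. vol x (vector_derivative (linepath a b) (at t))))))"

definition polygonal_subdivision :: "'b::euclidean_space set \<Rightarrow> 'b set set \<Rightarrow> bool" where
  "polygonal_subdivision Q \<P> \<longleftrightarrow>
     finite \<P> \<and> (\<forall>P \<in> \<P>. convex_polygon P) \<and> \<Union>\<P> = Q \<and>
     (\<forall>P \<in> \<P>. \<forall>P' \<in> \<P>. P \<noteq> P' \<longrightarrow>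
        (P \<inter> P') face_of P \<and> P \<inter> P' \<noteq> P \<and> (P \<inter> P') face_of P' \<and> P \<inter> P' \<noteq> P')"

definition dual_graph ::
    "'b::euclidean_space set \<Rightarrow> 'b set set \<Rightarrow> ('b set, 'b set) legged_graph" where
  "dual_graph Q \<P> =
     \<lparr> verts = \<P>,
       edges = {F. (\<exists>P \<in> \<P>. F facet_of P) \<and> \<not> F \<subseteq> frontier Q},
       legs = {F. (\<exists>P \<in> \<P>. F facet_of P) \<and> F \<subseteq> frontier Q},
       ends = (\<lambda>F. {P \<in> \<P>. F \<subseteq> P}) \<rparr>"

definition affine_function :: "('b::real_vector \<Rightarrow> real) \<Rightarrow> bool" where
  "affine_function g \<longleftrightarrow> (\<exists>h c. linear h \<and> (\<forall>x. g x = h x + c))"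

definition strictly_convex_PL ::
    "'b::euclidean_space set \<Rightarrow> 'b set set \<Rightarrow> ('b \<Rightarrow> real) \<Rightarrow> bool" where
  "strictly_convex_PL Q \<P> f \<longleftrightarrow>
     continuous_on Q f \<and> convex_on Q f \<and>
     (\<forall>P \<in> \<P>. \<exists>g. affine_function g \<and> (\<forall>x \<in> P. f x = g x)) \<and>
     (\<forall>P \<in> \<P>. \<forall>P' \<in> \<P>. P \<noteq> P' \<and> (\<exists>F. F facet_of P \<and> F facet_of P') \<longrightarrow>
        (\<forall>g g'. affine_function g \<and> (\<forall>x \<in> P. f x = g x) \<and>
                affine_function g' \<and> (\<forall>x \<in> P'. f x = g' x) \<longrightarrow> g \<noteq> g'))"

definition regular_subdivision :: "'b::euclidean_space set \<Rightarrow> 'b set set \<Rightarrow> bool" where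
  "regular_subdivision Q \<P> \<longleftrightarrow>
     polygonal_subdivision Q \<P> \<and> (\<exists>f. strictly_convex_PL Q \<P> f)"

definition linear_part ::
    "'a::euclidean_space set \<Rightarrow> ('b::euclidean_space \<Rightarrow> 'a \<Rightarrow> real) \<Rightarrow> ('b \<Rightarrow> real) \<Rightarrow> 'b set \<Rightarrow> 'a"
  where
  "linear_part W ev f P = (THE w. w \<in> W \<and> (\<exists>c. \<forall>x \<in> P. f x = ev x w + c))"


section \<open>Polygonal singularities\<close>

definition legged_graph_iso ::
    "('v, 'e) legged_graph \<Rightarrow> ('v2, 'e2) legged_graph \<Rightarrow> ('v \<Rightarrow> 'v2) \<Rightarrow> ('e \<Rightarrow> 'e2) \<Rightarrow> bool" where
  "legged_graph_iso G H \<alpha> \<beta> \<longleftrightarrow>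
     bij_betw \<alpha> (verts G) (verts H) \<and>
     bij_betw \<beta> (edges G) (edges H) \<and> bij_betw \<beta> (legs G) (legs H) \<and>
     (\<forall>e \<in> edges G \<union> legs G. ends H (\<beta> e) = \<alpha> ` ends G e)"

definition polygonal_singularity ::
    "'a::euclidean_space set \<Rightarrow> ('b::euclidean_space \<Rightarrow> 'a \<Rightarrow> real) \<Rightarrow> ('b \<Rightarrow> 'b \<Rightarrow> real) \<Rightarrow>
     ('v, 'e) legged_graph \<Rightarrow> ('v + 'e \<times> real \<Rightarrow> 'a) \<Rightarrow> ('v \<Rightarrow> 'e \<Rightarrow> 'a) \<Rightarrow> bool" where
  "polygonal_singularity W ev vol G \<phi> \<sigma> \<longleftrightarrow>
     (\<exists>Q \<P> f P F.
        convex_polygon Q \<and> regular_subdivision Q \<P> \<and> strictly_convex_PL Q \<P> f \<and>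
        legged_graph_iso G (dual_graph Q \<P>) P F \<and>
        (\<forall>e \<in> edges G \<union> legs G. \<forall>v \<in> ends G e.
           \<sigma> v e = weighted_normal W ev vol (P v) (F e)) \<and>
        (\<forall>v \<in> verts G. \<phi> (Inl v) = linear_part W ev f (P v)))"

end

theory Submission
  imports Defs
begin

text \<open>The area form identifies the momentum plane with its dual, so that both live in one plane with
  the pairing \<open>vol\<close> and the weighted normal of an oriented side becomes the side vector itself.

  An embedded balanced graph is the corner locus of a convex piecewise linear function \<open>g\<close>, written
  down explicitly as a sum over the edges of the heights above them. It is affine off the graph, has
  a single kink across every edge and, by balancing, no bend on the verticals above the vertices;
  hence it is convex by a local midpoint criterion. The polygon of a vertex and the side of an edge
  are the sets of subgradients of \<open>g\<close> at that vertex and at the points of that edge, and the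
  PL-function on the dual polygon is the Legendre transform of \<open>g\<close>.

  Conversely, a point \<open>x\<close> of the graph of a polygonal singularity with PL-function \<open>f\<close> is determined
  by the set of slopes at which \<open>vol \<xi> x - f \<xi>\<close> is maximal: it is the polygon or side dual to the
  open cell containing \<open>x\<close>. So the map is injective, and an injective piecewise affine map of a
  finite graph with legs is an embedding.\<close>

section \<open>Plane with an area form\<close>

text \<open>The obstacle is planar topology. Building a convex function region by region would need
  the complementary regions of the graph and the consistency of the affine pieces around every
  cycle. The explicit sum needs neither: only its germ at one point at a time is examined, and
  injectivity enters by leaving at most one vertex or open cell at that point. The price is an
  auxiliary vertical direction transversal to all edges, and with it possible bends on the verticals
  through the vertices, which balancing removes. Reading slopes and points in one plane through
  \<open>vol\<close> fixes the normalisation: a kink max(0, vol(t, d)) has as its slopes the segment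
  from 0 to t, so a momentum is literally the vector of its dual side. Slopes are handled with the
  same economy: the set of points where a supporting affine function touches the potential is
  closed, and it is open along cells and off the graph, so that connectedness replaces any
  description of regions.\<close>

lemma span_pairE:
  assumes "x \<in> span {a, b}" obtains r s where "x = r *\<^sub>R a + s *\<^sub>R b"
proof -
  obtain r where "x - r *\<^sub>R a \<in> range (\<lambda>k. k *\<^sub>R b)"
    using assms by (auto simp: span_insert span_singleton)
  then obtain s where "x - r *\<^sub>R a = s *\<^sub>R b" by blast
  then show ?thesis using that[of r s] by (simp add: diff_eq_eq add.commute)
qed

lemma scaleR_at_right_tendsto: "((\<lambda>t::real. p + t *\<^sub>R d) \<longlongrightarrow> (p::'a::real_normed_vector)) (at_right 0)"
proof -
  have "((\<lambda>t::real. p + t *\<^sub>R d) \<longlongrightarrow> p + 0 *\<^sub>R d) (at_right 0)" by (intro tendsto_intros)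
  then show ?thesis by simp
qed

lemma eventually_at_right_0D:
  assumes "\<forall>\<^sub>F t in at_right (0::real). R t" obtains t where "0 < t" "t < 1" "R t"
proof -
  have "\<forall>\<^sub>F t in at_right (0::real). t \<in> {0<..<1}" by (intro eventually_at_right_real) simp
  with assms have "\<forall>\<^sub>F t in at_right 0. t \<in> {0<..<1} \<and> R t" by eventually_elim simp
  from eventually_happens'[OF trivial_limit_at_right_real this] show ?thesis using that by auto
qed

lemma area_form_bounded_bilinear:
  fixes vol :: "'b::euclidean_space \<Rightarrow> 'b \<Rightarrow> real"
  assumes "area_form vol"
  shows "bounded_bilinear vol"
  using assms by (simp add: area_form_def bilinear_conv_bounded_bilinear)

locale area_plane =
  fixes vol :: "'b::euclidean_space \<Rightarrow> 'b \<Rightarrow> real"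
  assumes area_form: "area_form vol" and dim2: "DIM('b) = 2"

sublocale area_plane \<subseteq> vol: bounded_bilinear vol
  by (rule area_form_bounded_bilinear[OF area_form])

context area_plane
begin

lemma vol_self [simp]: "vol x x = 0"
  using area_form by (simp add: area_form_def)

lemma vol_skew: "vol x y = - vol y x"
proof -
  have "vol (x + y) (x + y) = vol x x + vol x y + vol y x + vol y y"
    by (simp only: vol.add_left vol.add_right)
  then show ?thesis by simp
qed

lemmas vol_simps = vol.add_left vol.add_right vol.diff_left vol.diff_right
  vol.scaleR_left vol.scaleR_right vol.minus_left vol.minus_right vol.zero_left vol.zero_right

lemma cramer: "vol p q *\<^sub>R x = vol x q *\<^sub>R p + vol p x *\<^sub>R q"
proof -
  obtain a b where ab: "vol a b \<noteq> 0"
    using area_form by (auto simp: area_form_def)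
  have ne: "a \<noteq> b" "b \<noteq> 0" using ab by (auto simp: vol.zero_right)
  have ind: "independent {a, b}"
  proof -
    have "a \<notin> span {b}"
      using ab by (auto simp: span_singleton vol.scaleR_left)
    then show ?thesis
      using ne by (simp add: independent_insert)
  qed
  have "UNIV \<subseteq> span {a, b}"
    using ind ne dim2 by (intro card_ge_dim_independent) auto
  then have dec: "\<exists>r s. x = r *\<^sub>R a + s *\<^sub>R b" for x by (meson UNIV_I span_pairE subsetD)
  obtain p1 p2 q1 q2 x1 x2 where *: "p = p1 *\<^sub>R a + p2 *\<^sub>R b" "q = q1 *\<^sub>R a + q2 *\<^sub>R b"
      "x = x1 *\<^sub>R a + x2 *\<^sub>R b"
    using dec by metis
  have A: "vol p q = (p1 * q2 - p2 * q1) * vol a b" "vol x q = (x1 * q2 - x2 * q1) * vol a b"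
     "vol p x = (p1 * x2 - p2 * x1) * vol a b"
    using vol_skew[of b a] by (simp_all add: * vol_simps algebra_simps)
  have 1: "vol p q * x1 = vol x q * p1 + vol p x * q1" "vol p q * x2 = vol x q * p2 + vol p x * q2"
    unfolding A by (simp_all add: algebra_simps)
  have "vol p q *\<^sub>R x = (vol p q * x1) *\<^sub>R a + (vol p q * x2) *\<^sub>R b"
    by (simp add: *(3) scaleR_right_distrib)
  also have "\<dots> = vol x q *\<^sub>R (p1 *\<^sub>R a + p2 *\<^sub>R b) + vol p x *\<^sub>R (q1 *\<^sub>R a + q2 *\<^sub>R b)"
    unfolding 1 by (simp add: scaleR_right_distrib scaleR_left_distrib)
  finally show ?thesis
    using *(1,2) by simp
qed

lemma vol_nondegenerate:
  assumes "y \<noteq> 0" obtains z where "vol z y = 1"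
proof -
  obtain a b where ab: "vol a b \<noteq> 0"
    using area_form by (auto simp: area_form_def)
  have "vol a y \<noteq> 0 \<or> vol b y \<noteq> 0"
    using cramer[of a b y] ab assms vol_skew[of b y] by auto
  then obtain z where "vol z y \<noteq> 0" by blast
  then have "vol ((1 / vol z y) *\<^sub>R z) y = 1"
    by (simp add: vol.scaleR_left)
  then show ?thesis using that by blast
qed

lemma parallel_if_vol_zero:
  assumes "vol x y = 0" "y \<noteq> 0" obtains c where "x = c *\<^sub>R y"
proof -
  obtain z where "vol z y = 1" using vol_nondegenerate[OF assms(2)] .
  then show ?thesis using cramer[of z y x] assms that by auto
qed

lemma unit_frame: obtains u1 u2 where "vol u1 u2 = 1"
proof -
  obtain a b where "vol a b \<noteq> 0"
    using area_form by (auto simp: area_form_def)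
  then have "b \<noteq> 0" by (auto simp: vol.zero_right)
  then show ?thesis using vol_nondegenerate that by blast
qed

text \<open>Applying \<open>h\<close> to the expansion of \<open>x\<close> in a unit frame shows the
  representing vector.\<close>

lemma linear_functional_vol:
  assumes "linear h" obtains w where "\<And>x. h x = vol x w"
proof -
  obtain p q where pq: "vol p q = 1" using unit_frame .
  have "h x = vol x (h p *\<^sub>R q - h q *\<^sub>R p)" for x
  proof -
    have "h x = h (vol x q *\<^sub>R p + vol p x *\<^sub>R q)"
      using cramer[of p q x] pq by simp
    also have "\<dots> = vol x q * h p + vol p x * h q"
      using assms by (simp add: linear_add linear_scale)
    finally show ?thesis
      using vol_skew[of p x] by (simp add: vol_simps algebra_simps)
  qed
  then show ?thesis using that by blast
qed

declare vol.continuous_on [continuous_intros]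

lemma vol_separates: assumes "\<And>x. vol x y = vol x z" shows "y = z"
proof (rule ccontr)
  assume "y \<noteq> z"
  then obtain x where "vol x (y - z) = 1" using vol_nondegenerate[of "y - z"] by auto
  then show False using assms[of x] by (simp add: vol.diff_right)
qed

lemma aff_dim_interior: "interior S \<noteq> {} \<Longrightarrow> aff_dim (S :: 'b set) = 2"
  using aff_dim_nonempty_interior[of S] dim2 by simp

text \<open>Supporting and separating hyperplanes come with an inner product normal; this turns them
  into functionals of the form \<open>vol x n\<close>.\<close>

lemma inner_vol:
  assumes "a \<noteq> 0" obtains n where "n \<noteq> 0" "\<And>x. a \<bullet> x = vol x n"
proof -
  have "linear (\<lambda>x. a \<bullet> x)"
    by (intro linearI) (simp_all add: inner_add_right)
  then obtain n where n: "\<And>x. a \<bullet> x = vol x n"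
    using linear_functional_vol by metis
  moreover have "n \<noteq> 0" using assms n[of a] by (auto simp: vol.zero_right)
  ultimately show ?thesis using that by blast
qed

lemma supporting_vol:
  assumes "convex S" "x \<in> S" "x \<in> frontier S" "interior S \<noteq> {}"
  obtains n where "n \<noteq> 0" "\<And>y. y \<in> S \<Longrightarrow> vol x n \<le> vol y n"
proof -
  have "x \<notin> rel_interior S"
    using assms(3,4) rel_interior_nonempty_interior by (auto simp: frontier_def)
  then obtain a where "a \<noteq> 0" "\<And>y. y \<in> S \<Longrightarrow> a \<bullet> x \<le> a \<bullet> y"
    using supporting_hyperplane_rel_boundary[OF assms(1,2)] by metis
  then show ?thesis using that inner_vol by metis
qed

lemma empty_interior_vol:
  assumes "convex S" "interior S = {}"
  obtains n k where "n \<noteq> 0" "\<And>x. x \<in> S \<Longrightarrow> vol x n = k"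
proof -
  obtain a b where ab: "a \<noteq> 0" "S \<subseteq> {x. a \<bullet> x = b}"
    using empty_interior_subset_hyperplane[OF assms] by metis
  obtain n where "n \<noteq> 0" and n: "\<And>x. a \<bullet> x = vol x n" using inner_vol[OF ab(1)] by blast
  then show ?thesis using that[of n b] n ab(2) by (simp add: subset_iff)
qed

lemma interior_vol_less:
  assumes "x \<in> interior S" "n \<noteq> 0" "\<And>z. z \<in> S \<Longrightarrow> vol z n \<le> k"
  shows "vol x n < k"
proof -
  obtain u where u: "vol u n = 1" using vol_nondegenerate[OF assms(2)] .
  have "\<forall>\<^sub>F t in at_right (0::real). x + t *\<^sub>R u \<in> interior S"
    by (rule topological_tendstoD[OF scaleR_at_right_tendsto open_interior assms(1)])
  then obtain t where t: "t > 0" "x + t *\<^sub>R u \<in> interior S" by (rule eventually_at_right_0D)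
  then have "vol (x + t *\<^sub>R u) n \<le> k" using assms(3) interior_subset by blast
  then show ?thesis using t u by (simp add: vol_simps)
qed

text \<open>Bounds on two independent functionals bound the norm; this serves the compactness of
  subgradient sets and the coercivity estimate on the dual polygon.\<close>

lemma two_functionals_bounded:
  assumes "vol p q = 1"
  shows "norm x \<le> \<bar>vol x q\<bar> * norm p + \<bar>vol p x\<bar> * norm q"
proof -
  have "norm x = norm (vol x q *\<^sub>R p + vol p x *\<^sub>R q)" using cramer[of p q x] assms by simp
  also have "\<dots> \<le> norm (vol x q *\<^sub>R p) + norm (vol p x *\<^sub>R q)" by (rule norm_triangle_ineq)
  finally show ?thesis by simp
qed

end

lemma closed_affine_image:
  fixes d :: "'b::euclidean_space"
  assumes "d \<noteq> 0" "closed T"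
  shows "closed ((\<lambda>t::real. p + t *\<^sub>R d) ` T)"
proof -
  have "closed ((\<lambda>t::real. t *\<^sub>R d) ` T)"
    using assms by (intro closed_injective_linear_image) (auto simp: inj_def intro: linearI scaleR_left_distrib)
  then have "closed ((+) p ` (\<lambda>t::real. t *\<^sub>R d) ` T)" by (rule closed_translation)
  then show ?thesis by (simp add: image_image)
qed

section \<open>Convexity from local midpoint convexity\<close>

text \<open>Maximum principle: at a positive maximum the midpoint inequality forces equality at both
  neighbours, so the leftmost maximum point could be moved further to the left.\<close>

lemma midpoint_local_imp_below_chord:
  fixes h :: "real \<Rightarrow> real"
  assumes cont: "continuous_on {0..1} h" and ends: "h 0 = 0" "h 1 = 0"
    and mid: "\<And>t. 0 < t \<Longrightarrow> t < 1 \<Longrightarrow> \<forall>\<^sub>F e in at_right 0. 2 * h t \<le> h (t + e) + h (t - e)"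
    and t: "t \<in> {0..1}"
  shows "h t \<le> 0"
proof (rule ccontr)
  assume "\<not> h t \<le> 0"
  obtain m where m: "m \<in> {0..1}" "\<And>s. s \<in> {0..1} \<Longrightarrow> h s \<le> h m"
    using continuous_attains_sup[OF compact_Icc _ cont] by auto
  then have pos: "h m > 0" using \<open>\<not> h t \<le> 0\<close> t by force
  let ?S = "{s \<in> {0..1}. h s = h m}"
  have "closed ?S"
    by (rule continuous_closed_preimage_constant[OF cont]) simp
  moreover have "bounded ?S" by (rule bounded_subset[of "{0..1}"]) auto
  ultimately have "compact ?S" by (simp add: compact_eq_bounded_closed)
  then obtain s where s: "s \<in> ?S" "\<And>r. r \<in> ?S \<Longrightarrow> s \<le> r"
    using compact_attains_inf[of ?S] m by blast
  have hs: "h s = h m" "0 \<le> s" "s \<le> 1" using s(1) by auto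
  have "s \<noteq> 0" "s \<noteq> 1" using hs(1) pos ends by force+
  then have s01: "0 < s" "s < 1" using hs by auto
  have "\<forall>\<^sub>F e in at_right (0::real). e \<in> {0<..<min s (1 - s)}"
    using s01 by (intro eventually_at_right_real) auto
  with mid[OF s01] have "\<forall>\<^sub>F e in at_right (0::real). e \<in> {0<..<min s (1 - s)} \<and> 2 * h s \<le> h (s + e) + h (s - e)"
    by eventually_elim auto
  then obtain e where e: "e \<in> {0<..<min s (1 - s)}" "2 * h s \<le> h (s + e) + h (s - e)"
    using eventually_happens'[OF trivial_limit_at_right_real] by blast
  have "h (s + e) \<le> h m" "h (s - e) \<le> h m" using e m(2) by auto
  then have "h (s - e) = h m" using e(2) hs(1) by linarith
  then have "s - e \<in> ?S" using e(1) hs by auto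
  then show False using s(2)[of "s - e"] e(1) by auto
qed

text \<open>The admissible \<open>e\<close> may depend on \<open>z\<close> and \<open>d\<close>,
  which is exactly what a germ at \<open>z\<close> provides. Subtracting the chord on a segment
  reduces the claim to one variable.\<close>

lemma convex_on_if_midpoint_local:
  fixes g :: "'b::real_normed_vector \<Rightarrow> real"
  assumes cont: "continuous_on UNIV g"
    and mid: "\<And>z d. \<forall>\<^sub>F e in at_right (0::real). 2 * g z \<le> g (z + e *\<^sub>R d) + g (z - e *\<^sub>R d)"
  shows "convex_on UNIV g"
proof (rule convex_onI)
  fix t :: real and x y assume t: "0 < t" "t < 1"
  define h where "h s = g (x + s *\<^sub>R (y - x)) - ((1 - s) * g x + s * g y)" for s
  have "h t \<le> 0"
  proof (rule midpoint_local_imp_below_chord[where h = h])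
    show "continuous_on {0..1} h" unfolding h_def
      by (intro continuous_intros continuous_on_compose2[OF cont]) auto
    show "\<forall>\<^sub>F e in at_right 0. 2 * h s \<le> h (s + e) + h (s - e)" for s
      using mid[of "x + s *\<^sub>R (y - x)" "y - x"]
    proof eventually_elim
      case (elim e)
      have "x + (s + e) *\<^sub>R (y - x) = x + s *\<^sub>R (y - x) + e *\<^sub>R (y - x)"
        "x + (s - e) *\<^sub>R (y - x) = x + s *\<^sub>R (y - x) - e *\<^sub>R (y - x)"
        by (simp_all add: scaleR_left_distrib scaleR_left_diff_distrib)
      then show ?case using elim unfolding h_def
        by (simp add: left_diff_distrib distrib_right add.assoc add_diff_eq)
    qed
  qed (use t in \<open>auto simp: h_def\<close>)
  moreover have "x + t *\<^sub>R (y - x) = (1 - t) *\<^sub>R x + t *\<^sub>R y" by (simp add: algebra_simps)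
  ultimately show "g ((1 - t) *\<^sub>R x + t *\<^sub>R y) \<le> (1 - t) * g x + t * g y"
    by (simp add: h_def)
qed simp

section \<open>Germs of piecewise linear functions\<close>

context area_plane
begin

text \<open>Germs are taken modulo affine functions: \<open>k\<close> records only how
  \<open>f\<close> bends at \<open>z\<close>. This makes the contributions of different cells
  additive without tracking their slopes.\<close>

definition germ :: "('b \<Rightarrow> real) \<Rightarrow> 'b \<Rightarrow> ('b \<Rightarrow> real) \<Rightarrow> bool" where
  "germ f z k \<longleftrightarrow> (\<exists>c w. \<forall>\<^sub>F d in nhds 0. f (z + d) = c + vol w d + k d)"

text \<open>The elementary bend along the line of \<open>t\<close>; its subgradients at 0 form the
  segment from 0 to \<open>t\<close>.\<close>

definition kink :: "'b \<Rightarrow> 'b \<Rightarrow> real" where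
  "kink t d = max 0 (vol t d)"

text \<open>Modulo affine functions the bend does not depend on the orientation of the line, so an
  edge bends the function in the same way seen from either end.\<close>

lemma kink_minus: "kink (- t) d = kink t d - vol t d"
  by (auto simp: kink_def vol.minus_left)

lemma kink_zero [simp]: "kink t 0 = 0"
  by (simp add: kink_def vol.zero_right)

lemma kink_nonneg: "0 \<le> kink t d"
  by (simp add: kink_def)

lemma germI: "\<forall>\<^sub>F d in nhds 0. f (z + d) = c + vol w d + k d \<Longrightarrow> germ f z k"
  unfolding germ_def by blast

lemma germ_add:
  assumes "germ f z k" "germ f' z k'"
  shows "germ (\<lambda>x. f x + f' x) z (\<lambda>d. k d + k' d)"
proof -
  obtain c w c' w' where
    "\<forall>\<^sub>F d in nhds 0. f (z + d) = c + vol w d + k d"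
    "\<forall>\<^sub>F d in nhds 0. f' (z + d) = c' + vol w' d + k' d"
    using assms unfolding germ_def by blast
  then have "\<forall>\<^sub>F d in nhds 0. f (z + d) + f' (z + d) = (c + c') + vol (w + w') d + (k d + k' d)"
    by eventually_elim (simp add: vol_simps)
  then show ?thesis by (rule germI)
qed

lemma germ_scale:
  assumes "germ f z k"
  shows "germ (\<lambda>x. r * f x) z (\<lambda>d. r * k d)"
proof -
  obtain c w where
    "\<forall>\<^sub>F d in nhds 0. f (z + d) = c + vol w d + k d"
    using assms unfolding germ_def by blast
  then have "\<forall>\<^sub>F d in nhds 0. r * f (z + d) = r * c + vol (r *\<^sub>R w) d + r * k d"
    by eventually_elim (simp add: vol_simps algebra_simps)
  then show ?thesis by (rule germI)
qed

lemma germ_zero: "germ (\<lambda>_. 0) z (\<lambda>_. 0)"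
  by (rule germI[of _ _ 0 0]) (simp add: vol.zero_left)

lemma germ_sum:
  assumes "\<And>i. i \<in> I \<Longrightarrow> germ (f i) z (k i)"
  shows "germ (\<lambda>x. \<Sum>i\<in>I. f i x) z (\<lambda>d. \<Sum>i\<in>I. k i d)"
  using assms by (induction I rule: infinite_finite_induct) (auto simp: germ_zero intro!: germ_add)

lemma germ_diff:
  assumes "germ f z k" "germ f' z k'"
  shows "germ (\<lambda>x. f x - f' x) z (\<lambda>d. k d - k' d)"
  using germ_add[OF assms(1) germ_scale[OF assms(2), of "-1"]] by simp

lemma germ_change:
  assumes "germ f z k" "\<And>d. k d = vol w d + k' d"
  shows "germ f z k'"
proof -
  obtain c w' where
    "\<forall>\<^sub>F d in nhds 0. f (z + d) = c + vol w' d + k d"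
    using assms unfolding germ_def by blast
  then have "\<forall>\<^sub>F d in nhds 0. f (z + d) = c + vol (w' + w) d + k' d"
    by eventually_elim (simp add: vol_simps assms(2))
  then show ?thesis by (rule germI)
qed

lemma germ_cong: "germ f z k \<Longrightarrow> (\<And>d. k d = k' d) \<Longrightarrow> germ f z k'"
  using germ_change[of f z k 0 k'] by (simp add: vol.zero_left)

lemma germ_value:
  assumes "germ f z k" "k 0 = 0"
  obtains w where "\<forall>\<^sub>F d in nhds 0. f (z + d) = f z + vol w d + k d"
proof -
  obtain c w where ev: "\<forall>\<^sub>F d in nhds 0. f (z + d) = c + vol w d + k d"
    using assms unfolding germ_def by blast
  then have "f (z + 0) = c + vol w 0 + k 0" by (rule eventually_nhds_x_imp_x)
  then have "c = f z" using assms(2) by (simp add: vol.zero_right)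
  then show ?thesis using ev that by blast
qed

lemma eventually_shift_pos:
  assumes "continuous_on UNIV h" "h (z::'b) > (0::real)"
  shows "\<forall>\<^sub>F d in nhds 0. h (z + d) > 0"
proof -
  have "((\<lambda>d. h (z + d)) \<longlongrightarrow> h (z + 0)) (nhds 0)"
  proof -
    have "continuous_on UNIV (\<lambda>d. h (z + d))"
      by (intro continuous_on_compose2[OF assms(1)] continuous_intros) auto
    then have "isCont (\<lambda>d. h (z + d)) 0"
      by (simp add: continuous_on_eq_continuous_at)
    then show ?thesis
      using tendsto_at_iff_tendsto_nhds[of "\<lambda>d. h (z + d)" 0] by (simp only: isCont_def)
  qed
  then show ?thesis using assms(2) by (intro order_tendstoD) auto
qed

subsection \<open>Functions bent along a ray\<close>

text \<open>The direction \<open>s\<close> plays the role of the vertical; \<open>hgt s t x\<close> is the height of \<open>x\<close> above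
  the line spanned by \<open>t\<close>, scaled so that its differential is \<open>\<plusminus> vol t\<close>.\<close>

definition hgt :: "'b \<Rightarrow> 'b \<Rightarrow> 'b \<Rightarrow> real" where
  "hgt s t x = - sgn (vol s t) * vol t x"

text \<open>The region above a ray, with weight \<open>1/2\<close> on the vertical line through its origin; with
  this normalisation the sum over a balanced star is affine along the vertical above the centre.\<close>

definition above_ray :: "'b \<Rightarrow> 'b \<Rightarrow> 'b \<Rightarrow> real" where
  "above_ray s t x = (1 + sgn (vol s x) * sgn (vol s t)) / 2 * max 0 (hgt s t x)"

definition on_ray :: "'b \<Rightarrow> 'b \<Rightarrow> bool" where
  "on_ray t x \<longleftrightarrow> (\<exists>c>0. x = c *\<^sub>R t)"

lemma hgt_cont: "continuous_on UNIV (\<lambda>x. hgt s t (x - p))"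
  unfolding hgt_def by (intro continuous_intros)

text \<open>Off the line one branch of the maximum persists. On it the function is
  \<open>kink t\<close> or \<open>kink (- t)\<close>, according to the sign of
  \<open>vol s t\<close>, and these agree modulo affine functions.\<close>

lemma germ_halfplane:
  assumes "vol s t \<noteq> 0"
  shows "germ (\<lambda>x. max 0 (hgt s t (x - p))) z (\<lambda>d. if vol t (z - p) = 0 then kink t d else 0)"
proof -
  let ?h = "hgt s t (z - p)"
  have h: "hgt s t (z + d - p) = ?h + vol (- sgn (vol s t) *\<^sub>R t) d" for d
    by (simp add: hgt_def vol_simps algebra_simps)
  consider "?h > 0" | "?h < 0" | "?h = 0" by linarith
  then show ?thesis
  proof cases
    case 1
    have "\<forall>\<^sub>F d in nhds 0. hgt s t (z + d - p) > 0"
      using eventually_shift_pos[OF hgt_cont 1] by simp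
    then have "\<forall>\<^sub>F d in nhds 0. max 0 (hgt s t (z + d - p)) = ?h + vol (- sgn (vol s t) *\<^sub>R t) d + 0"
      by eventually_elim (simp add: h)
    moreover have "vol t (z - p) \<noteq> 0" using 1 by (auto simp: hgt_def)
    ultimately show ?thesis using germI by simp
  next
    case 2
    have ev: "\<forall>\<^sub>F d in nhds 0. - hgt s t (z + d - p) > 0"
      by (rule eventually_shift_pos[where h = "\<lambda>x. - hgt s t (x - p)"])
         (use 2 in \<open>auto intro!: continuous_intros hgt_cont\<close>)
    have "germ (\<lambda>x. max 0 (hgt s t (x - p))) z (\<lambda>_. 0)"
      by (rule germI[where c = 0 and w = 0]) (use ev in eventually_elim, simp add: vol.zero_left)
    moreover have "vol t (z - p) \<noteq> 0" using 2 by (auto simp: hgt_def)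
    ultimately show ?thesis by simp
  next
    case 3
    then have 0: "vol t (z - p) = 0" using assms by (simp add: hgt_def sgn_zero_iff)
    have *: "max 0 (hgt s t (z + d - p)) = 0 + vol (if vol s t > 0 then - t else 0) d + kink t d" for d
      using assms 3 h[of d] by (auto simp: hgt_def kink_def sgn_real_def vol_simps)
    show ?thesis using 0 germI[OF always_eventually, of _ _ 0 "if vol s t > 0 then - t else 0" "kink t"] * by simp
  qed
qed

text \<open>Away from the vertical through \<open>p\<close> the weight is locally constant, 1 on the
  side of the ray and 0 on the other, so of the bend of the half-plane only the part along the ray
  survives.\<close>

lemma germ_above_ray:
  assumes st: "vol s t \<noteq> 0" and sz: "vol s (z - p) \<noteq> 0"
  shows "germ (\<lambda>x. above_ray s t (x - p)) z (\<lambda>d. if on_ray t (z - p) then kink t d else 0)"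
proof -
  have ev: "\<forall>\<^sub>F d in nhds 0. sgn (vol s (z + d - p)) = sgn (vol s (z - p))"
  proof -
    have "\<forall>\<^sub>F d in nhds 0. sgn (vol s (z - p)) * vol s (z + d - p) > 0"
      by (rule eventually_shift_pos[where h = "\<lambda>x. sgn (vol s (z - p)) * vol s (x - p)"])
         (use sz in \<open>auto intro!: continuous_intros simp: sgn_real_def\<close>)
    then show ?thesis
      by eventually_elim (auto simp: sgn_real_def split: if_splits)
  qed
  have ray: "on_ray t (z - p) \<longleftrightarrow> vol t (z - p) = 0 \<and> sgn (vol s (z - p)) = sgn (vol s t)"
  proof
    assume "on_ray t (z - p)"
    then show "vol t (z - p) = 0 \<and> sgn (vol s (z - p)) = sgn (vol s t)"
      by (auto simp: on_ray_def vol.scaleR_right sgn_mult)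
  next
    assume a: "vol t (z - p) = 0 \<and> sgn (vol s (z - p)) = sgn (vol s t)"
    have "t \<noteq> 0" using st by (auto simp: vol.zero_right)
    then obtain c where c: "z - p = c *\<^sub>R t"
      using a vol_skew[of t "z - p"] parallel_if_vol_zero[of "z - p" t] by auto
    then have "c > 0" using a st
      by (auto simp: vol.scaleR_right sgn_real_def zero_less_mult_iff mult_less_0_iff split: if_splits)
    then show "on_ray t (z - p)" using c by (auto simp: on_ray_def)
  qed
  show ?thesis
  proof (cases "sgn (vol s (z - p)) = sgn (vol s t)")
    case True
    have 1: "sgn (vol s t) * sgn (vol s t) = 1" using st by (simp add: sgn_real_def)
    obtain c w where "\<forall>\<^sub>F d in nhds 0. max 0 (hgt s t (z + d - p)) = c + vol w d + (if vol t (z - p) = 0 then kink t d else 0)"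
      using germ_halfplane[OF st, of p z] unfolding germ_def by blast
    with ev have "\<forall>\<^sub>F d in nhds 0. above_ray s t (z + d - p) = c + vol w d + (if vol t (z - p) = 0 then kink t d else 0)"
      by eventually_elim (simp add: above_ray_def True 1 st)
    then show ?thesis using ray True by (auto intro: germI)
  next
    case False
    have 1: "sgn (vol s (z - p)) * sgn (vol s t) = - 1" using False st sz by (auto simp: sgn_real_def split: if_splits)
    have "germ (\<lambda>x. above_ray s t (x - p)) z (\<lambda>_. 0)"
      by (rule germI[where c = 0 and w = 0])
        (use ev in eventually_elim, simp add: above_ray_def 1 vol.zero_left)
    then show ?thesis using ray False by simp
  qed
qed

subsection \<open>The function of a balanced star\<close>

definition star_fun :: "'b \<Rightarrow> ('e \<Rightarrow> 'b) \<Rightarrow> 'e set \<Rightarrow> 'b \<Rightarrow> real" where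
  "star_fun s t I x = (\<Sum>i\<in>I. above_ray s (t i) x)"

text \<open>The critical points lie on the vertical through the centre. Below the centre all heights
  are negative and the sum vanishes. Above it all heights are positive, and each summand is half its
  height minus \<open>sgn (vol s x) / 2 * vol (t i) x\<close>; the terms that jump have a common
  sign factor, and by balancing they add up to zero.\<close>

lemma germ_star_fun:
  assumes st: "\<And>i. i \<in> I \<Longrightarrow> vol s (t i) \<noteq> 0" and bal: "(\<Sum>i\<in>I. t i) = 0" and fin: "finite I"
    and zp: "z \<noteq> p"
  shows "germ (\<lambda>x. star_fun s t I (x - p)) z (\<lambda>d. \<Sum>i\<in>I. if on_ray (t i) (z - p) then kink (t i) d else 0)"
proof (cases "vol s (z - p) = 0")
  case False
  then show ?thesis unfolding star_fun_def
    by (intro germ_sum germ_above_ray st)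
next
  case True
  show ?thesis
  proof (cases "I = {}")
    case True
    then show ?thesis by (simp add: star_fun_def germ_zero)
  next
    case False
    then have "s \<noteq> 0" using st by (auto simp: vol.zero_left)
    then obtain k where k: "z - p = k *\<^sub>R s"
      using True vol_skew[of s "z - p"] parallel_if_vol_zero[of "z - p" s] by auto
    then have k0: "k \<noteq> 0" using zp by auto
    have off: "\<not> on_ray (t i) (z - p)" if "i \<in> I" for i
    proof
      assume "on_ray (t i) (z - p)"
      then obtain c where "c > 0" "k *\<^sub>R s = c *\<^sub>R t i" using k by (auto simp: on_ray_def)
      then have "vol s (c *\<^sub>R t i) = 0" by (metis vol.scaleR_right vol_self scaleR_zero_right)
      then show False using \<open>c > 0\<close> st[OF that] by (simp add: vol_simps)
    qed
    have hk: "hgt s (t i) (z - p) = k * \<bar>vol s (t i)\<bar>" for i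
      using vol_skew[of "t i" s] by (simp add: hgt_def k vol_simps sgn_real_def abs_if)
    have "germ (\<lambda>x. star_fun s t I (x - p)) z (\<lambda>d. 0)"
    proof (cases "k > 0")
      case True
      have "\<forall>\<^sub>F d in nhds 0. hgt s (t i) (z + d - p) > 0" if "i \<in> I" for i
        by (rule eventually_shift_pos[OF hgt_cont]) (use hk st[OF that] True in auto)
      then have "\<forall>\<^sub>F d in nhds 0. \<forall>i\<in>I. hgt s (t i) (z + d - p) > 0"
        using fin by (simp add: eventually_ball_finite_distrib)
      then have "\<forall>\<^sub>F d in nhds 0. star_fun s t I (z + d - p) =
         (\<Sum>i\<in>I. hgt s (t i) (z - p) / 2) + vol (\<Sum>i\<in>I. (- sgn (vol s (t i)) / 2) *\<^sub>R t i) d + 0"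
      proof eventually_elim
        case (elim d)
        let ?x = "z + d - p"
        have "star_fun s t I ?x = (\<Sum>i\<in>I. hgt s (t i) ?x / 2 - sgn (vol s ?x) / 2 * vol (t i) ?x)"
          unfolding star_fun_def
        proof (rule sum.cong[OF refl])
          fix i assume i: "i \<in> I"
          have "sgn (vol s (t i)) * sgn (vol s (t i)) = 1" using st[OF i] by (simp add: sgn_real_def)
          then have "sgn (vol s (t i)) * hgt s (t i) ?x = - vol (t i) ?x"
            unfolding hgt_def by (metis mult.assoc mult_minus_left mult_minus_right mult_1)
          moreover have "above_ray s (t i) ?x = hgt s (t i) ?x / 2 + sgn (vol s ?x) / 2 * (sgn (vol s (t i)) * hgt s (t i) ?x)"
          proof -
            have "max 0 (hgt s (t i) ?x) = hgt s (t i) ?x" using elim i by (simp add: less_imp_le)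
            then show ?thesis unfolding above_ray_def by (simp only:) (simp add: field_simps)
          qed
          ultimately show "above_ray s (t i) ?x = hgt s (t i) ?x / 2 - sgn (vol s ?x) / 2 * vol (t i) ?x"
            by simp
        qed
        also have "\<dots> = (\<Sum>i\<in>I. hgt s (t i) ?x / 2) - sgn (vol s ?x) / 2 * (\<Sum>i\<in>I. vol (t i) ?x)"
          by (simp add: sum_subtractf sum_distrib_left)
        also have "(\<Sum>i\<in>I. vol (t i) ?x) = 0"
          by (simp add: bal vol.zero_left flip: vol.sum_left)
        also have "(\<Sum>i\<in>I. hgt s (t i) ?x / 2) = (\<Sum>i\<in>I. hgt s (t i) (z - p) / 2) + vol (\<Sum>i\<in>I. (- sgn (vol s (t i)) / 2) *\<^sub>R t i) d"
          unfolding vol.sum_left sum.distrib[symmetric]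
          by (intro sum.cong) (auto simp: hgt_def vol_simps field_simps)
        finally show ?case by simp
      qed
      then show ?thesis by (rule germI)
    next
      case False
      have "\<forall>\<^sub>F d in nhds 0. - hgt s (t i) (z + d - p) > 0" if "i \<in> I" for i
        by (rule eventually_shift_pos[where h = "\<lambda>x. - hgt s (t i) (x - p)"])
           (use hk st[OF that] False k0 in \<open>auto simp: mult_less_0_iff intro!: continuous_intros hgt_cont\<close>)
      then have "\<forall>\<^sub>F d in nhds 0. \<forall>i\<in>I. - hgt s (t i) (z + d - p) > 0"
        using fin by (simp add: eventually_ball_finite_distrib)
      then have "\<forall>\<^sub>F d in nhds 0. star_fun s t I (z + d - p) = 0 + vol 0 d + 0"
        by eventually_elim (auto simp: star_fun_def above_ray_def vol.zero_left intro!: sum.neutral)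
      then show ?thesis by (rule germI)
    qed
    then show ?thesis using off by (auto intro: germ_cong)
  qed
qed

lemma star_fun_nonneg: "star_fun s t I x \<ge> 0"
  unfolding star_fun_def above_ray_def
  by (intro sum_nonneg mult_nonneg_nonneg) (auto simp: sgn_real_def)

lemma star_fun_zero [simp]: "star_fun s t I 0 = 0"
  by (simp add: star_fun_def above_ray_def hgt_def vol_simps)

lemma star_fun_scale: "c \<ge> 0 \<Longrightarrow> star_fun s t I (c *\<^sub>R x) = c * star_fun s t I x"
proof (cases "c = 0")
  case False
  assume "c \<ge> 0"
  with False have "c > 0" by simp
  then show ?thesis
    by (auto simp: star_fun_def above_ray_def hgt_def vol_simps sgn_mult sum_distrib_left max_def
        mult_le_0_iff zero_le_mult_iff mult_less_0_iff intro!: sum.cong)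
qed (simp add: star_fun_def above_ray_def hgt_def vol_simps)

text \<open>The weight jumps across the vertical, and \<open>germ_star_fun\<close> excludes the
  centre; this bound is what gives continuity there.\<close>

lemma star_fun_le: "star_fun s t I x \<le> (\<Sum>i\<in>I. \<bar>vol (t i) x\<bar>)"
  unfolding star_fun_def
proof (rule sum_mono)
  fix i
  have "max 0 (hgt s (t i) x) \<le> \<bar>vol (t i) x\<bar>" by (auto simp: hgt_def sgn_real_def)
  moreover have "(1 + sgn (vol s x) * sgn (vol s (t i))) / 2 \<le> 1" "0 \<le> (1 + sgn (vol s x) * sgn (vol s (t i))) / 2"
    by (auto simp: sgn_real_def)
  ultimately show "above_ray s (t i) x \<le> \<bar>vol (t i) x\<bar>"
    unfolding above_ray_def by (metis mult_mono mult_1 max.cobounded1 zero_le_one abs_ge_zero)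
qed

text \<open>The linear parts at two opposite displacements cancel, which leaves the nonnegative
  bends.\<close>

lemma germ_midpoint:
  assumes "germ f z k" "k 0 = 0" "\<And>d. k d \<ge> 0"
  shows "\<forall>\<^sub>F e in at_right (0::real). 2 * f z \<le> f (z + e *\<^sub>R d) + f (z - e *\<^sub>R d)"
proof -
  obtain w where ev: "\<forall>\<^sub>F d in nhds 0. f (z + d) = f z + vol w d + k d"
    using germ_value[OF assms(1,2)] .
  have lim: "((\<lambda>e::real. e *\<^sub>R d) \<longlongrightarrow> 0) (at_right 0)" for d :: 'b
    using scaleR_at_right_tendsto[of 0 d] by simp
  have "\<forall>\<^sub>F e in at_right (0::real). f (z + e *\<^sub>R d) = f z + vol w (e *\<^sub>R d) + k (e *\<^sub>R d)"
    "\<forall>\<^sub>F e in at_right (0::real). f (z + e *\<^sub>R (-d)) = f z + vol w (e *\<^sub>R (-d)) + k (e *\<^sub>R (-d))"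
    using eventually_compose_filterlim[OF ev lim] by blast+
  then show ?thesis
  proof eventually_elim
    case (elim e)
    then show ?case using assms(3)[of "e *\<^sub>R d"] assms(3)[of "e *\<^sub>R (- d)"] by (simp add: vol_simps)
  qed
qed

lemma germ_isCont:
  assumes "germ f z k" "k 0 = 0" "(k \<longlongrightarrow> 0) (nhds 0)"
  shows "isCont f z"
proof -
  obtain w where ev: "\<forall>\<^sub>F d in nhds 0. f (z + d) = f z + vol w d + k d"
    using germ_value[OF assms(1,2)] .
  have "((\<lambda>d. vol w d) \<longlongrightarrow> vol w 0) (nhds 0)"
    by (intro vol.tendsto tendsto_intros filterlim_ident)
  then have "((\<lambda>d. f z + vol w d + k d) \<longlongrightarrow> f z + 0 + 0) (nhds 0)"
    by (intro tendsto_intros assms(3)) (simp add: vol.zero_right)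
  then have "((\<lambda>d. f (z + d)) \<longlongrightarrow> f z) (nhds 0)"
    using tendsto_cong[OF ev] by simp
  then have "(\<lambda>d. f (z + d)) \<midarrow>0\<rightarrow> f z"
    by (rule tendsto_mono[rotated]) (simp add: at_within_le_nhds)
  then show ?thesis by (simp add: isCont_iff)
qed

lemma kink_tendsto: "(kink t \<longlongrightarrow> 0) (nhds 0)"
proof -
  have "((\<lambda>d. max 0 (vol t d)) \<longlongrightarrow> max 0 (vol t 0)) (nhds 0)"
    by (intro vol.tendsto tendsto_intros filterlim_ident)
  then show ?thesis by (simp add: kink_def[abs_def] vol.zero_right)
qed

lemma star_fun_tendsto: "(star_fun s t I \<longlongrightarrow> 0) (nhds 0)"
proof (rule tendsto_sandwich[where f = "\<lambda>_. 0"])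
  have "((\<lambda>x. \<Sum>i\<in>I. \<bar>vol (t i) x\<bar>) \<longlongrightarrow> (\<Sum>i\<in>I. \<bar>vol (t i) 0\<bar>)) (nhds 0)"
    by (intro tendsto_intros vol.tendsto filterlim_ident)
  then show "((\<lambda>x. \<Sum>i\<in>I. \<bar>vol (t i) x\<bar>) \<longlongrightarrow> 0) (nhds 0)" by (simp add: vol.zero_right)
qed (auto intro: always_eventually star_fun_nonneg star_fun_le)

text \<open>In the pencil of directions \<open>p + k q\<close> each nonzero vector excludes at most
  one value of \<open>k\<close>.\<close>

lemma exists_transversal:
  assumes "finite T" "0 \<notin> T"
  shows "\<exists>s. \<forall>t\<in>T. vol s t \<noteq> 0"
proof -
  obtain p q where pq: "vol p q = 1" using unit_frame .
  have nz: "vol p t \<noteq> 0 \<or> vol q t \<noteq> 0" if "t \<in> T" for t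
    using cramer[of p q t] pq vol_skew[of t q] that assms(2) by (metis add.right_neutral minus_zero scaleR_one scaleR_zero_left)
  \<comment> \<open>When \<open>vol q t = 0\<close> the quotient is 0 by convention. This excludes
    \<open>k = 0\<close> without harm, since no member of the pencil is parallel to such a
    \<open>t\<close>.\<close>
  let ?bad = "(\<lambda>t. - vol p t / vol q t) ` T"
  have "finite ?bad" using assms by simp
  then obtain k where k: "k \<notin> ?bad" using ex_new_if_finite[OF infinite_UNIV_char_0] by blast
  have "vol (p + k *\<^sub>R q) t \<noteq> 0" if "t \<in> T" for t
  proof
    assume 0: "vol (p + k *\<^sub>R q) t = 0"
    then have e: "vol p t + k * vol q t = 0" by (simp add: vol_simps)
    then have "vol q t \<noteq> 0" using nz[OF that] by auto
    then have "k = - vol p t / vol q t" using e by (simp add: field_simps)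
    then show False using k that by blast
  qed
  then show ?thesis by blast
qed

end

section \<open>Balanced graphs embedded in the plane\<close>

text \<open>Cells are parametrised from each of their ends by the momentum at that end, and
  \<open>len\<close> measures an edge in units of its momentum; on legs \<open>len\<close> carries
  no information. The last three assumptions express injectivity on vertices and open cells. Two
  parameters on one cell need no separate condition because momenta are nonzero.\<close>

locale plane_graph = area_plane vol for vol :: "'b::euclidean_space \<Rightarrow> 'b \<Rightarrow> real" +
  fixes V :: "'v set" and E L :: "'e set" and ends :: "'e \<Rightarrow> 'v set"
    and pos :: "'v \<Rightarrow> 'b" and tau :: "'v \<Rightarrow> 'e \<Rightarrow> 'b" and len :: "'e \<Rightarrow> real"
  assumes finite_V: "finite V" and finite_E: "finite E" and finite_L: "finite L"
    and V_nonempty: "V \<noteq> {}"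
    and disjoint_EL: "E \<inter> L = {}"
    and ends_subset: "e \<in> E \<union> L \<Longrightarrow> ends e \<subseteq> V"
    and ends_edge: "e \<in> E \<Longrightarrow> \<exists>v w. v \<noteq> w \<and> ends e = {v, w}"
    and ends_leg: "e \<in> L \<Longrightarrow> \<exists>v. ends e = {v}"
    and edge_vector: "e \<in> E \<Longrightarrow> v \<noteq> w \<Longrightarrow> ends e = {v, w} \<Longrightarrow>
      len e > 0 \<and> pos w = pos v + len e *\<^sub>R tau v e \<and> tau w e = - tau v e"
    and balanced: "v \<in> V \<Longrightarrow> (\<Sum>e\<in>{e \<in> E \<union> L. v \<in> ends e}. tau v e) = 0"
    and valence: "v \<in> V \<Longrightarrow> 3 \<le> card {e \<in> E \<union> L. v \<in> ends e}"
    and tau_nonzero: "e \<in> E \<union> L \<Longrightarrow> v \<in> ends e \<Longrightarrow> tau v e \<noteq> 0"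
    and inj_pos: "inj_on pos V"
    and cell_avoids_vertex: "e \<in> E \<union> L \<Longrightarrow> v \<in> ends e \<Longrightarrow> w \<in> V \<Longrightarrow> 0 < t \<Longrightarrow> (e \<in> E \<Longrightarrow> t < len e) \<Longrightarrow>
      pos w \<noteq> pos v + t *\<^sub>R tau v e"
    and cells_disjoint: "e \<in> E \<union> L \<Longrightarrow> v \<in> ends e \<Longrightarrow> 0 < t \<Longrightarrow> (e \<in> E \<Longrightarrow> t < len e) \<Longrightarrow>
      e' \<in> E \<union> L \<Longrightarrow> v' \<in> ends e' \<Longrightarrow> 0 < t' \<Longrightarrow> (e' \<in> E \<Longrightarrow> t' < len e') \<Longrightarrow>
      pos v + t *\<^sub>R tau v e = pos v' + t' *\<^sub>R tau v' e' \<Longrightarrow> e = e'"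
begin

definition star :: "'v \<Rightarrow> 'e set" where
  "star v = {e \<in> E \<union> L. v \<in> ends e}"

definition open_cell :: "'e \<Rightarrow> 'b set" where
  "open_cell e = {pos v + t *\<^sub>R tau v e | v t. v \<in> ends e \<and> 0 < t \<and> (e \<in> E \<longrightarrow> t < len e)}"

definition support :: "'b set" where
  "support = pos ` V \<union> (\<Union>e\<in>E \<union> L. open_cell e)"

definition vert :: 'b where
  "vert = (SOME s. \<forall>t\<in>(\<Union>v\<in>V. tau v ` star v). vol s t \<noteq> 0)"

lemma finite_star: "finite (star v)"
  using finite_E finite_L by (simp add: star_def)

lemma vert_transversal: "v \<in> V \<Longrightarrow> e \<in> star v \<Longrightarrow> vol vert (tau v e) \<noteq> 0"
proof -
  have "\<exists>s. \<forall>t\<in>(\<Union>v\<in>V. tau v ` star v). vol s t \<noteq> 0"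
    using finite_V finite_star tau_nonzero by (intro exists_transversal) (auto simp: star_def)
  then have "\<forall>t\<in>(\<Union>v\<in>V. tau v ` star v). vol vert t \<noteq> 0"
    unfolding vert_def by (rule someI_ex)
  then show "v \<in> V \<Longrightarrow> e \<in> star v \<Longrightarrow> vol vert (tau v e) \<noteq> 0" by blast
qed

definition fan :: "'v \<Rightarrow> 'b \<Rightarrow> real" where
  "fan v = star_fun vert (tau v) (star v)"

text \<open>The tropical polynomial of the graph: every edge contributes the height above it on the
  vertical strip over it, written as two half-infinite strips minus the whole half-plane. The
  half-plane is split evenly between the two ends so as not to choose an orientation.\<close>

definition potential :: "'b \<Rightarrow> real" where
  "potential x = (\<Sum>v\<in>V. fan v (x - pos v)) -
     (\<Sum>e\<in>E. \<Sum>v\<in>ends e. 1 / 2 * max 0 (hgt vert (tau v e) (x - pos v)))"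

lemma ends_cases:
  assumes "e \<in> E \<union> L" "v \<in> ends e"
  obtains (edge) w where "e \<in> E" "e \<notin> L" "w \<noteq> v" "ends e = {v, w}" | (leg) "e \<in> L" "e \<notin> E" "ends e = {v}"
proof (cases "e \<in> E")
  case True
  then obtain a b where ab: "a \<noteq> b" "ends e = {a, b}" using ends_edge by blast
  have "e \<notin> L" using True disjoint_EL by blast
  consider "v = a" | "v = b" using ab assms(2) by blast
  then show ?thesis using True \<open>e \<notin> L\<close> ab edge[of a] edge[of b] by cases auto
next
  case False
  then have "e \<in> L" using assms(1) by blast
  then show ?thesis using False ends_leg[of e] assms(2) leg by auto
qed

lemma open_cell_eq:
  assumes e: "e \<in> E \<union> L" and v: "v \<in> ends e"
  shows "open_cell e = {pos v + t *\<^sub>R tau v e | t. 0 < t \<and> (e \<in> E \<longrightarrow> t < len e)}"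
  using assms
proof (cases rule: ends_cases)
  case (edge w)
  then have r: "len e > 0" "pos w = pos v + len e *\<^sub>R tau v e" "tau w e = - tau v e"
    using edge_vector[of e v w] by auto
  have "\<exists>t'. pos w + t *\<^sub>R tau w e = pos v + t' *\<^sub>R tau v e \<and> 0 < t' \<and> t' < len e" if "0 < t" "t < len e" for t
    by (rule exI[of _ "len e - t"]) (use that r in \<open>auto simp: algebra_simps\<close>)
  then show ?thesis using edge by (auto simp: open_cell_def; blast)
next
  case leg
  then show ?thesis by (auto simp: open_cell_def)
qed

text \<open>At a point of the line of an edge, both rays from the ends pass through it if it lies
  inside the edge, and only one of them otherwise. The two halved half-planes remove one kink in
  total, so exactly one kink remains inside and none outside, up to a linear function.\<close>

lemma cell_kink:
  assumes e: "e \<in> E \<union> L" and v: "v \<in> ends e"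
  shows "\<exists>w. \<forall>d. (\<Sum>u\<in>ends e. if on_ray (tau u e) (z - pos u) then kink (tau u e) d else 0) -
     (if e \<in> E then \<Sum>u\<in>ends e. 1 / 2 * (if vol (tau u e) (z - pos u) = 0 then kink (tau u e) d else 0) else 0)
     = vol w d + (if z \<in> open_cell e then kink (tau v e) d else 0)"
  using assms
proof (cases rule: ends_cases)
  case leg
  then have "on_ray (tau v e) (z - pos v) \<longleftrightarrow> z \<in> open_cell e"
    by (auto simp: open_cell_eq[OF e v] on_ray_def algebra_simps)
  then show ?thesis using leg by (intro exI[of _ 0]) (simp add: vol.zero_left)
next
  case (edge w)
  define T l where "T = tau v e" and "l = len e"
  have r: "l > 0" "pos w = pos v + l *\<^sub>R T" "tau w e = - T" "T \<noteq> 0"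
    using edge_vector[of e v w] edge tau_nonzero[OF e v] by (auto simp: T_def l_def)
  show ?thesis
  proof (cases "vol T (z - pos v) = 0")
    case False
    then have "\<not> on_ray T (z - pos v)" by (auto simp: on_ray_def vol.scaleR_right)
    moreover have "vol (- T) (z - pos w) = - vol T (z - pos v)" by (simp add: r(2) vol_simps)
    ultimately have 1: "\<not> on_ray T (z - pos v)" "vol (- T) (z - pos w) \<noteq> 0"
      using False by auto
    then have "\<not> on_ray (- T) (z - pos w)" by (metis on_ray_def vol.scaleR_right vol_self mult_zero_right scaleR_zero_right)
    moreover have "z \<notin> open_cell e"
      using 1 by (auto simp: open_cell_eq[OF e v] on_ray_def T_def)
    ultimately show ?thesis using edge 1 False
      by (intro exI[of _ 0]) (simp add: vol.zero_left r(3) flip: T_def)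
  next
    case True
    then obtain c where c: "z - pos v = c *\<^sub>R T"
      using vol_skew[of T "z - pos v"] parallel_if_vol_zero[of "z - pos v" T] r(4) by auto
    then have z: "z = pos v + c *\<^sub>R T" by (simp add: algebra_simps)
    have zw: "z - pos w = (l - c) *\<^sub>R (- T)" by (simp add: z r(2) algebra_simps)
    have "vol (- T) (z - pos w) = 0" by (simp add: zw vol_simps)
    moreover have "on_ray T (z - pos v) \<longleftrightarrow> c > 0" using c r(4) by (auto simp: on_ray_def)
    moreover have "on_ray (- T) (z - pos w) \<longleftrightarrow> c < l" using zw r(4) by (auto simp: on_ray_def)
    moreover have "z \<in> open_cell e \<longleftrightarrow> 0 < c \<and> c < l"
      using edge r(4) by (auto simp: open_cell_eq[OF e v] z simp flip: T_def l_def)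
    \<comment> \<open>Because \<open>kink (- T) d = kink T d - vol T d\<close>, the linear remainder
      is -1/2, -1/2 or 1/2 times \<open>vol T d\<close> for \<open>z\<close> before, inside or
      beyond the edge; the two coefficients encode these cases.\<close>
    ultimately have "(\<Sum>u\<in>ends e. if on_ray (tau u e) (z - pos u) then kink (tau u e) d else 0) -
     (if e \<in> E then \<Sum>u\<in>ends e. 1 / 2 * (if vol (tau u e) (z - pos u) = 0 then kink (tau u e) d else 0) else 0)
     = vol ((if c \<le> 0 then - 1 else 0) *\<^sub>R T + (if 0 < c \<and> c < l then - 1/2 else 1/2) *\<^sub>R T) d
       + (if z \<in> open_cell e then kink T d else 0)" for d
      using edge True r(1) by (auto simp: r(3) kink_minus vol_simps field_simps simp flip: T_def)
    then show ?thesis unfolding T_def by blast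
  qed
qed

lemma fan_germ:
  assumes v: "v \<in> V"
  shows "germ (\<lambda>x. fan v (x - pos v)) z (\<lambda>d. (if z = pos v then fan v d else 0) +
     (\<Sum>e\<in>star v. if on_ray (tau v e) (z - pos v) then kink (tau v e) d else 0))"
proof (cases "z = pos v")
  case True
  have "\<not> on_ray (tau v e) 0" if "e \<in> star v" for e
    using tau_nonzero[of e v] that by (auto simp: on_ray_def star_def)
  then have "(\<Sum>e\<in>star v. if on_ray (tau v e) (z - pos v) then kink (tau v e) d else 0) = 0" for d
    using True by (simp add: sum.neutral)
  moreover have "germ (\<lambda>x. fan v (x - pos v)) z (fan v)"
    by (rule germI[where c = 0 and w = 0]) (simp add: True vol.zero_left)
  ultimately show ?thesis using True by simp
next
  case False
  then show ?thesis using germ_star_fun[OF vert_transversal[OF v] balanced[OF v, folded star_def] finite_star False]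
    by (simp add: fan_def)
qed

text \<open>The sum over incident pairs is regrouped from vertices to cells, where
  \<open>cell_kink\<close> applies. \<open>eps\<close> picks the end from which each cell is seen;
  another choice changes the germ by a linear function only.\<close>

lemma potential_germ:
  assumes eps: "\<And>e. e \<in> E \<union> L \<Longrightarrow> eps e \<in> ends e"
  shows "germ potential z (\<lambda>d. (\<Sum>v\<in>V. if z = pos v then fan v d else 0) +
    (\<Sum>e\<in>E \<union> L. if z \<in> open_cell e then kink (tau (eps e) e) d else 0))"
proof -
  let ?R = "\<lambda>u e d. if on_ray (tau u e) (z - pos u) then kink (tau u e) d else 0"
  let ?H = "\<lambda>u e d. 1 / 2 * (if vol (tau u e) (z - pos u) = 0 then kink (tau u e) d else 0)"
  have "germ potential z (\<lambda>d. (\<Sum>v\<in>V. (if z = pos v then fan v d else 0) + (\<Sum>e\<in>star v. ?R v e d)) - (\<Sum>e\<in>E. \<Sum>u\<in>ends e. ?H u e d))"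
    unfolding potential_def[abs_def]
  proof (intro germ_diff germ_sum fan_germ germ_scale germ_halfplane)
    fix e v assume "e \<in> E" "v \<in> ends e"
    then show "vol vert (tau v e) \<noteq> 0"
      using vert_transversal[of v e] ends_subset[of e] by (auto simp: star_def)
  qed
  moreover have "\<forall>e\<in>E \<union> L. \<exists>w. \<forall>d. (\<Sum>u\<in>ends e. ?R u e d) - (if e \<in> E then \<Sum>u\<in>ends e. ?H u e d else 0)
     = vol w d + (if z \<in> open_cell e then kink (tau (eps e) e) d else 0)"
    using cell_kink eps by blast
  from bchoice[OF this] obtain w where w: "\<forall>e\<in>E \<union> L. \<forall>d. (\<Sum>u\<in>ends e. ?R u e d) - (if e \<in> E then \<Sum>u\<in>ends e. ?H u e d else 0)
     = vol (w e) d + (if z \<in> open_cell e then kink (tau (eps e) e) d else 0)"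
    by blast
  have "(\<Sum>v\<in>V. (if z = pos v then fan v d else 0) + (\<Sum>e\<in>star v. ?R v e d)) - (\<Sum>e\<in>E. \<Sum>u\<in>ends e. ?H u e d)
     = vol (\<Sum>e\<in>E \<union> L. w e) d + ((\<Sum>v\<in>V. if z = pos v then fan v d else 0) +
    (\<Sum>e\<in>E \<union> L. if z \<in> open_cell e then kink (tau (eps e) e) d else 0))" for d
  proof -
    have "(\<Sum>v\<in>V. \<Sum>e\<in>star v. ?R v e d) = (\<Sum>e\<in>E \<union> L. \<Sum>v\<in>{v \<in> V. v \<in> ends e}. ?R v e d)"
      unfolding star_def using finite_V finite_E finite_L by (intro sum.swap_restrict) auto
    also have "\<dots> = (\<Sum>e\<in>E \<union> L. \<Sum>v\<in>ends e. ?R v e d)"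
      using ends_subset by (intro sum.cong arg_cong2[where f = sum]) auto
    finally have 1: "(\<Sum>v\<in>V. \<Sum>e\<in>star v. ?R v e d) = (\<Sum>e\<in>E \<union> L. \<Sum>v\<in>ends e. ?R v e d)" .
    have 2: "(\<Sum>e\<in>E. \<Sum>u\<in>ends e. ?H u e d) = (\<Sum>e\<in>E \<union> L. if e \<in> E then \<Sum>u\<in>ends e. ?H u e d else 0)"
      using finite_E finite_L by (intro sum.mono_neutral_cong_left) auto
    have "(\<Sum>e\<in>E \<union> L. \<Sum>v\<in>ends e. ?R v e d) - (\<Sum>e\<in>E. \<Sum>u\<in>ends e. ?H u e d) =
      (\<Sum>e\<in>E \<union> L. vol (w e) d + (if z \<in> open_cell e then kink (tau (eps e) e) d else 0))"
      unfolding 2 sum_subtractf[symmetric] by (intro sum.cong refl w[rule_format])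
    then show ?thesis by (simp add: sum.distrib 1 vol.sum_left)
  qed
  ultimately show ?thesis by (rule germ_change)
qed

lemma exists_end: "e \<in> E \<union> L \<Longrightarrow> \<exists>v. v \<in> ends e"
  using ends_edge ends_leg by blast

lemma vertex_notin_cell: "v \<in> V \<Longrightarrow> e \<in> E \<union> L \<Longrightarrow> pos v \<notin> open_cell e"
  using cell_avoids_vertex unfolding open_cell_def by blast

lemma open_cells_disjoint: "e \<in> E \<union> L \<Longrightarrow> e' \<in> E \<union> L \<Longrightarrow> z \<in> open_cell e \<Longrightarrow> z \<in> open_cell e' \<Longrightarrow> e = e'"
  using cells_disjoint unfolding open_cell_def by blast

lemma potential_germ_off:
  assumes "z \<notin> support" shows "germ potential z (\<lambda>_. 0)"
proof -
  obtain eps where eps: "\<And>e. e \<in> E \<union> L \<Longrightarrow> eps e \<in> ends e" using exists_end by metis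
  show ?thesis
  proof (rule germ_cong[OF potential_germ[OF eps]])
    fix d
    have "(\<Sum>v\<in>V. if z = pos v then fan v d else 0) = 0"
      "(\<Sum>e\<in>E \<union> L. if z \<in> open_cell e then kink (tau (eps e) e) d else 0) = 0"
      using assms by (intro sum.neutral; auto simp: support_def)+
    then show "(\<Sum>v\<in>V. if z = pos v then fan v d else 0) +
      (\<Sum>e\<in>E \<union> L. if z \<in> open_cell e then kink (tau (eps e) e) d else 0) = 0" by simp
  qed
qed

lemma potential_germ_vertex:
  assumes v: "v \<in> V" shows "germ potential (pos v) (fan v)"
proof -
  obtain eps where eps: "\<And>e. e \<in> E \<union> L \<Longrightarrow> eps e \<in> ends e" using exists_end by metis
  show ?thesis
  proof (rule germ_cong[OF potential_germ[OF eps]])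
    fix d
    have "(\<Sum>u\<in>V. if pos v = pos u then fan u d else 0) = (\<Sum>u\<in>V. if v = u then fan u d else 0)"
      using v inj_pos by (intro sum.cong) (auto simp: inj_on_def)
    also have "\<dots> = fan v d" using v finite_V by simp
    finally show "(\<Sum>u\<in>V. if pos v = pos u then fan u d else 0) +
      (\<Sum>e\<in>E \<union> L. if pos v \<in> open_cell e then kink (tau (eps e) e) d else 0) = fan v d"
      using vertex_notin_cell[OF v] by (simp add: sum.neutral)
  qed
qed

lemma potential_germ_cell:
  assumes e: "e \<in> E \<union> L" and v: "v \<in> ends e" and z: "z \<in> open_cell e"
  shows "germ potential z (kink (tau v e))"
proof -
  obtain eps0 where eps0: "\<And>e. e \<in> E \<union> L \<Longrightarrow> eps0 e \<in> ends e" using exists_end by metis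
  \<comment> \<open>The choice of ends is adjusted at \<open>e\<close> so that the kink is expressed
    through the given end \<open>v\<close>.\<close>
  define eps where "eps = eps0(e := v)"
  have eps: "eps e' \<in> ends e'" if "e' \<in> E \<union> L" for e' using eps0[OF that] v by (simp add: eps_def)
  show ?thesis
  proof (rule germ_cong[OF potential_germ[OF eps]])
    fix d
    have "(\<Sum>e'\<in>E \<union> L. if z \<in> open_cell e' then kink (tau (eps e') e') d else 0)
       = (\<Sum>e'\<in>E \<union> L. if e = e' then kink (tau (eps e') e') d else 0)"
      using open_cells_disjoint[OF e _ z] z by (intro sum.cong) auto
    also have "\<dots> = kink (tau v e) d" using e finite_E finite_L by (simp add: eps_def)
    finally show "(\<Sum>u\<in>V. if z = pos u then fan u d else 0) +
      (\<Sum>e\<in>E \<union> L. if z \<in> open_cell e then kink (tau (eps e) e) d else 0) = kink (tau v e) d"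
      using vertex_notin_cell[OF _ e] z by (auto intro!: sum.neutral)
  qed
qed

lemma fan_nonneg: "fan v d \<ge> 0" and fan_zero [simp]: "fan v 0 = 0"
  and fan_scale: "c \<ge> 0 \<Longrightarrow> fan v (c *\<^sub>R d) = c * fan v d"
  by (simp_all add: fan_def star_fun_nonneg star_fun_scale)

lemma fan_tendsto: "(fan v \<longlongrightarrow> 0) (nhds 0)"
  unfolding fan_def by (rule star_fun_tendsto)

lemma potential_germ_any:
  obtains k where "germ potential z k" "k 0 = 0" "\<And>d. k d \<ge> 0" "(k \<longlongrightarrow> 0) (nhds 0)"
proof -
  consider v where "v \<in> V" "z = pos v" | e v where "e \<in> E \<union> L" "v \<in> ends e" "z \<in> open_cell e" | "z \<notin> support"
    using exists_end unfolding support_def by blast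
  then show ?thesis
  proof cases
    case 1
    then show ?thesis
      using that[of "fan v"] potential_germ_vertex[of v] fan_tendsto fan_nonneg by simp
  next
    case 2
    then show ?thesis using that[OF potential_germ_cell[OF 2]] kink_tendsto by (simp add: kink_nonneg)
  next
    case 3
    then show ?thesis using that[OF potential_germ_off[OF 3]] by simp
  qed
qed

lemma potential_continuous: "continuous_on UNIV potential"
proof (intro continuous_at_imp_continuous_on ballI)
  fix z
  obtain k where "germ potential z k" "k 0 = 0" "(k \<longlongrightarrow> 0) (nhds 0)"
    using potential_germ_any[of z] .
  then show "isCont potential z" by (rule germ_isCont)
qed

lemma potential_convex: "convex_on UNIV potential"
proof (rule convex_on_if_midpoint_local[OF potential_continuous])
  fix z d
  show "\<forall>\<^sub>F e in at_right 0. 2 * potential z \<le> potential (z + e *\<^sub>R d) + potential (z - e *\<^sub>R d)"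
  proof -
    obtain k where "germ potential z k" "k 0 = 0" "\<And>d. k d \<ge> 0"
      using potential_germ_any[of z] by blast
    then show ?thesis by (rule germ_midpoint)
  qed
qed

end

section \<open>Subgradients\<close>

context area_plane
begin

definition subgrad :: "('b \<Rightarrow> real) \<Rightarrow> 'b \<Rightarrow> 'b set" where
  "subgrad f z = {\<xi>. \<forall>x. f z + vol \<xi> (x - z) \<le> f x}"

text \<open>The inverse relation of \<open>subgrad\<close>: all points where the supporting affine
  function of slope \<open>\<xi>\<close> touches \<open>f\<close>.\<close>

definition contact :: "('b \<Rightarrow> real) \<Rightarrow> 'b \<Rightarrow> 'b set" where
  "contact f \<xi> = {z. \<xi> \<in> subgrad f z}"

lemma subgradD: "\<xi> \<in> subgrad f z \<Longrightarrow> f z + vol \<xi> (x - z) \<le> f x"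
  by (simp add: subgrad_def)

text \<open>For a convex function a supporting inequality near \<open>z\<close> is global: a point
  of the segment close to \<open>z\<close> carries it to the far end.\<close>

lemma subgrad_local:
  assumes "convex_on UNIV f" "\<forall>\<^sub>F d in nhds 0. f z + vol \<xi> d \<le> f (z + d)"
  shows "\<xi> \<in> subgrad f z"
  unfolding subgrad_def
proof (intro CollectI allI)
  fix x
  have "((\<lambda>t::real. t *\<^sub>R (x - z)) \<longlongrightarrow> 0) (at_right 0)"
    using scaleR_at_right_tendsto[of 0 "x - z"] by simp
  from eventually_compose_filterlim[OF assms(2) this]
  have "\<forall>\<^sub>F t in at_right (0::real). f z + vol \<xi> (t *\<^sub>R (x - z)) \<le> f (z + t *\<^sub>R (x - z))" .
  then obtain t :: real where t: "0 < t" "t < 1" "f z + vol \<xi> (t *\<^sub>R (x - z)) \<le> f (z + t *\<^sub>R (x - z))"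
    by (rule eventually_at_right_0D)
  have "f (z + t *\<^sub>R (x - z)) \<le> (1 - t) * f z + t * f x"
    using convex_onD[OF assms(1), of t z x] t by (simp add: algebra_simps)
  moreover have "f z + t * vol \<xi> (x - z) \<le> f (z + t *\<^sub>R (x - z))"
    using t(3) by (simp only: vol.scaleR_right real_scaleR_def)
  ultimately have "f z + t * vol \<xi> (x - z) \<le> (1 - t) * f z + t * f x" by linarith
  then have "t * (f z + vol \<xi> (x - z)) \<le> t * f x"
    by (simp add: distrib_left left_diff_distrib)
  then show "f z + vol \<xi> (x - z) \<le> f x" using t by simp
qed

lemma convex_subgrad: "convex (subgrad f z)"
proof (rule convexI)
  fix \<xi> \<eta> and u v :: real
  assume *: "\<xi> \<in> subgrad f z" "\<eta> \<in> subgrad f z" "0 \<le> u" "0 \<le> v" "u + v = 1"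
  have "f z + vol (u *\<^sub>R \<xi> + v *\<^sub>R \<eta>) (x - z) \<le> f x" for x
  proof -
    have "f z + vol (u *\<^sub>R \<xi> + v *\<^sub>R \<eta>) (x - z) = (u + v) * f z + u * vol \<xi> (x - z) + v * vol \<eta> (x - z)"
      using *(5) by (simp add: vol.add_left vol.scaleR_left)
    also have "\<dots> = u * (f z + vol \<xi> (x - z)) + v * (f z + vol \<eta> (x - z))"
      by (simp add: algebra_simps)
    also have "\<dots> \<le> u * f x + v * f x"
      using * subgradD by (intro add_mono mult_left_mono) auto
    also have "\<dots> = f x" using *(5) by (simp flip: distrib_right)
    finally show ?thesis .
  qed
  then show "u *\<^sub>R \<xi> + v *\<^sub>R \<eta> \<in> subgrad f z" by (simp add: subgrad_def)
qed

lemma closed_subgrad: "closed (subgrad f z)"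
  unfolding subgrad_def
  by (intro closed_Collect_all closed_Collect_le continuous_intros)

text \<open>The values of \<open>f\<close> at \<open>z\<close> shifted both ways along a unit frame
  bound the two coordinates of every subgradient.\<close>

lemma compact_subgrad: "compact (subgrad f z)"
proof -
  obtain p q where pq: "vol p q = 1" using unit_frame .
  define K where "K d = max (f (z + d) - f z) (f (z - d) - f z)" for d
  have K: "\<bar>vol \<xi> d\<bar> \<le> K d" if "\<xi> \<in> subgrad f z" for \<xi> d
    using subgradD[OF that, of "z + d"] subgradD[OF that, of "z - d"]
    by (simp add: K_def vol.minus_right abs_le_iff le_max_iff_disj; linarith)
  have "norm \<xi> \<le> K q * norm p + K p * norm q" if "\<xi> \<in> subgrad f z" for \<xi>
  proof -
    have "norm \<xi> \<le> \<bar>vol \<xi> q\<bar> * norm p + \<bar>vol p \<xi>\<bar> * norm q" by (rule two_functionals_bounded[OF pq])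
    also have "\<dots> \<le> K q * norm p + K p * norm q"
      using K[OF that, of q] K[OF that, of p] vol_skew[of p \<xi>] by (intro add_mono mult_right_mono) auto
    finally show ?thesis .
  qed
  then have "bounded (subgrad f z)" by (intro boundedI)
  then show ?thesis using closed_subgrad by (simp add: compact_eq_bounded_closed)
qed

lemma closed_contact:
  assumes "continuous_on UNIV f"
  shows "closed (contact f \<xi>)"
  unfolding contact_def subgrad_def mem_Collect_eq
  by (intro closed_Collect_all closed_Collect_le continuous_intros assms)

lemma contact_eq:
  assumes "z \<in> contact f \<xi>" "z' \<in> contact f \<xi>"
  shows "f z' = f z + vol \<xi> (z' - z)"
  using subgradD[of \<xi> f z z'] subgradD[of \<xi> f z' z] assms by (simp add: contact_def vol.diff_right)

lemma contact_extend:
  assumes "z \<in> contact f \<xi>" "f z' = f z + vol \<xi> (z' - z)"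
  shows "z' \<in> contact f \<xi>"
  using assms by (auto simp: contact_def subgrad_def vol.diff_right)

lemma face_of_vol:
  assumes "convex S" "\<And>x. x \<in> S \<Longrightarrow> vol x n \<le> k"
  shows "{x \<in> S. vol x n = k} face_of S"
  unfolding face_of_def
proof (intro conjI ballI impI)
  have "{x \<in> S. vol x n = k} = S \<inter> (\<lambda>x. vol x n) -` {k}" by auto
  moreover have "convex ((\<lambda>x. vol x n) -` {k})"
    by (intro convex_linear_vimage bounded_linear.linear vol.bounded_linear_left convex_singleton)
  ultimately show "convex {x \<in> S. vol x n = k}" using assms(1) by (simp add: convex_Int)
next
  fix a b x assume *: "a \<in> S" "b \<in> S" "x \<in> {x \<in> S. vol x n = k}" "x \<in> open_segment a b"
  then obtain u where u: "0 < u" "u < 1" "x = (1 - u) *\<^sub>R a + u *\<^sub>R b" by (auto simp: in_segment)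
  have "(1 - u) * vol a n + u * vol b n = k" using * u by (simp add: vol_simps)
  then have "(1 - u) * (k - vol a n) + u * (k - vol b n) = 0" by (simp add: algebra_simps)
  moreover have "0 \<le> (1 - u) * (k - vol a n)" "0 \<le> u * (k - vol b n)"
    using assms(2)[OF *(1)] assms(2)[OF *(2)] u by auto
  ultimately have "(1 - u) * (k - vol a n) = 0" "u * (k - vol b n) = 0" by linarith+
  then show "a \<in> {x \<in> S. vol x n = k}" "b \<in> {x \<in> S. vol x n = k}" using * u by auto
qed auto

text \<open>A slope that supports at \<open>z\<close> also supports at \<open>z'\<close> exactly
  when its affine function reaches the value there. The intersection is thus cut out by turning the
  subgradient inequality at \<open>z'\<close> into an equality, hence is a face.\<close>

lemma subgrad_Int_eq:
  "subgrad f z \<inter> subgrad f z' = {\<xi> \<in> subgrad f z. vol \<xi> (z' - z) = f z' - f z}"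
proof (intro set_eqI iffI)
  fix \<xi> assume "\<xi> \<in> subgrad f z \<inter> subgrad f z'"
  then show "\<xi> \<in> {\<xi> \<in> subgrad f z. vol \<xi> (z' - z) = f z' - f z}"
    using contact_eq[of z f \<xi> z'] by (simp add: contact_def)
next
  fix \<xi> assume "\<xi> \<in> {\<xi> \<in> subgrad f z. vol \<xi> (z' - z) = f z' - f z}"
  then show "\<xi> \<in> subgrad f z \<inter> subgrad f z'"
    using contact_extend[of z f \<xi> z'] by (simp add: contact_def)
qed

lemma subgrad_Int_face: "(subgrad f z \<inter> subgrad f z') face_of subgrad f z"
  unfolding subgrad_Int_eq
proof (rule face_of_vol[OF convex_subgrad])
  fix \<xi> assume "\<xi> \<in> subgrad f z"
  then show "vol \<xi> (z' - z) \<le> f z' - f z" using subgradD[of \<xi> f z z'] by simp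
qed

text \<open>Testing along \<open>t\<close> and \<open>- t\<close>, where the kink vanishes, makes
  \<open>\<xi> - w\<close> a multiple of \<open>t\<close>; testing in a transversal direction with
  both signs bounds the multiple by 0 and 1.\<close>

lemma subgrad_kink:
  assumes "convex_on UNIV f" and g: "germ f z (kink t)" and t: "t \<noteq> 0"
  obtains w where "subgrad f z = closed_segment w (w + t)"
proof -
  obtain w where ev: "\<forall>\<^sub>F d in nhds 0. f (z + d) = f z + vol w d + kink t d"
    using germ_value[OF g kink_zero] .
  have "\<xi> \<in> subgrad f z \<longleftrightarrow> \<xi> \<in> closed_segment w (w + t)" for \<xi>
  proof
    assume "\<xi> \<in> closed_segment w (w + t)"
    then obtain u where u: "0 \<le> u" "u \<le> 1" "\<xi> = (1 - u) *\<^sub>R w + u *\<^sub>R (w + t)" by (auto simp: in_segment)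
    then have xi: "\<xi> = w + u *\<^sub>R t" by (simp add: algebra_simps)
    have "u * x \<le> max 0 x" for x :: real
      using u by (cases "x \<ge> 0") (auto simp: mult_left_le_one_le mult_nonneg_nonpos)
    then show "\<xi> \<in> subgrad f z"
      by (intro subgrad_local[OF assms(1)] eventually_mono[OF ev])
        (simp add: xi vol_simps kink_def)
  next
    assume xi: "\<xi> \<in> subgrad f z"
    have le: "vol (\<xi> - w) d \<le> kink t d" for d
    proof -
      have "((\<lambda>e::real. e *\<^sub>R d) \<longlongrightarrow> 0) (at_right 0)"
        using scaleR_at_right_tendsto[of 0 d] by simp
      from eventually_compose_filterlim[OF ev this]
      obtain e where e: "0 < e" "f (z + e *\<^sub>R d) = f z + vol w (e *\<^sub>R d) + kink t (e *\<^sub>R d)"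
        by (rule eventually_at_right_0D)
      then have "e * vol (\<xi> - w) d \<le> e * kink t d"
        using subgradD[OF xi, of "z + e *\<^sub>R d"]
        by (simp add: kink_def vol_simps max_mult_distrib_left algebra_simps)
      then show ?thesis using e(1) by simp
    qed
    have "vol (\<xi> - w) t = 0"
      using le[of t] le[of "- t"] by (simp add: kink_def vol.minus_right)
    then obtain u where u: "\<xi> - w = u *\<^sub>R t" using t by (rule parallel_if_vol_zero)
    obtain d where "vol d t = 1" using vol_nondegenerate[OF t] .
    then have d: "vol t d = - 1" using vol_skew[of t d] by simp
    have "0 \<le> u" "u \<le> 1" using le[of d] le[of "- d"] by (simp_all add: u kink_def vol_simps d)
    moreover have "\<xi> = (1 - u) *\<^sub>R w + u *\<^sub>R (w + t)"
      using u by (simp add: algebra_simps)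
    ultimately show "\<xi> \<in> closed_segment w (w + t)" by (auto simp: in_segment)
  qed
  then show ?thesis using that by blast
qed

text \<open>Along \<open>t\<close> the function is affine near \<open>z\<close>. A supporting affine
  function that touches such a stretch from below at an inner point must have the same slope and
  touches on both sides.\<close>

lemma contact_affine_direction:
  assumes g: "germ f z k" and k: "\<And>s. k (s *\<^sub>R t) = 0" and z: "z \<in> contact f \<xi>"
  shows "\<forall>\<^sub>F s in nhds (0::real). z + s *\<^sub>R t \<in> contact f \<xi>"
proof -
  have "k 0 = 0" using k[of 0] by simp
  then obtain w where ev: "\<forall>\<^sub>F d in nhds 0. f (z + d) = f z + vol w d + k d"
    using germ_value[OF g] by blast
  have "((\<lambda>s::real. s *\<^sub>R t) \<longlongrightarrow> 0 *\<^sub>R t) (nhds 0)" by (intro tendsto_intros filterlim_ident)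
  then have "((\<lambda>s::real. s *\<^sub>R t) \<longlongrightarrow> 0) (nhds 0)" by simp
  from eventually_compose_filterlim[OF ev this]
  have ev': "\<forall>\<^sub>F s in nhds (0::real). f (z + s *\<^sub>R t) = f z + s * vol w t"
    by (simp add: k vol.scaleR_right)
  then obtain e where e: "e > 0" "\<And>s. \<bar>s\<bar> < e \<Longrightarrow> f (z + s *\<^sub>R t) = f z + s * vol w t"
    by (auto simp: eventually_nhds_metric dist_real_def)
  have "vol \<xi> t = vol w t"
  proof -
    have "(e/2) * vol \<xi> t \<le> (e/2) * vol w t" "(- e/2) * vol \<xi> t \<le> (- e/2) * vol w t"
      using subgradD[of \<xi> f z "z + (e/2) *\<^sub>R t"] subgradD[of \<xi> f z "z + (- e/2) *\<^sub>R t"] z e(2)[of "e/2"] e(2)[of "- e/2"] e(1)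
      by (auto simp: contact_def vol_simps)
    then show ?thesis using e(1) by simp
  qed
  with ev' show ?thesis
    by (auto elim!: eventually_mono intro!: contact_extend[OF z] simp: vol.scaleR_right)
qed

text \<open>The previous argument in all directions at once. Off the graph this makes contact sets
  open, which drives the later connectedness arguments.\<close>

lemma contact_affine_open:
  assumes g: "germ f z (\<lambda>_. 0)" and z: "z \<in> contact f \<xi>"
  shows "z \<in> interior (contact f \<xi>)"
proof -
  obtain w where ev: "\<forall>\<^sub>F d in nhds 0. f (z + d) = f z + vol w d"
    using germ_value[OF g] by auto
  have par: "vol (\<xi> - w) t = 0" for t
  proof -
    have "\<forall>\<^sub>F s in nhds (0::real). z + s *\<^sub>R t \<in> contact f \<xi>"
      by (rule contact_affine_direction[OF g _ z]) simp
    moreover have "((\<lambda>s::real. s *\<^sub>R t) \<longlongrightarrow> 0 *\<^sub>R t) (nhds 0)" by (intro tendsto_intros filterlim_ident)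
    then have "((\<lambda>s::real. s *\<^sub>R t) \<longlongrightarrow> 0) (nhds 0)" by simp
    from eventually_compose_filterlim[OF ev this]
    have "\<forall>\<^sub>F s in nhds (0::real). f (z + s *\<^sub>R t) = f z + s * vol w t"
      by (simp add: vol.scaleR_right)
    ultimately have "\<forall>\<^sub>F s in nhds (0::real). s * vol (\<xi> - w) t = 0"
      by eventually_elim (use contact_eq[OF z] in \<open>auto simp: vol_simps algebra_simps\<close>)
    then obtain e :: real where e: "e > 0" "\<forall>s. dist s 0 < e \<longrightarrow> s * vol (\<xi> - w) t = 0"
      unfolding eventually_nhds_metric by blast
    have "dist (e/2) 0 < e" using e(1) by (simp add: dist_real_def)
    then have "e/2 * vol (\<xi> - w) t = 0" using e(2) by blast
    then show ?thesis using e(1) by simp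
  qed
  have "vol w d = vol \<xi> d" for d using par[of d] by (simp add: vol.diff_left)
  with ev have "\<forall>\<^sub>F d in nhds 0. f (z + d) = f z + vol \<xi> d" by simp
  then have "\<forall>\<^sub>F d in nhds 0. z + d \<in> contact f \<xi>"
    by (rule eventually_mono) (intro contact_extend[OF z], simp)
  then obtain e where e: "e > 0" "\<And>d. norm d < e \<Longrightarrow> z + d \<in> contact f \<xi>"
    by (auto simp: eventually_nhds_metric)
  have "ball z e \<subseteq> contact f \<xi>"
  proof
    fix x assume "x \<in> ball z e"
    then have "norm (x - z) < e" by (simp add: dist_norm norm_minus_commute)
    then show "x \<in> contact f \<xi>" using e(2)[of "x - z"] by simp
  qed
  then show ?thesis using e(1) mem_interior by blast
qed

end

section \<open>Tiles dual to vertices and sides dual to edges and legs\<close>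

context plane_graph
begin

definition tile :: "'v \<Rightarrow> 'b set" where
  "tile v = subgrad potential (pos v)"

text \<open>Asking for contact along the whole open cell avoids choosing a point of it;
  \<open>side_eq_subgrad\<close> shows that any single point gives the same set.\<close>

definition side :: "'e \<Rightarrow> 'b set" where
  "side e = {\<xi>. open_cell e \<subseteq> contact potential \<xi>}"

lemma len_pos: "e \<in> E \<Longrightarrow> 0 < len e"
  using ends_edge edge_vector by blast

lemma open_cell_nonempty:
  assumes "e \<in> E \<union> L" shows "open_cell e \<noteq> {}"
proof -
  obtain v where v: "v \<in> ends e" using exists_end[OF assms] by blast
  have "0 < (if e \<in> E then len e / 2 else 1)" "e \<in> E \<longrightarrow> (if e \<in> E then len e / 2 else 1) < len e"
    using len_pos by auto
  then show ?thesis using v unfolding open_cell_def by blast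
qed

text \<open>Contact is a closed condition, and it is open within the cell because the potential is
  affine along it; the cell is connected, so contact at one point spreads to all of it and by
  closedness to its ends.\<close>

lemma contact_cell:
  assumes e: "e \<in> E \<union> L" and z: "z \<in> open_cell e" "z \<in> contact potential \<xi>"
  shows "open_cell e \<subseteq> contact potential \<xi>" and "v \<in> ends e \<Longrightarrow> pos v \<in> contact potential \<xi>"
proof -
  have *: "open_cell e \<subseteq> contact potential \<xi> \<and> pos v \<in> contact potential \<xi>" if v: "v \<in> ends e" for v
  proof -
    let ?M = "contact potential \<xi>" and ?p = "\<lambda>t. pos v + t *\<^sub>R tau v e"
    define T where "T = {t. 0 < t \<and> (e \<in> E \<longrightarrow> t < len e)}"
    have Tcell: "open_cell e = ?p ` T" by (auto simp: open_cell_eq[OF e v] T_def)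
    have T_eq: "T = (if e \<in> E then {0<..<len e} else {0<..})" by (auto simp: T_def)
    have T: "open T" "connected T" unfolding T_eq by auto
    have pcont: "continuous_on A ?p" for A by (intro continuous_intros)
    have cM: "closed ?M" by (rule closed_contact[OF potential_continuous])
    let ?S = "{t \<in> T. ?p t \<in> ?M}"
    have "openin (top_of_set T) ?S"
    proof (rule openin_subset_trans[of UNIV])
      show "openin (top_of_set UNIV) ?S"
        unfolding openin_open_eq[OF open_UNIV] open_dist
      proof (intro conjI ballI subset_UNIV)
        fix t assume t: "t \<in> ?S"
        have g: "germ potential (?p t) (kink (tau v e))"
          using t Tcell by (intro potential_germ_cell[OF e v]) auto
        have "\<forall>\<^sub>F s in nhds (0::real). ?p t + s *\<^sub>R tau v e \<in> ?M"
          by (rule contact_affine_direction[OF g]) (use t in \<open>auto simp: kink_def vol_simps\<close>)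
        then obtain r where r: "r > 0" "\<And>s. \<bar>s\<bar> < r \<Longrightarrow> ?p t + s *\<^sub>R tau v e \<in> ?M"
          by (auto simp: eventually_nhds_metric dist_real_def)
        obtain r' where r': "r' > 0" "\<And>s. dist s t < r' \<Longrightarrow> s \<in> T"
          using T(1) t unfolding open_dist by auto
        show "\<exists>r>0. \<forall>s. dist s t < r \<longrightarrow> s \<in> ?S"
        proof (intro exI[of _ "min r r'"] conjI allI impI)
          fix s assume s: "dist s t < min r r'"
          then have "?p t + (s - t) *\<^sub>R tau v e \<in> ?M" by (intro r) (auto simp: dist_real_def)
          then show "s \<in> ?S" using r'(2)[of s] s by (simp add: algebra_simps)
        qed (use r r' in auto)
      qed
    qed auto
    moreover have "closedin (top_of_set T) ?S"
    proof -
      have "closed (?p -` ?M)" by (rule closed_vimage[OF cM pcont])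
      moreover have "?S = T \<inter> ?p -` ?M" by auto
      ultimately show ?thesis by (auto simp: closedin_closed)
    qed
    ultimately have "?S = {} \<or> ?S = T" using T(2) unfolding connected_clopen by blast
    moreover have "?S \<noteq> {}" using z Tcell by auto
    ultimately have ST: "?S = T" by blast
    have "\<forall>\<^sub>F t in at_right 0. t \<in> T"
    proof (cases "e \<in> E")
      case True
      then show ?thesis unfolding T_eq using len_pos eventually_at_right_real[of 0 "len e"] by simp
    next
      case False
      then show ?thesis unfolding T_eq by (simp add: eventually_at_right_less)
    qed
    then have "\<forall>\<^sub>F t in at_right 0. ?p t \<in> ?M" by (rule eventually_mono) (use ST in blast)
    then have "pos v \<in> ?M"
      using Lim_in_closed_set[OF cM _ trivial_limit_at_right_real scaleR_at_right_tendsto] by blast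
    moreover have "?p t \<in> ?M" if "t \<in> T" for t
      using that ST by (metis (mono_tags, lifting) mem_Collect_eq)
    ultimately show ?thesis using Tcell by auto
  qed
  show "open_cell e \<subseteq> contact potential \<xi>" using * exists_end[OF e] by blast
  show "v \<in> ends e \<Longrightarrow> pos v \<in> contact potential \<xi>" using * by blast
qed

lemma side_eq_subgrad:
  assumes "e \<in> E \<union> L" "z \<in> open_cell e"
  shows "side e = subgrad potential z"
  using contact_cell(1)[OF assms] assms(2) by (auto simp: side_def contact_def)

lemma side_segment:
  assumes e: "e \<in> E \<union> L" and v: "v \<in> ends e"
  obtains w where "side e = closed_segment w (w + tau v e)"
proof -
  obtain z where z: "z \<in> open_cell e" using open_cell_nonempty[OF e] by blast
  obtain w where "subgrad potential z = closed_segment w (w + tau v e)"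
    using subgrad_kink[OF potential_convex potential_germ_cell[OF e v z] tau_nonzero[OF e v]] .
  then show ?thesis using that side_eq_subgrad[OF e z] by simp
qed

lemma side_nonempty: "e \<in> E \<union> L \<Longrightarrow> side e \<noteq> {}"
  using side_segment exists_end by (metis ends_in_segment(1) empty_iff)

lemma side_subset:
  assumes e: "e \<in> E \<union> L" and v: "v \<in> ends e"
  shows "side e \<subseteq> tile v"
proof
  fix \<xi> assume xi: "\<xi> \<in> side e"
  obtain z where z: "z \<in> open_cell e" using open_cell_nonempty[OF e] by blast
  then have "z \<in> contact potential \<xi>" using xi by (auto simp: side_def)
  then have "pos v \<in> contact potential \<xi>" using contact_cell(2)[OF e z] v by blast
  then show "\<xi> \<in> tile v" by (simp add: tile_def contact_def)
qed

text \<open>Two cells leaving a vertex in the same direction would overlap.\<close>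

lemma arms_distinct:
  assumes e: "e \<in> star v" and e': "e' \<in> star v" and c: "tau v e' = c *\<^sub>R tau v e" "c > 0"
  shows "e = e'"
proof -
  have *: "e \<in> E \<union> L" "v \<in> ends e" "e' \<in> E \<union> L" "v \<in> ends e'" using e e' by (auto simp: star_def)
  define l where "l f = (if f \<in> E then len f else 1)" for f
  have l: "l e > 0" "l e' > 0" using len_pos by (auto simp: l_def)
  define t where "t = min (l e' / 2) (l e / 2 / c)"
  have t: "t > 0" "t < l e'" "c * t < l e"
  proof -
    show "t > 0" "t < l e'" using l c by (auto simp: t_def)
    have "t \<le> l e / 2 / c" by (simp add: t_def)
    then have "c * t \<le> l e / 2" using c by (simp add: field_simps)
    then show "c * t < l e" using l by simp
  qed
  have "pos v + (c * t) *\<^sub>R tau v e = pos v + t *\<^sub>R tau v e'" by (simp add: c)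
  then show ?thesis
    by (intro cells_disjoint[OF *(1,2) _ _ *(3,4)]) (use t c in \<open>auto simp: l_def\<close>)
qed

text \<open>A line has two directions and each is taken by at most one arm, so a collinear star
  would have at most two arms, against the valence condition.\<close>

lemma star_not_collinear:
  assumes v: "v \<in> V" and n: "n \<noteq> 0"
  obtains e where "e \<in> star v" "vol (tau v e) n \<noteq> 0"
proof (rule ccontr)
  assume "\<not> thesis"
  then have 0: "vol (tau v e) n = 0" if "e \<in> star v" for e using that \<open>\<And>e. \<lbrakk>e \<in> star v; vol (tau v e) n \<noteq> 0\<rbrakk> \<Longrightarrow> thesis\<close> by blast
  have "\<exists>c. tau v e = c *\<^sub>R n" if "e \<in> star v" for e
    using parallel_if_vol_zero[OF 0[OF that] n] by blast
  then obtain c where c: "\<And>e. e \<in> star v \<Longrightarrow> tau v e = c e *\<^sub>R n" by metis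
  have c0: "c e \<noteq> 0" if "e \<in> star v" for e
    using c[OF that] tau_nonzero[of e v] that by (auto simp: star_def)
  have "inj_on (\<lambda>e. c e > 0) (star v)"
  proof (rule inj_onI)
    fix e e' assume *: "e \<in> star v" "e' \<in> star v" "(c e > 0) = (c e' > 0)"
    have "c e' / c e > 0" using *(3) c0[OF *(1)] c0[OF *(2)] by (auto simp: zero_less_divide_iff)
    moreover have "tau v e' = (c e' / c e) *\<^sub>R tau v e"
      using c[OF *(1)] c[OF *(2)] c0[OF *(1)] by simp
    ultimately show "e = e'" using arms_distinct[OF *(1,2)] by blast
  qed
  then have "card (star v) \<le> card (UNIV :: bool set)"
    by (rule card_inj_on_le) auto
  then show False using valence[OF v] by (simp add: star_def)
qed

text \<open>A tile without interior would lie in a line, and then all its sides, that is all momenta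
  at the vertex, would be parallel.\<close>

lemma cell_interior:
  assumes v: "v \<in> V" shows "interior (tile v) \<noteq> {}"
proof
  assume "interior (tile v) = {}"
  then obtain n k where nk: "n \<noteq> 0" "\<And>\<xi>. \<xi> \<in> tile v \<Longrightarrow> vol \<xi> n = k"
    using empty_interior_vol[of "tile v"] convex_subgrad unfolding tile_def by metis
  obtain e where e: "e \<in> star v" "vol (tau v e) n \<noteq> 0" using star_not_collinear[OF v nk(1)] .
  have e': "e \<in> E \<union> L" "v \<in> ends e" using e by (auto simp: star_def)
  obtain w where w: "side e = closed_segment w (w + tau v e)" using side_segment[OF e'] .
  have "w \<in> tile v" "w + tau v e \<in> tile v" using side_subset[OF e'] w by auto
  then have "vol w n = k" "vol (w + tau v e) n = k" using nk by auto
  then show False using e(2) by (simp add: vol.add_left)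
qed

lemma cell_compact: "compact (tile v)" and cell_convex: "convex (tile v)"
  by (simp_all add: tile_def compact_subgrad convex_subgrad)

text \<open>For \<open>z\<close> on the open cell, \<open>z - pos v\<close> is a positive multiple
  of \<open>tau v e\<close>. Hence the equation describing
  \<open>tile v \<inter> subgrad potential z\<close> says that \<open>tau v e\<close> is maximised:
  it is the outer normal of its side.\<close>

lemma side_max:
  assumes e: "e \<in> E \<union> L" "v \<in> ends e" and x0: "\<xi>0 \<in> side e" and x: "\<xi> \<in> tile v"
  shows "vol (\<xi> - \<xi>0) (tau v e) \<le> 0" and "vol (\<xi> - \<xi>0) (tau v e) = 0 \<longleftrightarrow> \<xi> \<in> side e"
proof -
  obtain z where z: "z \<in> open_cell e" using open_cell_nonempty[OF e(1)] by blast
  obtain t where t: "t > 0" "z = pos v + t *\<^sub>R tau v e" using z open_cell_eq[OF e] by auto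
  have s: "side e = tile v \<inter> subgrad potential z"
    using side_eq_subgrad[OF e(1) z] side_subset[OF e] by auto
  have eq: "side e = {\<xi> \<in> tile v. vol \<xi> (z - pos v) = potential z - potential (pos v)}"
    unfolding s tile_def by (rule subgrad_Int_eq)
  have "vol \<xi> (z - pos v) \<le> potential z - potential (pos v)"
    using x subgradD[of \<xi> potential "pos v" z] by (simp add: tile_def)
  moreover have "vol \<xi>0 (z - pos v) = potential z - potential (pos v)" using x0 eq by auto
  moreover have "vol \<xi> (z - pos v) - vol \<xi>0 (z - pos v) = t * vol (\<xi> - \<xi>0) (tau v e)"
    by (simp add: t vol.scaleR_right vol.diff_left right_diff_distrib)
  ultimately have "t * vol (\<xi> - \<xi>0) (tau v e) \<le> 0"
    and "t * vol (\<xi> - \<xi>0) (tau v e) = 0 \<longleftrightarrow> \<xi> \<in> side e"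
    using x unfolding eq by auto
  then show "vol (\<xi> - \<xi>0) (tau v e) \<le> 0" "vol (\<xi> - \<xi>0) (tau v e) = 0 \<longleftrightarrow> \<xi> \<in> side e"
    using t(1) by (auto simp: mult_le_0_iff)
qed

lemma cell_not_flat:
  assumes v: "v \<in> V" and n: "n \<noteq> 0" and le: "\<And>\<xi>. \<xi> \<in> tile v \<Longrightarrow> vol \<xi> n \<le> k"
  obtains \<xi> where "\<xi> \<in> tile v" "vol \<xi> n < k"
  using cell_interior[OF v] interior_vol_less[OF _ n le] interior_subset by blast

lemma side_facet:
  assumes e: "e \<in> E \<union> L" and v: "v \<in> ends e"
  shows "side e facet_of tile v"
  unfolding facet_of_def
proof (intro conjI)
  obtain z where z: "z \<in> open_cell e" using open_cell_nonempty[OF e] by blast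
  have s: "side e = tile v \<inter> subgrad potential z"
    using side_eq_subgrad[OF e z] side_subset[OF e v] by auto
  show "side e face_of tile v" unfolding s tile_def by (rule subgrad_Int_face)
  obtain w where w: "side e = closed_segment w (w + tau v e)" using side_segment[OF e v] .
  then show "side e \<noteq> {}" by simp
  have "v \<in> V" using ends_subset[OF e] v by blast
  have "aff_dim (side e) = aff_dim {w, w + tau v e}"
    unfolding w segment_convex_hull by (simp add: aff_dim_convex_hull)
  also have "\<dots> = 1" using tau_nonzero[OF e v] by (simp add: aff_dim_2)
  finally show "aff_dim (side e) = aff_dim (tile v) - 1"
    using aff_dim_interior[OF cell_interior[OF \<open>v \<in> V\<close>]] by simp
qed

lemma closure_open_cell:
  assumes e: "e \<in> E \<union> L"
  shows "closure (open_cell e) \<subseteq> open_cell e \<union> pos ` ends e"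
proof -
  obtain v where v: "v \<in> ends e" using exists_end[OF e] by blast
  have "closure (open_cell e) \<subseteq> (\<lambda>t. pos v + t *\<^sub>R tau v e) ` (if e \<in> E then {0..len e} else {0..})"
    using tau_nonzero[OF e v]
    by (intro closure_minimal closed_affine_image) (auto simp: open_cell_eq[OF e v])
  also have "\<dots> \<subseteq> open_cell e \<union> pos ` ends e"
    using e v
  proof (cases rule: ends_cases)
    case (edge w)
    then have "pos w = pos v + len e *\<^sub>R tau v e" using edge_vector[of e v w] by auto
    moreover have "pos v + t *\<^sub>R tau v e \<in> open_cell e" if "0 < t" "t < len e" for t
      using that edge by (auto simp: open_cell_eq[OF e v])
    ultimately show ?thesis using edge by (auto simp: le_less)
  next
    case leg
    have "pos v + t *\<^sub>R tau v e \<in> open_cell e" if "0 < t" for t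
      using that leg by (auto simp: open_cell_eq[OF e v])
    then show ?thesis using leg by (auto simp: le_less)
  qed
  finally show ?thesis .
qed

text \<open>A slope of the tile lying on no side touches the potential, near the vertex, only at the
  vertex itself. The gap is then bounded below on a small sphere, so all nearby slopes still support
  at the vertex and the slope is interior.\<close>

lemma cell_frontier:
  assumes v: "v \<in> V"
  shows "frontier (tile v) \<subseteq> (\<Union>e\<in>star v. side e)"
proof (rule ccontr)
  let ?M = "contact potential"
  assume "\<not> ?thesis"
  then obtain \<xi> where xi: "\<xi> \<in> frontier (tile v)" "\<And>e. e \<in> star v \<Longrightarrow> \<xi> \<notin> side e" by blast
  then have xiP: "\<xi> \<in> tile v"
    using frontier_subset_closed[OF compact_imp_closed[OF cell_compact]] by blast
  then have vM: "pos v \<in> ?M \<xi>" by (simp add: contact_def tile_def)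
  obtain w where ev: "\<forall>\<^sub>F d in nhds 0. potential (pos v + d) = potential (pos v) + vol w d + fan v d"
    using germ_value[OF potential_germ_vertex[OF v] fan_zero] .
  then obtain r1 where r1: "r1 > 0" "\<And>d. norm d < r1 \<Longrightarrow> potential (pos v + d) = potential (pos v) + vol w d + fan v d"
    by (auto simp: eventually_nhds_metric)
  \<comment> \<open>Near the vertex the graph consists of the arms at \<open>v\<close> alone: the
    other vertices and the closures of the other cells form a closed set that misses
    \<open>pos v\<close>.\<close>
  obtain r2 where r2: "r2 > 0" "\<And>x. dist x (pos v) < r2 \<Longrightarrow> x \<in> support \<Longrightarrow> x = pos v \<or> (\<exists>e\<in>star v. x \<in> open_cell e)"
  proof -
    define C where "C = pos ` (V - {v}) \<union> (\<Union>e\<in>(E \<union> L) - star v. closure (open_cell e))"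
    have "closed C" unfolding C_def using finite_V finite_E finite_L
      by (intro closed_Un closed_UN finite_imp_closed) auto
    moreover have "pos v \<notin> C"
    proof
      assume "pos v \<in> C"
      moreover have "pos v \<notin> pos ` (V - {v})" using inj_pos v by (auto simp: inj_on_def)
      ultimately obtain e where e: "e \<in> E \<union> L" "v \<notin> ends e" "pos v \<in> closure (open_cell e)"
        by (auto simp: C_def star_def)
      have "pos v \<in> open_cell e \<union> pos ` ends e" using closure_open_cell[OF e(1)] e(3) by blast
      then show False
        using vertex_notin_cell[OF v e(1)] e(2) inj_pos v ends_subset[OF e(1)] by (auto simp: inj_on_def)
    qed
    ultimately obtain r where "r > 0" "\<And>x. dist x (pos v) < r \<Longrightarrow> x \<notin> C"
      using open_dist[of "- C"] by (auto simp: open_Compl)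
    moreover have "x = pos v \<or> (\<exists>e\<in>star v. x \<in> open_cell e)" if "x \<in> support" "x \<notin> C" for x
      using that closure_subset by (fastforce simp: support_def C_def)
    ultimately show ?thesis using that by blast
  qed
  define r where "r = min r1 r2"
  have "r > 0" using r1 r2 by (simp add: r_def)
  define B where "B = ball (pos v) r - {pos v}"
  have cB: "connected B" unfolding B_def using dim2 by (intro connected_punctured_ball) simp
  have oB: "open B" unfolding B_def by auto
  have off: "x \<notin> support" if "x \<in> B \<inter> ?M \<xi>" for x
  proof
    assume "x \<in> support"
    moreover have "dist x (pos v) < r2" "x \<noteq> pos v"
      using that by (auto simp: B_def r_def dist_commute)
    ultimately obtain e where e: "e \<in> star v" "x \<in> open_cell e"
      using r2(2) by blast
    then have "\<xi> \<in> side e"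
      using side_eq_subgrad[of e x] that by (auto simp: star_def contact_def)
    then show False using xi(2) e by blast
  qed
  \<comment> \<open>The contact set within the punctured ball avoids the graph, hence is open and
    closed there. If nonempty it would fill the punctured ball, yet every arm at \<open>v\<close>
    enters it.\<close>
  have "B \<inter> ?M \<xi> = {}"
  proof (rule ccontr)
    assume ne: "B \<inter> ?M \<xi> \<noteq> {}"
    have "openin (top_of_set B) (B \<inter> ?M \<xi>)"
    proof -
      have "B \<inter> ?M \<xi> = B \<inter> interior (?M \<xi>)"
        using contact_affine_open[OF potential_germ_off[OF off]] interior_subset by blast
      then show ?thesis by (auto intro: openin_open_Int)
    qed
    moreover have "closedin (top_of_set B) (B \<inter> ?M \<xi>)"
      using closed_contact[OF potential_continuous] by (auto intro: closedin_closed_Int)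
    ultimately have "B \<inter> ?M \<xi> = B" using cB ne unfolding connected_clopen by blast
    then have Bs: "B \<inter> support = {}" using off by blast
    \<comment> \<open>Any nonzero vector will do, as only the existence of an arm at
      \<open>v\<close> is wanted.\<close>
    obtain p where "p \<noteq> (0::'b)" using vol_nondegenerate unit_frame by (metis vol.zero_left zero_neq_one)
    then obtain e where "e \<in> star v" using star_not_collinear[OF v] by metis
    then have e: "e \<in> E \<union> L" "v \<in> ends e" by (auto simp: star_def)
    obtain z where "z \<in> open_cell e" using open_cell_nonempty[OF e(1)] by blast
    then obtain t where t: "t > 0" "e \<in> E \<longrightarrow> t < len e" using open_cell_eq[OF e] by auto
    let ?n = "norm (tau v e)"
    have n: "?n > 0" using tau_nonzero[OF e] by simp
    define s where "s = min t (r / 2 / ?n)"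
    have s: "s > 0" "s \<le> t" "s * ?n < r"
    proof -
      show "s > 0" "s \<le> t" using t n \<open>r > 0\<close> by (auto simp: s_def)
      have "s \<le> r / 2 / ?n" by (simp add: s_def)
      then have "s * ?n \<le> r / 2" using n by (simp add: field_simps)
      then show "s * ?n < r" using \<open>r > 0\<close> by simp
    qed
    have "pos v + s *\<^sub>R tau v e \<in> open_cell e" using s t open_cell_eq[OF e] by auto
    moreover have "pos v + s *\<^sub>R tau v e \<in> B" using s n by (auto simp: B_def dist_norm)
    ultimately show False using Bs e(1) by (auto simp: support_def)
  qed
  \<comment> \<open>Inside the ball this is the gap between the potential and its supporting affine
    function of slope \<open>\<xi>\<close>; it is positively homogeneous, so one sphere controls all
    directions.\<close>
  define h where "h d = vol (w - \<xi>) d + fan v d" for d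
  have hpos: "h d > 0" if d: "d \<noteq> 0" "norm d < r" for d
  proof -
    have "pos v + d \<in> B" using d by (auto simp: B_def dist_norm)
    then have "pos v + d \<notin> ?M \<xi>" using \<open>B \<inter> ?M \<xi> = {}\<close> by blast
    then have "potential (pos v + d) \<noteq> potential (pos v) + vol \<xi> d"
      using contact_extend[OF vM, of "pos v + d"] by auto
    moreover have "potential (pos v) + vol \<xi> d \<le> potential (pos v + d)"
      using subgradD[of \<xi> potential "pos v" "pos v + d"] vM by (simp add: contact_def)
    ultimately show ?thesis using r1(2)[of d] d by (simp add: h_def vol_simps r_def)
  qed
  have hcont: "continuous_on (sphere 0 (r/2)) h"
  proof -
    have "continuous_on (sphere 0 (r/2)) (\<lambda>d. potential (pos v + d) - potential (pos v) - vol \<xi> d)"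
      by (intro continuous_intros continuous_on_compose2[OF potential_continuous]) auto
    then show ?thesis
      by (rule continuous_on_eq) (use r1(2) \<open>r > 0\<close> in \<open>auto simp: h_def vol_simps r_def\<close>)
  qed
  have ne: "sphere (0::'b) (r/2) \<noteq> {}" using \<open>r > 0\<close> by simp
  obtain d0 where d0: "d0 \<in> sphere 0 (r/2)" "\<And>d. d \<in> sphere 0 (r/2) \<Longrightarrow> h d0 \<le> h d"
    using continuous_attains_inf[OF compact_sphere ne hcont] by blast
  have "h d0 > 0" using d0(1) \<open>r > 0\<close> by (intro hpos) auto
  obtain K where K: "K > 0" "\<And>a b. norm (vol a b) \<le> norm a * norm b * K"
    using vol.pos_bounded by blast
  \<comment> \<open>With \<open>K\<close> bounding the bilinear form, a change of slope below
    \<open>\<delta>\<close> changes its value on the sphere of radius \<open>r / 2\<close> by at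
    most the minimum \<open>h d0\<close>.\<close>
  define \<delta> where "\<delta> = h d0 / (r / 2 * K)"
  have "\<delta> > 0" using \<open>h d0 > 0\<close> \<open>r > 0\<close> K by (simp add: \<delta>_def)
  have "ball \<xi> \<delta> \<subseteq> tile v"
  proof
    fix \<eta> assume eta: "\<eta> \<in> ball \<xi> \<delta>"
    have hs: "vol (\<eta> - w) d \<le> fan v d" if d: "d \<in> sphere 0 (r/2)" for d
    proof -
      have "vol (\<eta> - \<xi>) d \<le> norm (\<eta> - \<xi>) * norm d * K" using K(2)[of "\<eta> - \<xi>" d] by simp
      also have "\<dots> \<le> \<delta> * (r/2) * K"
        using eta d K(1) \<open>r > 0\<close> \<open>\<delta> > 0\<close> by (intro mult_right_mono mult_mono) (auto simp: dist_norm norm_minus_commute)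
      also have "\<dots> = h d0" using K(1) \<open>r > 0\<close> by (simp add: \<delta>_def)
      also have "\<dots> \<le> h d" by (rule d0(2)[OF d])
      finally show ?thesis by (simp add: h_def vol_simps)
    qed
    have all: "vol (\<eta> - w) d \<le> fan v d" for d
    proof (cases "d = 0")
      case False
      let ?c = "r / 2 / norm d"
      have c: "?c > 0" using False \<open>r > 0\<close> by simp
      have "?c *\<^sub>R d \<in> sphere 0 (r/2)" using False \<open>r > 0\<close> by simp
      from hs[OF this] have "?c * vol (\<eta> - w) d \<le> ?c * fan v d"
        using fan_scale[of ?c v d] c by (simp only: vol.scaleR_right real_scaleR_def less_imp_le)
      then show ?thesis using c by (rule mult_left_le_imp_le)
    qed (simp add: vol.zero_right)
    show "\<eta> \<in> tile v" unfolding tile_def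
    proof (rule subgrad_local[OF potential_convex])
      show "\<forall>\<^sub>F d in nhds 0. potential (pos v) + vol \<eta> d \<le> potential (pos v + d)"
        using ev
      proof eventually_elim
        case (elim d)
        then show ?case using all[of d] by (simp add: vol.diff_left)
      qed
    qed
  qed
  then have "\<xi> \<in> interior (tile v)" using \<open>\<delta> > 0\<close> mem_interior by blast
  then show False using xi(1) by (simp add: frontier_def)
qed

end

context area_plane
begin

lemma affine_unique_interior:
  assumes "interior S \<noteq> {}" "\<And>\<xi>. \<xi> \<in> S \<Longrightarrow> vol \<xi> y + c = vol \<xi> y' + c'"
  shows "y = y'"
proof (rule ccontr)
  assume "y \<noteq> y'"
  then have n: "y - y' \<noteq> 0" by simp
  obtain x where x: "x \<in> interior S" using assms(1) by blast
  have "vol \<xi> (y - y') = c' - c" if "\<xi> \<in> S" for \<xi>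
    using assms(2)[OF that] by (simp add: vol.diff_right)
  then show False
    using interior_vol_less[OF x n, of "c' - c"] x interior_subset by fastforce
qed

lemma affine_function_vol:
  assumes "affine_function g"
  obtains n c where "\<And>\<xi>. g \<xi> = vol \<xi> n + c"
proof -
  obtain h c where h: "linear h" "\<And>x. g x = h x + c" using assms by (auto simp: affine_function_def)
  obtain n where "\<And>x. h x = vol x n" using linear_functional_vol[OF h(1)] by blast
  then show ?thesis using that h by simp
qed

lemma affine_function_vol_add: "affine_function (\<lambda>\<xi>. vol \<xi> n + c)"
  unfolding affine_function_def
  by (intro exI[of _ "\<lambda>\<xi>. vol \<xi> n"] exI[of _ c]) (simp add: bounded_linear.linear vol.bounded_linear_left)

end

context plane_graph
begin

text \<open>A relative interior point of the facet lies on the frontier and so on some side. A face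
  that contains a relative interior point of \<open>F\<close> contains \<open>F\<close>, and the
  dimensions agree.\<close>

lemma facet_is_side:
  assumes v: "v \<in> V" and F: "F facet_of tile v"
  obtains e where "e \<in> star v" "F = side e"
proof -
  have face: "F face_of tile v" and ne: "F \<noteq> {}"
    and dim: "aff_dim F = aff_dim (tile v) - 1"
    using F by (auto simp: facet_of_def)
  then have cF: "convex F" using face_of_imp_convex by blast
  then obtain \<xi> where xi: "\<xi> \<in> rel_interior F" using ne rel_interior_eq_empty by blast
  have FP: "F \<subseteq> tile v" using face face_of_imp_subset by blast
  have "F \<noteq> tile v" using dim by auto
  then have "F \<inter> interior (tile v) = {}" using face_of_disjoint_interior[OF face] by blast
  moreover have "\<xi> \<in> F" using xi rel_interior_subset by blast
  ultimately have "\<xi> \<in> frontier (tile v)"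
    using FP closure_subset by (auto simp: frontier_def)
  then obtain e where e: "e \<in> star v" "\<xi> \<in> side e" using cell_frontier[OF v] by blast
  have sf: "side e facet_of tile v" using e side_facet by (auto simp: star_def)
  then have "F \<subseteq> side e"
    using subset_of_face_of[OF facet_of_imp_face_of FP] xi e by blast
  then have "F face_of side e" using face_of_subset[OF face] facet_of_imp_subset[OF sf] by blast
  moreover have "aff_dim F = aff_dim (side e)" using sf dim by (simp add: facet_of_def)
  moreover have "convex (side e)" using sf face_of_imp_convex facet_of_imp_face_of by blast
  ultimately have "F = side e" using face_of_aff_dim_lt by fastforce
  then show ?thesis using that e by blast
qed

text \<open>A compact convex set is the hull of its frontier, and here finitely many segments cover
  the frontier, so their end points span the tile.\<close>

lemma cell_polytope:
  assumes v: "v \<in> V" shows "polytope (tile v)"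
proof -
  have "\<forall>e\<in>star v. \<exists>w. side e = closed_segment w (w + tau v e)"
    using side_segment by (metis (mono_tags, lifting) mem_Collect_eq star_def)
  then obtain w where w: "\<And>e. e \<in> star v \<Longrightarrow> side e = closed_segment (w e) (w e + tau v e)" by metis
  define X where "X = (\<Union>e\<in>star v. {w e, w e + tau v e})"
  have "finite X" using finite_star by (simp add: X_def)
  have sub: "side e \<subseteq> convex hull X" if "e \<in> star v" for e
    unfolding w[OF that] segment_convex_hull by (rule hull_mono) (use that in \<open>auto simp: X_def\<close>)
  have "tile v = convex hull (frontier (tile v))"
    by (rule Krein_Milman_frontier[OF cell_convex cell_compact])
  also have "\<dots> \<subseteq> convex hull X"
    using cell_frontier[OF v] sub by (intro hull_minimal) auto
  finally have "tile v \<subseteq> convex hull X" .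
  moreover have "X \<subseteq> tile v"
  proof
    fix x assume "x \<in> X"
    then obtain e where e: "e \<in> star v" "x \<in> side e" using w by (auto simp: X_def)
    then show "x \<in> tile v" using side_subset by (auto simp: star_def)
  qed
  then have "convex hull X \<subseteq> tile v" by (rule hull_minimal) (rule cell_convex)
  ultimately show ?thesis using \<open>finite X\<close> unfolding polytope_def by blast
qed

text \<open>The dual graph reads incidence off inclusion, so accidental inclusions must be excluded.
  If every slope of the side also supports at \<open>u\<close>, then comparing the two end slopes
  puts \<open>pos u\<close> on the line of the cell. It is not on the open cell and, by
  \<open>behind\<close>, not past an end.\<close>

lemma side_subset_cell_imp_end:
  assumes e: "e \<in> E \<union> L" and u: "u \<in> V" and sub: "side e \<subseteq> tile u"
  shows "u \<in> ends e"
proof (rule ccontr)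
  assume nu: "u \<notin> ends e"
  \<comment> \<open>Some slope of \<open>tile v\<close> is strictly smaller along
    \<open>tau v e\<close> than the slopes of the side. At a point behind \<open>v\<close> its
    affine function would exceed the potential, which there equals the value given by
    \<open>\<xi>0\<close>.\<close>
  have behind: False if v: "v \<in> ends e" and s: "pos u = pos v + s *\<^sub>R tau v e" "s < 0" for v s
  proof -
    have vV: "v \<in> V" using ends_subset[OF e] v by blast
    obtain \<xi>0 where x0: "\<xi>0 \<in> side e" using side_nonempty[OF e] by blast
    have x0v: "\<xi>0 \<in> tile v" using x0 side_subset[OF e v] by blast
    have x0u: "\<xi>0 \<in> tile u" using x0 sub by blast
    have eq: "potential (pos u) = potential (pos v) + vol \<xi>0 (pos u - pos v)"
      using contact_eq[of "pos v" potential \<xi>0 "pos u"] x0u x0v by (simp add: contact_def tile_def)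
    have le: "vol \<xi> (tau v e) \<le> vol \<xi>0 (tau v e)" if "\<xi> \<in> tile v" for \<xi>
      using side_max(1)[OF e v x0 that] by (simp add: vol.diff_left)
    obtain \<xi> where xi: "\<xi> \<in> tile v" "vol \<xi> (tau v e) < vol \<xi>0 (tau v e)"
      using cell_not_flat[OF vV tau_nonzero[OF e v] le] .
    have "vol \<xi> (pos u - pos v) \<le> vol \<xi>0 (pos u - pos v)"
      using subgradD[of \<xi> potential "pos v" "pos u"] xi(1) eq by (simp add: tile_def)
    then have "s * vol \<xi> (tau v e) \<le> s * vol \<xi>0 (tau v e)" by (simp add: s vol.scaleR_right)
    then show False using xi(2) s(2) by simp
  qed
  obtain v where v: "v \<in> ends e" using exists_end[OF e] by blast
  then have vV: "v \<in> V" using ends_subset[OF e] by blast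
  obtain z where z: "z \<in> open_cell e" using open_cell_nonempty[OF e] by blast
  obtain t where t: "z = pos v + t *\<^sub>R tau v e" using z open_cell_eq[OF e v] by auto
  obtain a where a: "side e = closed_segment a (a + tau v e)" using side_segment[OF e v] .
  have "potential (pos u) = potential z + vol \<xi> (pos u - z)" if "\<xi> \<in> side e" for \<xi>
    using contact_eq[of z potential \<xi> "pos u"] that sub side_eq_subgrad[OF e z]
    by (auto simp: contact_def tile_def)
  from this[of a] this[of "a + tau v e"] have "vol (tau v e) (pos u - z) = 0"
    by (simp add: a vol.add_left)
  then have "vol (pos u - z) (tau v e) = 0" using vol_skew[of "pos u - z"] by simp
  then obtain c where c: "pos u - z = c *\<^sub>R tau v e" using parallel_if_vol_zero tau_nonzero[OF e v] by blast
  have s: "pos u = pos v + (t + c) *\<^sub>R tau v e" using c t by (simp add: algebra_simps)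
  have s0: "t + c \<ge> 0" using behind[OF v s] by (meson not_le)
  have "t + c \<noteq> 0"
  proof
    assume "t + c = 0"
    then have "pos u = pos v" using s by simp
    then have "u = v" using inj_onD[OF inj_pos _ u vV] by blast
    then show False using nu v by simp
  qed
  then have "t + c > 0" using s0 by simp
  then have "\<not> (e \<in> E \<longrightarrow> t + c < len e)" using cell_avoids_vertex[OF e v u, of "t + c"] s by blast
  then have "e \<in> E" "len e \<le> t + c" by auto
  from e v show False
  proof (cases rule: ends_cases)
    case (edge w)
    then have w: "pos w = pos v + len e *\<^sub>R tau v e" "tau w e = - tau v e" "w \<in> ends e"
      using edge_vector[of e v w] by auto
    \<comment> \<open>Beyond the far end \<open>w\<close> means behind \<open>w\<close> when the
      edge is read from \<open>w\<close>.\<close>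
    have "pos u = pos w + (len e - (t + c)) *\<^sub>R tau w e" using s w by (simp add: algebra_simps)
    moreover have "len e \<noteq> t + c"
    proof
      assume "len e = t + c"
      then have "pos u = pos w" using s w(1) by simp
      moreover have "w \<in> V" using w(3) ends_subset[OF e] by blast
      ultimately have "u = w" using inj_onD[OF inj_pos _ u] by blast
      then show False using nu w(3) by simp
    qed
    ultimately show False using behind[OF w(3), of "len e - (t + c)"] \<open>len e \<le> t + c\<close> by linarith
  qed (use \<open>e \<in> E\<close> in simp)
qed

text \<open>Cells with the same side share an end, and their momenta there are parallel. Opposite
  momenta would bound the tile on both sides of one line and flatten it; equal directions are
  excluded by \<open>arms_distinct\<close>.\<close>

lemma side_inj: "inj_on side (E \<union> L)"
proof (rule inj_onI)
  fix e e' assume e: "e \<in> E \<union> L" and e': "e' \<in> E \<union> L" and eq: "side e = side e'"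
  obtain v where v: "v \<in> ends e" using exists_end[OF e] by blast
  then have vV: "v \<in> V" using ends_subset[OF e] by blast
  have v': "v \<in> ends e'" using side_subset_cell_imp_end[OF e' vV] side_subset[OF e v] eq by simp
  obtain a where a: "side e = closed_segment a (a + tau v e)" using side_segment[OF e v] .
  have mem: "a \<in> side e" "a + tau v e \<in> side e" by (auto simp: a)
  then have mem': "a \<in> side e'" "a + tau v e \<in> side e'" using eq by auto
  have "vol (tau v e) (tau v e') = 0"
    using side_max(2)[OF e' v' mem'(1), of "a + tau v e"] mem'(2) side_subset[OF e' v'] by auto
  then have "vol (tau v e') (tau v e) = 0" using vol_skew[of "tau v e'"] by simp
  then obtain c where c: "tau v e' = c *\<^sub>R tau v e" using parallel_if_vol_zero tau_nonzero[OF e v] by blast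
  have "c > 0"
  proof (rule ccontr)
    assume "\<not> c > 0"
    moreover have "c \<noteq> 0" using c tau_nonzero[OF e' v'] by auto
    ultimately have "c < 0" by simp
    have le: "vol \<xi> (tau v e) \<le> vol a (tau v e)" if "\<xi> \<in> tile v" for \<xi>
      using side_max(1)[OF e v mem(1) that] by (simp add: vol.diff_left)
    obtain \<xi> where xi: "\<xi> \<in> tile v" "vol \<xi> (tau v e) < vol a (tau v e)"
      using cell_not_flat[OF vV tau_nonzero[OF e v] le] .
    have "c * vol (\<xi> - a) (tau v e) \<le> 0"
      using side_max(1)[OF e' v' mem'(1) xi(1)] by (simp add: c vol.scaleR_right)
    then show False using \<open>c < 0\<close> xi(2) by (simp add: mult_le_0_iff vol.diff_left)
  qed
  then show "e = e'" using arms_distinct[of e v e' c] c e e' v v' by (simp add: star_def)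
qed

section \<open>The dual polygon\<close>

definition dual_polygon :: "'b set" where
  "dual_polygon = (\<Union>v\<in>V. tile v)"

text \<open>A nonempty contact set avoiding the graph would be open and closed, hence the whole
  plane, which does contain the graph. Once it meets a cell it contains the ends.\<close>

lemma contact_meets_vertex:
  assumes "contact potential \<xi> \<noteq> {}"
  shows "\<xi> \<in> dual_polygon"
proof -
  let ?M = "contact potential \<xi>"
  have "\<exists>z. z \<in> ?M \<inter> support"
  proof (rule ccontr)
    assume none: "\<not> ?thesis"
    have "?M = interior ?M"
      using contact_affine_open[OF potential_germ_off] none interior_subset by blast
    then have "open ?M" by (metis open_interior)
    then have "?M = UNIV"
      using assms closed_contact[OF potential_continuous] clopen by blast
    then show False using none V_nonempty by (auto simp: support_def)
  qed
  then obtain z where z: "z \<in> ?M" "z \<in> support" by blast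
  then have "\<exists>v\<in>V. pos v \<in> ?M"
    using contact_cell(2) exists_end ends_subset unfolding support_def by blast
  then show ?thesis by (auto simp: dual_polygon_def tile_def contact_def)
qed

lemma dual_polygon_compact: "compact dual_polygon"
  unfolding dual_polygon_def using finite_V cell_compact by (intro compact_UN) auto

lemma dual_polygon_interior: "interior dual_polygon \<noteq> {}"
proof -
  obtain v where v: "v \<in> V" using V_nonempty by blast
  then have "tile v \<subseteq> dual_polygon" by (auto simp: dual_polygon_def)
  then show ?thesis using cell_interior[OF v] interior_mono by blast
qed

text \<open>The slopes for which the potential stays above some affine function form a convex set, and
  the minimum is attained for slopes in its interior.\<close>

lemma dual_polygon_convex: "convex dual_polygon"
proof -
  \<comment> \<open>The effective domain of the Legendre transform of the potential.\<close>
  define D where "D = {\<xi>. \<exists>c. \<forall>x. vol \<xi> x + c \<le> potential x}"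
  have "convex D"
  proof (rule convexI)
    fix \<xi> \<eta> and u v :: real assume *: "\<xi> \<in> D" "\<eta> \<in> D" "0 \<le> u" "0 \<le> v" "u + v = 1"
    obtain c c' where c: "\<And>x. vol \<xi> x + c \<le> potential x" "\<And>x. vol \<eta> x + c' \<le> potential x"
      using * by (auto simp: D_def)
    have "vol (u *\<^sub>R \<xi> + v *\<^sub>R \<eta>) x + (u * c + v * c') \<le> potential x" for x
    proof -
      have "vol (u *\<^sub>R \<xi> + v *\<^sub>R \<eta>) x + (u * c + v * c') = u * (vol \<xi> x + c) + v * (vol \<eta> x + c')"
        by (simp add: vol.add_left vol.scaleR_left algebra_simps)
      also have "\<dots> \<le> u * potential x + v * potential x"
        using * c by (intro add_mono mult_left_mono) auto
      also have "\<dots> = potential x" using *(5) by (simp flip: distrib_right)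
      finally show ?thesis .
    qed
    then show "u *\<^sub>R \<xi> + v *\<^sub>R \<eta> \<in> D" by (auto simp: D_def)
  qed
  have QD: "dual_polygon \<subseteq> D"
  proof
    fix \<xi> assume "\<xi> \<in> dual_polygon"
    then obtain v where "\<xi> \<in> tile v" by (auto simp: dual_polygon_def)
    then have "vol \<xi> x + (potential (pos v) - vol \<xi> (pos v)) \<le> potential x" for x
      using subgradD[of \<xi> potential "pos v" x] by (simp add: tile_def vol.diff_right)
    then show "\<xi> \<in> D" by (auto simp: D_def)
  qed
  have "interior D \<subseteq> dual_polygon"
  proof
    fix \<xi> assume "\<xi> \<in> interior D"
    then obtain \<epsilon> where eps: "\<epsilon> > 0" "ball \<xi> \<epsilon> \<subseteq> D" by (auto simp: mem_interior)
    obtain p q where pq: "vol p q = 1" using unit_frame .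
    then have "p \<noteq> 0" "q \<noteq> 0" by (auto simp: vol.zero_left vol.zero_right)
    define N where "N = norm p + norm q"
    have N: "N > 0" "norm p \<le> N" "norm q \<le> N" using \<open>p \<noteq> 0\<close> by (auto simp: N_def add_pos_nonneg)
    \<comment> \<open>Small enough for the four slopes shifted by \<open>\<delta>\<close> along plus
      or minus \<open>p\<close> and \<open>q\<close> to stay in the ball inside
      \<open>D\<close>.\<close>
    define \<delta> where "\<delta> = \<epsilon> / (2 * N)"
    have d: "\<delta> > 0" "\<delta> * N < \<epsilon>" using eps N by (auto simp: \<delta>_def)
    have mem: "\<xi> + s *\<^sub>R u \<in> D" if "u = p \<or> u = q" "\<bar>s\<bar> = \<delta>" for s u
    proof -
      have "norm (s *\<^sub>R u) \<le> \<delta> * N" using that N d by (auto intro: mult_left_mono)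
      then have "\<xi> + s *\<^sub>R u \<in> ball \<xi> \<epsilon>" using d by (simp add: dist_norm)
      then show ?thesis using eps by blast
    qed
    have "\<exists>c. \<forall>x. vol \<xi> x + \<delta> * \<bar>vol u x\<bar> + c \<le> potential x" if u: "u = p \<or> u = q" for u
    proof -
      obtain c c' where "\<And>x. vol (\<xi> + \<delta> *\<^sub>R u) x + c \<le> potential x" "\<And>x. vol (\<xi> + (- \<delta>) *\<^sub>R u) x + c' \<le> potential x"
        using mem[OF u, of \<delta>] mem[OF u, of "- \<delta>"] d unfolding D_def by auto
      then have "vol \<xi> x + \<delta> * vol u x + c \<le> potential x" "vol \<xi> x - \<delta> * vol u x + c' \<le> potential x" for x
        by (simp_all add: vol_simps)
      then have "vol \<xi> x + \<delta> * \<bar>vol u x\<bar> + min c c' \<le> potential x" for x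
        by (smt (verit) mult_minus_right)
      then show ?thesis by blast
    qed
    then obtain c c' where c: "\<And>x. vol \<xi> x + \<delta> * \<bar>vol p x\<bar> + c \<le> potential x" "\<And>x. vol \<xi> x + \<delta> * \<bar>vol q x\<bar> + c' \<le> potential x"
      by metis
    \<comment> \<open>The four shifted slopes make the potential minus \<open>vol \<xi>\<close> grow
      at least linearly, so the search for a minimum reduces to a ball.\<close>
    have growth: "\<delta> * norm x + N * (c + c') \<le> N * 2 * (potential x - vol \<xi> x)" for x
    proof -
      have "norm x \<le> \<bar>vol x q\<bar> * norm p + \<bar>vol p x\<bar> * norm q" by (rule two_functionals_bounded[OF pq])
      also have "\<dots> \<le> \<bar>vol x q\<bar> * N + \<bar>vol p x\<bar> * N" using N by (intro add_mono mult_left_mono) auto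
      also have "\<dots> = N * (\<bar>vol q x\<bar> + \<bar>vol p x\<bar>)" using vol_skew[of x q] by (simp add: algebra_simps)
      finally have "\<delta> * norm x \<le> \<delta> * (N * (\<bar>vol q x\<bar> + \<bar>vol p x\<bar>))" using d by simp
      also have "\<dots> = N * (\<delta> * \<bar>vol q x\<bar> + \<delta> * \<bar>vol p x\<bar>)" by (simp add: algebra_simps)
      also have "\<dots> \<le> N * (2 * (potential x - vol \<xi> x) - (c + c'))"
        using c(1)[of x] c(2)[of x] N by (intro mult_left_mono) auto
      finally show ?thesis by (simp add: algebra_simps)
    qed
    \<comment> \<open>Outside this radius the growth bound already exceeds the value at 0.\<close>
    define R where "R = max 0 ((N * 2 * potential 0 - N * (c + c')) / \<delta>)"
    have "continuous_on (cball 0 R) (\<lambda>x. potential x - vol \<xi> x)"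
      by (intro continuous_intros continuous_on_subset[OF potential_continuous]) auto
    moreover have "0 \<in> cball 0 R" by (simp add: R_def)
    ultimately obtain x0 where x0: "x0 \<in> cball 0 R" "\<And>x. x \<in> cball 0 R \<Longrightarrow> potential x0 - vol \<xi> x0 \<le> potential x - vol \<xi> x"
      using continuous_attains_inf[OF compact_cball, of 0 R "\<lambda>x. potential x - vol \<xi> x"] by blast
    have "potential x0 - vol \<xi> x0 \<le> potential x - vol \<xi> x" for x
    proof (cases "x \<in> cball 0 R")
      case False
      then have "norm x > (N * 2 * potential 0 - N * (c + c')) / \<delta>" by (simp add: R_def)
      then have "\<delta> * norm x > N * 2 * potential 0 - N * (c + c')" using d by (simp add: field_simps)
      then have "N * 2 * potential 0 < N * 2 * (potential x - vol \<xi> x)" using growth[of x] by linarith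
      then have "potential 0 < potential x - vol \<xi> x" using N by simp
      moreover have "potential x0 - vol \<xi> x0 \<le> potential 0" using x0(2)[OF \<open>0 \<in> cball 0 R\<close>] by (simp add: vol.zero_right)
      ultimately show ?thesis by simp
    qed (use x0 in blast)
    then have "x0 \<in> contact potential \<xi>"
      by (simp add: contact_def subgrad_def vol.diff_right algebra_simps)
    then show "\<xi> \<in> dual_polygon" using contact_meets_vertex by blast
  qed
  moreover have "interior D \<noteq> {}" using dual_polygon_interior interior_mono[OF QD] by blast
  \<comment> \<open>A convex set with interior lies in the closure of its interior, and the dual
    polygon is closed; so boundary slopes of \<open>D\<close>, for which a minimum need not be
    evident, are covered too.\<close>
  ultimately have "closure D \<subseteq> dual_polygon"
    using convex_closure_interior[OF \<open>convex D\<close>] closure_minimal[OF _ compact_imp_closed[OF dual_polygon_compact]]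
    by metis
  then have "D \<subseteq> dual_polygon" using closure_subset by blast
  then show ?thesis using QD \<open>convex D\<close> by (metis subset_antisym)
qed

lemma dual_polygon_convex_polygon: "convex_polygon dual_polygon"
proof -
  have "\<forall>v\<in>V. \<exists>X. finite X \<and> tile v = convex hull X"
    using cell_polytope by (auto simp: polytope_def)
  then obtain X where X: "\<And>v. v \<in> V \<Longrightarrow> finite (X v) \<and> tile v = convex hull X v" by metis
  have "dual_polygon = convex hull (\<Union>v\<in>V. X v)"
  proof
    have "convex hull X v \<subseteq> convex hull (\<Union>v\<in>V. X v)" if "v \<in> V" for v
      using that by (intro hull_mono) auto
    then show "dual_polygon \<subseteq> convex hull (\<Union>v\<in>V. X v)"
      using X by (auto simp: dual_polygon_def)
    have "X v \<subseteq> dual_polygon" if "v \<in> V" for v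
      using X[OF that] that hull_subset[of "X v" convex] by (auto simp: dual_polygon_def)
    then show "convex hull (\<Union>v\<in>V. X v) \<subseteq> dual_polygon"
      by (intro hull_minimal dual_polygon_convex) auto
  qed
  moreover have "finite (\<Union>v\<in>V. X v)" using X finite_V by auto
  ultimately show ?thesis
    using dual_polygon_interior by (auto simp: convex_polygon_def polytope_def)
qed

text \<open>Along the leg the potential equals the affine function of slope \<open>\<xi>0\<close>
  arbitrarily far out. A slope of the polygon that is larger in the direction of the leg would
  eventually overtake it, so the side lies on a supporting line.\<close>

lemma leg_side_frontier:
  assumes l: "l \<in> L" shows "side l \<subseteq> frontier dual_polygon"
proof
  fix \<xi>0 assume x0: "\<xi>0 \<in> side l"
  have l': "l \<in> E \<union> L" "l \<notin> E" using l disjoint_EL by auto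
  obtain v where v: "v \<in> ends l" using exists_end[OF l'(1)] by blast
  have vV: "v \<in> V" using ends_subset[OF l'(1)] v by blast
  have x0Q: "\<xi>0 \<in> dual_polygon" using x0 side_subset[OF l'(1) v] vV by (auto simp: dual_polygon_def)
  have "vol \<xi> (tau v l) \<le> vol \<xi>0 (tau v l)" if xi: "\<xi> \<in> dual_polygon" for \<xi>
  proof (rule ccontr)
    assume "\<not> ?thesis"
    then have pos: "vol (\<xi> - \<xi>0) (tau v l) > 0" by (simp add: vol.diff_left)
    obtain u where u: "\<xi> \<in> tile u" using xi by (auto simp: dual_polygon_def)
    define K where "K = potential (pos v) - potential (pos u) - vol \<xi> (pos v - pos u)"
    have le: "t * vol (\<xi> - \<xi>0) (tau v l) \<le> K" if "t > 0" for t
    proof -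
      let ?z = "pos v + t *\<^sub>R tau v l"
      have z: "?z \<in> open_cell l" using that l' open_cell_eq[OF l'(1) v] by auto
      have "?z \<in> contact potential \<xi>0" using x0 z by (auto simp: side_def)
      moreover have "pos v \<in> contact potential \<xi>0"
        using x0 side_subset[OF l'(1) v] by (auto simp: contact_def tile_def)
      ultimately have "potential ?z = potential (pos v) + t * vol \<xi>0 (tau v l)"
        using contact_eq[of "pos v" potential \<xi>0 ?z] by (simp add: vol.scaleR_right)
      moreover have "potential (pos u) + vol \<xi> (?z - pos u) \<le> potential ?z"
        using subgradD u by (simp add: tile_def)
      ultimately show ?thesis by (simp add: K_def vol_simps algebra_simps)
    qed
    have "(\<bar>K\<bar> + 1) / vol (\<xi> - \<xi>0) (tau v l) > 0" using pos by simp
    from le[OF this] have "\<bar>K\<bar> + 1 \<le> K" using pos by simp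
    then show False by linarith
  qed
  then have "\<xi>0 \<notin> interior dual_polygon"
    using interior_vol_less[of \<xi>0 dual_polygon "tau v l"] tau_nonzero[OF l'(1) v] by blast
  then show "\<xi>0 \<in> frontier dual_polygon" using x0Q closure_subset by (auto simp: frontier_def)
qed

text \<open>A supporting line of the polygon at an inner point of the side must contain the side,
  while the tiles of the two ends lie on opposite sides of that line.\<close>

lemma edge_side_not_frontier:
  assumes e: "e \<in> E" shows "\<not> side e \<subseteq> frontier dual_polygon"
proof
  assume sub: "side e \<subseteq> frontier dual_polygon"
  obtain v w where vw: "v \<noteq> w" "ends e = {v, w}" using ends_edge[OF e] by blast
  have ev: "e \<in> E \<union> L" "v \<in> ends e" "w \<in> ends e" using e vw by auto
  have V: "v \<in> V" "w \<in> V" using ends_subset[OF ev(1)] vw by auto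
  obtain a where a: "side e = closed_segment a (a + tau v e)" using side_segment[OF ev(1,2)] .
  \<comment> \<open>At the midpoint the supporting functional is minimal, so it cannot differ
    between the two end points of the side.\<close>
  define \<xi>0 where "\<xi>0 = a + (1/2) *\<^sub>R tau v e"
  have "\<xi>0 = (1 - 1/2) *\<^sub>R a + (1/2) *\<^sub>R (a + tau v e)" by (simp add: \<xi>0_def algebra_simps flip: scaleR_left_distrib)
  then have x0: "\<xi>0 \<in> side e" unfolding a by (auto simp: in_segment intro!: exI[of _ "1/2::real"])
  have sQ: "side e \<subseteq> dual_polygon" using side_subset[OF ev(1,2)] V by (auto simp: dual_polygon_def)
  obtain n where n0: "n \<noteq> 0" and n: "\<And>y. y \<in> dual_polygon \<Longrightarrow> vol \<xi>0 n \<le> vol y n"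
    using supporting_vol[OF dual_polygon_convex subsetD[OF sQ x0] subsetD[OF sub x0] dual_polygon_interior] by blast
  have "a \<in> dual_polygon" "a + tau v e \<in> dual_polygon" using sQ a by auto
  then have "vol (tau v e) n = 0" using n[of a] n[of "a + tau v e"] by (simp add: \<xi>0_def vol_simps)
  then have "vol n (tau v e) = 0" using vol_skew[of n] by simp
  then obtain k where k: "n = k *\<^sub>R tau v e" using parallel_if_vol_zero tau_nonzero[OF ev(1,2)] by blast
  then have "k \<noteq> 0" using n0 by auto
  have twosided: "vol (\<xi> - \<xi>0) n \<ge> 0" if "u \<in> {v, w}" "\<xi> \<in> tile u" for u \<xi>
    using n[of \<xi>] that V by (auto simp: dual_polygon_def vol.diff_left)
  have exists: "\<exists>\<xi> \<in> tile u. vol (\<xi> - \<xi>0) (tau u e) < 0" if u: "u \<in> ends e" for u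
  proof -
    have uV: "u \<in> V" using u ends_subset[OF ev(1)] by blast
    have le: "vol \<xi> (tau u e) \<le> vol \<xi>0 (tau u e)" if "\<xi> \<in> tile u" for \<xi>
      using side_max(1)[OF ev(1) u x0 that] by (simp add: vol.diff_left)
    obtain \<xi> where "\<xi> \<in> tile u" "vol \<xi> (tau u e) < vol \<xi>0 (tau u e)"
      using cell_not_flat[OF uV tau_nonzero[OF ev(1) u] le] .
    then show ?thesis by (auto simp: vol.diff_left)
  qed
  have tw: "tau w e = - tau v e" using edge_vector[OF e vw] by blast
  obtain \<xi>1 where 1: "\<xi>1 \<in> tile v" "vol (\<xi>1 - \<xi>0) (tau v e) < 0" using exists[OF ev(2)] by blast
  obtain \<xi>2 where 2: "\<xi>2 \<in> tile w" "vol (\<xi>2 - \<xi>0) (tau v e) > 0"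
    using exists[OF ev(3)] by (auto simp: tw vol.minus_right)
  have "k * vol (\<xi>1 - \<xi>0) (tau v e) \<ge> 0" "k * vol (\<xi>2 - \<xi>0) (tau v e) \<ge> 0"
    using twosided[of v \<xi>1] twosided[of w \<xi>2] 1 2 by (simp_all add: k vol.scaleR_right)
  then show False using 1(2) 2(2) \<open>k \<noteq> 0\<close> by (simp add: zero_le_mult_iff)
qed

section \<open>The Legendre transform as a strictly convex PL-function on the dual polygon\<close>

text \<open>Finitely many vertices suffice: a slope of the dual polygon supports the potential at
  some vertex, where the supremum over the whole plane is attained.\<close>

definition dual_function :: "'b \<Rightarrow> real" where
  "dual_function \<xi> = Max ((\<lambda>v. vol \<xi> (pos v) - potential (pos v)) ` V)"

lemma dual_function_ge: "v \<in> V \<Longrightarrow> vol \<xi> (pos v) - potential (pos v) \<le> dual_function \<xi>"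
  unfolding dual_function_def using finite_V by (intro Max_ge) auto

lemma dual_function_attained: "\<exists>v\<in>V. dual_function \<xi> = vol \<xi> (pos v) - potential (pos v)"
proof -
  have "dual_function \<xi> \<in> (\<lambda>v. vol \<xi> (pos v) - potential (pos v)) ` V"
    unfolding dual_function_def using finite_V V_nonempty by (intro Max_in) auto
  then show ?thesis by auto
qed

lemma dual_function_cell:
  assumes "v \<in> V" "\<xi> \<in> tile v"
  shows "dual_function \<xi> = vol \<xi> (pos v) - potential (pos v)"
proof -
  obtain w where w: "w \<in> V" "dual_function \<xi> = vol \<xi> (pos w) - potential (pos w)"
    using dual_function_attained by blast
  have "potential (pos v) + vol \<xi> (pos w - pos v) \<le> potential (pos w)"
    using assms(2) subgradD by (simp add: tile_def)
  then show ?thesis using w dual_function_ge[OF assms(1), of \<xi>] by (simp add: vol.diff_right)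
qed

lemma dual_function_convex: "convex_on UNIV dual_function"
proof (rule convex_onI)
  fix t :: real and x y assume t: "0 < t" "t < 1"
  obtain v where v: "v \<in> V" "dual_function ((1 - t) *\<^sub>R x + t *\<^sub>R y) =
      vol ((1 - t) *\<^sub>R x + t *\<^sub>R y) (pos v) - potential (pos v)"
    using dual_function_attained by blast
  note v(2)
  also have "vol ((1 - t) *\<^sub>R x + t *\<^sub>R y) (pos v) - potential (pos v) = (1 - t) * (vol x (pos v) - potential (pos v)) + t * (vol y (pos v) - potential (pos v))"
    by (simp only: vol.add_left vol.scaleR_left real_scaleR_def) (simp add: algebra_simps)
  also have "\<dots> \<le> (1 - t) * dual_function x + t * dual_function y"
    using t dual_function_ge[OF v(1)] by (intro add_mono mult_left_mono) auto
  finally show "dual_function ((1 - t) *\<^sub>R x + t *\<^sub>R y) \<le> (1 - t) * dual_function x + t * dual_function y" .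
qed simp

lemma cell_convex_polygon: "v \<in> V \<Longrightarrow> convex_polygon (tile v)"
  by (simp add: convex_polygon_def cell_polytope cell_interior)

text \<open>Otherwise the dual function would have on the smaller tile both linear parts
  \<open>pos v\<close> and \<open>pos w\<close>, which the interior of the tile forbids.\<close>

lemma cell_not_subset:
  assumes "v \<in> V" "w \<in> V" "v \<noteq> w" shows "\<not> tile v \<subseteq> tile w"
proof
  assume sub: "tile v \<subseteq> tile w"
  have "pos v \<noteq> pos w" using assms inj_pos by (auto simp: inj_on_def)
  have eq: "vol \<xi> (pos w) + - potential (pos w) = vol \<xi> (pos v) + - potential (pos v)" if "\<xi> \<in> tile v" for \<xi>
    using dual_function_cell[OF assms(1) that] dual_function_cell[OF assms(2)] sub that by auto
  show False using affine_unique_interior[OF cell_interior[OF assms(1)] eq] \<open>pos v \<noteq> pos w\<close> by simp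
qed

lemma inj_cell: "inj_on tile V"
proof (rule inj_onI)
  fix v w assume "v \<in> V" "w \<in> V" "tile v = tile w"
  then show "v = w" using cell_not_subset[of v w] by blast
qed

lemma dual_subdivision: "polygonal_subdivision dual_polygon (tile ` V)"
  unfolding polygonal_subdivision_def
proof (intro conjI ballI impI)
  fix P P' assume "P \<in> tile ` V" "P' \<in> tile ` V" "P \<noteq> P'"
  then obtain v w where vw: "v \<in> V" "P = tile v" "w \<in> V" "P' = tile w" "v \<noteq> w" by blast
  show "(P \<inter> P') face_of P" unfolding vw tile_def by (rule subgrad_Int_face)
  show "(P \<inter> P') face_of P'"
    unfolding vw tile_def using subgrad_Int_face[of potential "pos w" "pos v"] by (simp add: Int_commute)
  show "P \<inter> P' \<noteq> P" "P \<inter> P' \<noteq> P'" using cell_not_subset vw by blast+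
qed (use finite_V cell_convex_polygon in \<open>auto simp: dual_polygon_def\<close>)

lemma dual_function_strictly_convex: "strictly_convex_PL dual_polygon (tile ` V) dual_function"
  unfolding strictly_convex_PL_def
proof (intro conjI ballI allI impI)
  show "continuous_on dual_polygon dual_function"
    using convex_on_continuous[OF open_UNIV dual_function_convex] continuous_on_subset by blast
  show "convex_on dual_polygon dual_function"
    using convex_on_subset[OF dual_function_convex] dual_polygon_convex by blast
next
  fix P assume "P \<in> tile ` V"
  then obtain v where v: "v \<in> V" "P = tile v" by blast
  then have "\<forall>\<xi> \<in> P. dual_function \<xi> = vol \<xi> (pos v) + - potential (pos v)"
    using dual_function_cell by simp
  then show "\<exists>g. affine_function g \<and> (\<forall>x\<in>P. dual_function x = g x)"
    using affine_function_vol_add by blast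
next
  fix P P' g g'
  assume "P \<in> tile ` V" "P' \<in> tile ` V" and ne: "P \<noteq> P' \<and> (\<exists>F. F facet_of P \<and> F facet_of P')"
    and g: "affine_function g \<and> (\<forall>x\<in>P. dual_function x = g x) \<and> affine_function g' \<and> (\<forall>x\<in>P'. dual_function x = g' x)"
  then obtain v w where vw: "v \<in> V" "P = tile v" "w \<in> V" "P' = tile w" "v \<noteq> w" by blast
  show "g \<noteq> g'"
  proof
    assume "g = g'"
    obtain n c where n: "\<And>\<xi>. g \<xi> = vol \<xi> n + c" using affine_function_vol g by metis
    have *: "n = pos u" if u: "u \<in> V" and eq: "\<forall>x\<in>tile u. dual_function x = g x" for u
      by (rule affine_unique_interior[OF cell_interior[OF u], of n c "pos u" "- potential (pos u)"])
         (use dual_function_cell[OF u] eq n in auto)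
    have "n = pos v" "n = pos w" using * vw g \<open>g = g'\<close> by blast+
    then show False using inj_onD[OF inj_pos, of v w] vw by simp
  qed
qed

lemma dual_graph_iso:
  "legged_graph_iso \<lparr>verts = V, edges = E, legs = L, ends = ends\<rparr>
     (dual_graph dual_polygon (tile ` V)) tile side"
proof -
  have facets: "{F. \<exists>P \<in> tile ` V. F facet_of P} = side ` (E \<union> L)"
  proof (intro set_eqI iffI)
    fix F assume "F \<in> {F. \<exists>P \<in> tile ` V. F facet_of P}"
    then obtain v where "v \<in> V" "F facet_of tile v" by blast
    then obtain e where "e \<in> star v" "F = side e" using facet_is_side by blast
    then show "F \<in> side ` (E \<union> L)" by (auto simp: star_def)
  next
    fix F assume "F \<in> side ` (E \<union> L)"
    then obtain e where e: "e \<in> E \<union> L" "F = side e" by blast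
    obtain v where v: "v \<in> ends e" using exists_end[OF e(1)] by blast
    then have "v \<in> V" using ends_subset[OF e(1)] by blast
    then show "F \<in> {F. \<exists>P \<in> tile ` V. F facet_of P}" using side_facet[OF e(1) v] e(2) by blast
  qed
  have edges: "{F. (\<exists>P \<in> tile ` V. F facet_of P) \<and> \<not> F \<subseteq> frontier dual_polygon} = side ` E"
  proof -
    have "{F. (\<exists>P \<in> tile ` V. F facet_of P) \<and> \<not> F \<subseteq> frontier dual_polygon} =
        {F \<in> side ` (E \<union> L). \<not> F \<subseteq> frontier dual_polygon}"
      unfolding facets[symmetric] by simp
    also have "\<dots> = side ` E" using leg_side_frontier edge_side_not_frontier by auto
    finally show ?thesis .
  qed
  have legs: "{F. (\<exists>P \<in> tile ` V. F facet_of P) \<and> F \<subseteq> frontier dual_polygon} = side ` L"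
  proof -
    have "{F. (\<exists>P \<in> tile ` V. F facet_of P) \<and> F \<subseteq> frontier dual_polygon} =
        {F \<in> side ` (E \<union> L). F \<subseteq> frontier dual_polygon}"
      unfolding facets[symmetric] by simp
    also have "\<dots> = side ` L"
    proof (intro set_eqI iffI)
      fix F assume "F \<in> {F \<in> side ` (E \<union> L). F \<subseteq> frontier dual_polygon}"
      then show "F \<in> side ` L" using edge_side_not_frontier by auto
    next
      fix F assume "F \<in> side ` L"
      then obtain l where "l \<in> L" "F = side l" by blast
      then show "F \<in> {F \<in> side ` (E \<union> L). F \<subseteq> frontier dual_polygon}" using leg_side_frontier[of l] by auto
    qed
    finally show ?thesis .
  qed
  have ends: "{P \<in> tile ` V. side e \<subseteq> P} = tile ` ends e" if e: "e \<in> E \<union> L" for e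
    using side_subset_cell_imp_end[OF e] side_subset[OF e] ends_subset[OF e] by blast
  show ?thesis
    unfolding legged_graph_iso_def dual_graph_def
    using inj_cell inj_on_subset[OF side_inj] edges legs ends
    by (simp add: bij_betw_def)
qed

text \<open>Since \<open>tau v e\<close> is maximised on its side, traversing the side along
  \<open>tau v e\<close> is the boundary orientation.\<close>

lemma side_oriented:
  assumes e: "e \<in> E \<union> L" and v: "v \<in> ends e"
  obtains a b where "side e = closed_segment a b" "b - a = tau v e" "boundary_oriented vol (tile v) a b"
proof -
  obtain a where a: "side e = closed_segment a (a + tau v e)" using side_segment[OF e v] .
  then have "a \<in> side e" by simp
  have le: "vol \<xi> (tau v e) \<le> vol a (tau v e)" if "\<xi> \<in> tile v" for \<xi>
    using side_max(1)[OF e v \<open>a \<in> side e\<close> that] by (simp add: vol.diff_left)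
  have "boundary_oriented vol (tile v) a (a + tau v e)"
    unfolding boundary_oriented_def
    using interior_vol_less[OF _ tau_nonzero[OF e v] le] by (simp add: vol.diff_left)
  then show ?thesis using a that by simp
qed

end

section \<open>Sides of polygons\<close>

context area_plane
begin

text \<open>A segment fixes its end points up to a swap, and swapping them reverses the sign in the
  orientation condition.\<close>

lemma boundary_oriented_unique:
  assumes "interior P \<noteq> {}" "closed_segment a b = closed_segment a' b'"
    "boundary_oriented vol P a b" "boundary_oriented vol P a' b'"
  shows "a = a' \<and> b = b'"
proof (rule ccontr)
  assume "\<not> ?thesis"
  then have sw: "a' = b" "b' = a" using assms(2) by (auto simp: closed_segment_eq doubleton_eq_iff)
  obtain c where c: "c \<in> interior P" using assms(1) by blast
  have "vol (a - c) (b - a) > 0" "vol (b - c) (a - b) > 0"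
    using assms(3,4) c sw by (auto simp: boundary_oriented_def)
  then show False using vol_skew[of a b] by (simp add: vol.diff_left vol.diff_right)
qed

text \<open>A facet is compact, convex and of dimension one, hence a segment. The convex interior
  misses its line and so lies strictly on one side of it, which decides the order of the end
  points.\<close>

lemma polygon_facet_segment:
  assumes P: "convex_polygon P" and F: "F facet_of P"
  obtains a b where "F = closed_segment a b" "a \<noteq> b" "boundary_oriented vol P a b"
    "\<And>\<xi>. \<xi> \<in> P \<Longrightarrow> vol (\<xi> - a) (b - a) \<le> 0" "F = {\<xi> \<in> P. vol (\<xi> - a) (b - a) = 0}"
proof -
  have cP: "convex P" "closed P" "interior P \<noteq> {}"
    using P polytope_imp_convex polytope_imp_closed by (auto simp: convex_polygon_def)
  have face: "F face_of P" and "F \<noteq> {}" and dF: "aff_dim F = 1"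
    using F aff_dim_interior[OF cP(3)] by (auto simp: facet_of_def)
  have "polytope F" using face P face_of_polytope_polytope by (auto simp: convex_polygon_def)
  then have "convex F" "compact F" by (simp_all add: polytope_imp_convex polytope_imp_compact)
  moreover have "collinear F" using dF by (simp add: collinear_aff_dim)
  ultimately obtain a b where ab: "F = closed_segment a b"
    using compact_convex_collinear_segment[OF \<open>F \<noteq> {}\<close>] by blast
  have "a \<noteq> b" using dF ab by auto
  have hull: "x \<in> F" if xP: "x \<in> P" and x0: "vol (x - a) (b - a) = 0" for x
  proof -
    obtain k where k: "x - a = k *\<^sub>R (b - a)" using parallel_if_vol_zero[OF x0] \<open>a \<noteq> b\<close> by auto
    then have x: "x = (1 - k) *\<^sub>R a + k *\<^sub>R b" by (simp add: algebra_simps)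
    have "a \<in> affine hull F" "b \<in> affine hull F" using ab hull_subset[of F affine] by auto
    then have "x \<in> affine hull F"
      unfolding x by (intro mem_affine[OF affine_affine_hull]) auto
    then show ?thesis using face_of_imp_eq_affine_Int[OF cP(1) face] xP by blast
  qed
  have "F \<noteq> P" using dF aff_dim_interior[OF cP(3)] by auto
  then have disj: "F \<inter> interior P = {}" using face_of_disjoint_interior[OF face] by blast
  let ?g = "\<lambda>c. vol (c - a) (b - a)"
  have nz: "?g c \<noteq> 0" if "c \<in> interior P" for c
    using hull[of c] disj that interior_subset by blast
  have same: False if c: "c \<in> interior P" "c' \<in> interior P" "?g c < 0" "?g c' > 0" for c c'
  proof -
    \<comment> \<open>The parameter at which the affine function \<open>?g\<close> vanishes between
      \<open>c\<close> and \<open>c'\<close>.\<close>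
    define t where "t = ?g c / (?g c - ?g c')"
    have t: "0 \<le> t" "t \<le> 1" using c by (auto simp: t_def field_simps)
    have "(1 - t) *\<^sub>R c + t *\<^sub>R c' \<in> interior P"
      using convexD_alt[OF convex_interior[OF cP(1)] c(1,2) t] .
    moreover have "?g ((1 - t) *\<^sub>R c + t *\<^sub>R c') = ?g c + t * (?g c' - ?g c)"
      by (simp add: vol_simps algebra_simps)
    moreover have "?g c + t * (?g c' - ?g c) = 0" using c by (simp add: t_def field_simps)
    ultimately show False using nz by metis
  qed
  have closure: "P = closure (interior P)" using convex_closure_interior[OF cP(1,3)] cP(2) by simp
  note goal = that
  have result: thesis if F': "F = closed_segment a' b'" "{a', b'} = {a, b}" and neg: "\<And>c. c \<in> interior P \<Longrightarrow> vol (c - a') (b' - a') < 0" for a' b'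
  proof -
    have swap: "vol (x - a') (b' - a') = 0 \<longleftrightarrow> ?g x = 0" for x
    proof -
      have "vol (x - b) (a - b) = - vol (x - a) (b - a)"
        using vol_skew[of a b] by (simp add: vol.diff_left vol.diff_right)
      then show ?thesis using F'(2) by (auto simp: doubleton_eq_iff)
    qed
    have "closure (interior P) \<subseteq> {\<xi>. vol (\<xi> - a') (b' - a') \<le> 0}"
      using neg by (intro closure_minimal closed_Collect_le continuous_intros) (auto intro: less_imp_le)
    then have le: "vol (\<xi> - a') (b' - a') \<le> 0" if "\<xi> \<in> P" for \<xi> using closure that by blast
    have "boundary_oriented vol P a' b'"
      unfolding boundary_oriented_def using neg by (simp add: vol.diff_left)
    moreover have "a' \<noteq> b'" using F'(2) \<open>a \<noteq> b\<close> by (auto simp: doubleton_eq_iff)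
    moreover have "F = {\<xi> \<in> P. vol (\<xi> - a') (b' - a') = 0}"
    proof (intro set_eqI iffI)
      fix x assume "x \<in> F"
      moreover from this obtain u where "x = (1 - u) *\<^sub>R a + u *\<^sub>R b" using ab by (auto simp: in_segment)
      then have "x - a = u *\<^sub>R (b - a)" by (simp add: algebra_simps)
      then have "?g x = 0" by (simp add: vol.scaleR_left)
      ultimately show "x \<in> {\<xi> \<in> P. vol (\<xi> - a') (b' - a') = 0}" using swap face_of_imp_subset[OF face] by auto
    qed (use hull swap in auto)
    ultimately show thesis using goal[OF F'(1)] le by blast
  qed
  show thesis
  proof (cases "\<exists>c\<in>interior P. ?g c < 0")
    case True
    then have "?g c < 0" if "c \<in> interior P" for c using same nz that by (meson linorder_neqE_linordered_idom)
    then show thesis by (intro result[OF ab]) auto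
  next
    case False
    then have "?g c > 0" if "c \<in> interior P" for c using nz that by (meson linorder_neqE_linordered_idom)
    then have "vol (c - b) (a - b) < 0" if "c \<in> interior P" for c
    proof -
      have "vol (c - b) (a - b) = - vol (c - a) (b - a)"
        using vol_skew[of a b] by (simp add: vol.diff_left vol.diff_right)
      then show ?thesis using \<open>\<And>c. c \<in> interior P \<Longrightarrow> ?g c > 0\<close>[OF that] by simp
    qed
    then show thesis by (intro result[of b a]) (auto simp: ab closed_segment_commute)
  qed
qed

section \<open>Maximising sets of a strictly convex PL-function\<close>

definition argmax_on :: "'b set \<Rightarrow> ('b \<Rightarrow> real) \<Rightarrow> 'b set" where
  "argmax_on Q g = {\<xi> \<in> Q. \<forall>\<eta>\<in>Q. g \<eta> \<le> g \<xi>}"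

text \<open>At a common maximiser both deficits are zero, so a point maximises the positive
  combination only if its two nonnegative deficits vanish. Points of an edge are such combinations
  of its ends, points of a leg of its vertex and its direction.\<close>

lemma argmax_on_add:
  assumes "0 < r" "0 < s" and ne: "argmax_on Q g \<inter> argmax_on Q h \<noteq> {}"
  shows "argmax_on Q (\<lambda>\<xi>. r * g \<xi> + s * h \<xi>) = argmax_on Q g \<inter> argmax_on Q h"
proof (intro set_eqI iffI)
  fix \<xi> assume "\<xi> \<in> argmax_on Q g \<inter> argmax_on Q h"
  then show "\<xi> \<in> argmax_on Q (\<lambda>\<xi>. r * g \<xi> + s * h \<xi>)"
    using assms(1,2) by (auto simp: argmax_on_def intro!: add_mono mult_left_mono)
next
  fix \<xi> assume xi: "\<xi> \<in> argmax_on Q (\<lambda>\<xi>. r * g \<xi> + s * h \<xi>)"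
  obtain \<eta> where eta: "\<eta> \<in> argmax_on Q g" "\<eta> \<in> argmax_on Q h" using ne by blast
  have Q: "\<xi> \<in> Q" "\<eta> \<in> Q" using xi eta by (auto simp: argmax_on_def)
  have 1: "g \<xi> \<le> g \<eta>" "h \<xi> \<le> h \<eta>" using eta Q by (auto simp: argmax_on_def)
  have "r * (g \<eta> - g \<xi>) + s * (h \<eta> - h \<xi>) \<le> 0" using xi Q by (auto simp: argmax_on_def algebra_simps)
  moreover have "0 \<le> r * (g \<eta> - g \<xi>)" "0 \<le> s * (h \<eta> - h \<xi>)" using 1 assms(1,2) by auto
  ultimately have "r * (g \<eta> - g \<xi>) = 0" "s * (h \<eta> - h \<xi>) = 0" by linarith+
  then have "g \<xi> = g \<eta>" "h \<xi> = h \<eta>" using assms(1,2) by auto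
  then show "\<xi> \<in> argmax_on Q g \<inter> argmax_on Q h" using eta Q by (auto simp: argmax_on_def)
qed

text \<open>Starting from an interior point of \<open>P\<close>, a short step towards
  \<open>\<xi>\<close> stays in \<open>P\<close>; convexity extends the affine formula as a lower
  bound to \<open>\<xi>\<close>.\<close>

lemma PL_piece_le:
  assumes "convex_on Q f" "P \<subseteq> Q" "interior P \<noteq> {}"
    and f: "\<And>\<xi>. \<xi> \<in> P \<Longrightarrow> f \<xi> = vol \<xi> y + c" and xi: "\<xi> \<in> Q"
  shows "vol \<xi> y + c \<le> f \<xi>"
proof -
  obtain x where x: "x \<in> interior P" using assms(3) by blast
  have "\<forall>\<^sub>F t in at_right (0::real). x + t *\<^sub>R (\<xi> - x) \<in> interior P"
    by (rule topological_tendstoD[OF scaleR_at_right_tendsto open_interior x])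
  then obtain t :: real where t: "0 < t" "t < 1" "x + t *\<^sub>R (\<xi> - x) \<in> interior P"
    by (rule eventually_at_right_0D)
  have eq: "x + t *\<^sub>R (\<xi> - x) = (1 - t) *\<^sub>R x + t *\<^sub>R \<xi>" by (simp add: algebra_simps)
  have "x \<in> P" "x + t *\<^sub>R (\<xi> - x) \<in> P" using x t interior_subset by blast+
  then have "vol ((1 - t) *\<^sub>R x + t *\<^sub>R \<xi>) y + c \<le> (1 - t) * (vol x y + c) + t * f \<xi>"
    using convex_onD[OF assms(1), of t x \<xi>] f[of x] f[of "x + t *\<^sub>R (\<xi> - x)"] t xi assms(2) unfolding eq by auto
  then have "t * (vol \<xi> y + c) \<le> t * f \<xi>" by (simp add: vol_simps algebra_simps)
  then show ?thesis using t by simp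
qed

text \<open>Strictness is only postulated across common sides; here it becomes global. The set
  \<open>M\<close> where \<open>f\<close> meets the affine piece of \<open>P\<close> is convex. With
  finitely many points removed its interior is connected, and \<open>P\<close> is open and closed in
  it, because another polygon continuing \<open>P\<close> across a side would have to carry the same
  affine piece.\<close>

lemma PL_piece_strict:
  assumes Q: "convex_polygon Q" and sub: "polygonal_subdivision Q PP" and f: "strictly_convex_PL Q PP f"
    and P: "P \<in> PP" and fP: "\<And>\<xi>. \<xi> \<in> P \<Longrightarrow> f \<xi> = vol \<xi> y + c"
    and xi0: "\<xi>0 \<in> Q" "f \<xi>0 = vol \<xi>0 y + c"
  shows "\<xi>0 \<in> P"
proof (rule ccontr)
  assume notin: "\<xi>0 \<notin> P"
  have fin: "finite PP" and poly: "\<And>P. P \<in> PP \<Longrightarrow> convex_polygon P" and un: "\<Union>PP = Q"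
    and faces: "\<And>P P'. P \<in> PP \<Longrightarrow> P' \<in> PP \<Longrightarrow> P \<noteq> P' \<Longrightarrow> (P \<inter> P') face_of P \<and> P \<inter> P' \<noteq> P \<and> (P \<inter> P') face_of P' \<and> P \<inter> P' \<noteq> P'"
    using sub by (auto simp: polygonal_subdivision_def)
  have cl: "closed P'" "convex P'" "interior P' \<noteq> {}" if "P' \<in> PP" for P'
    using poly[OF that] polytope_imp_convex polytope_imp_closed by (auto simp: convex_polygon_def)
  have PQ: "P \<subseteq> Q" using un P by blast
  have cQ: "convex Q" "closed Q" using Q polytope_imp_convex polytope_imp_closed by (auto simp: convex_polygon_def)
  have fc: "continuous_on Q f" "convex_on Q f" using f by (auto simp: strictly_convex_PL_def)
  have le: "vol \<xi> y + c \<le> f \<xi>" if "\<xi> \<in> Q" for \<xi>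
    using PL_piece_le[OF fc(2) PQ cl(3)[OF P], of y c \<xi>] fP that by blast
  define M where "M = {\<xi> \<in> Q. f \<xi> - (vol \<xi> y + c) = 0}"
  have PM: "P \<subseteq> M" using PQ fP by (auto simp: M_def)
  have "closed M" unfolding M_def
    by (rule continuous_closed_preimage_constant[OF _ cQ(2)]) (intro continuous_intros fc(1))
  have "convex M"
  proof (rule convexI)
    fix x x' and u v :: real assume *: "x \<in> M" "x' \<in> M" "0 \<le> u" "0 \<le> v" "u + v = 1"
    let ?x = "u *\<^sub>R x + v *\<^sub>R x'"
    have xQ: "x \<in> Q" "x' \<in> Q" "?x \<in> Q" using * convexD[OF cQ(1)] by (auto simp: M_def)
    have "f ?x \<le> u * f x + v * f x'"
      using fc(2) * xQ unfolding convex_on_def by blast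
    also have "\<dots> = u * (vol x y + c) + v * (vol x' y + c)" using * by (simp add: M_def)
    also have "\<dots> = vol ?x y + (u + v) * c" by (simp add: vol.add_left vol.scaleR_left algebra_simps)
    finally show "?x \<in> M" using le[OF xQ(3)] xQ *(5) by (simp add: M_def)
  qed
  have intM: "interior P \<subseteq> interior M" using PM by (rule interior_mono)
  \<comment> \<open>Only the values for one-point intersections matter, namely the corners where
    \<open>P\<close> touches another polygon without sharing a side. For other intersections
    \<open>the_elem\<close> yields some unspecified point, and removing finitely many extra points
    is harmless.\<close>
  define Z where "Z = (\<lambda>P'. the_elem (P \<inter> P')) ` PP"
  have "finite Z" using fin by (simp add: Z_def)
  define S where "S = interior M - Z"
  have "connected S" unfolding S_def
    using \<open>convex M\<close> \<open>finite Z\<close> dim2 by (intro connected_open_delete_finite convex_connected convex_interior) auto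
  define C where "C = \<Union>(PP - {P})"
  have "closed C" unfolding C_def using fin cl by (intro closed_Union) auto
  \<comment> \<open>An intersection through \<open>z\<close> is neither a point nor two-dimensional,
    hence a common side.\<close>
  have inC: "z \<notin> C" if z: "z \<in> S" "z \<in> P" for z
  proof
    assume "z \<in> C"
    then obtain P' where P': "P' \<in> PP" "P' \<noteq> P" "z \<in> P'" by (auto simp: C_def)
    note fc' = faces[OF P P'(1)]
    have "P \<inter> P' \<noteq> {z}"
    proof
      assume "P \<inter> P' = {z}"
      then have "z \<in> Z" using P'(1) by (auto simp: Z_def intro!: image_eqI[of _ _ P'])
      then show False using z(1) by (simp add: S_def)
    qed
    then have "P \<inter> P' \<noteq> {a}" for a using z(2) P'(3) by (metis IntI singletonD)
    then have "aff_dim (P \<inter> P') \<noteq> 0" by (simp add: aff_dim_eq_0)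
    moreover have "aff_dim (P \<inter> P') \<noteq> -1" using z(2) P'(3) aff_dim_empty[of "P \<inter> P'"] by auto
    moreover have "aff_dim (P \<inter> P') < 2"
      using face_of_aff_dim_lt[of P "P \<inter> P'"] fc' P'(2) cl[OF P] aff_dim_interior by auto
    ultimately have "aff_dim (P \<inter> P') = 1" using aff_dim_geq[of "P \<inter> P'"] by linarith
    then have facet: "(P \<inter> P') facet_of P" "(P \<inter> P') facet_of P'"
      using fc' P'(2,3) z(2) aff_dim_interior[OF cl(3)[OF P]] aff_dim_interior[OF cl(3)[OF P'(1)]]
      by (auto simp: facet_of_def)
    obtain g' where g': "affine_function g'" "\<forall>x\<in>P'. f x = g' x"
      using f P'(1) by (auto simp: strictly_convex_PL_def)
    then obtain n c' where n: "\<And>\<xi>. g' \<xi> = vol \<xi> n + c'" using affine_function_vol by blast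
    have "z \<in> closure (interior P')"
      using convex_closure_interior[OF cl(2,3)[OF P'(1)]] cl(1)[OF P'(1)] P'(3) by simp
    \<comment> \<open>On this open overlap \<open>f\<close> is given by both affine functions, which
      therefore coincide.\<close>
    then have "interior M \<inter> interior P' \<noteq> {}"
      using z(1) open_Int_closure_eq_empty[OF open_interior, of M "interior P'"] by (auto simp: S_def)
    then obtain x where x: "x \<in> interior M" "x \<in> interior P'" by blast
    then have ne: "interior (M \<inter> P') \<noteq> {}" by auto
    have eq: "vol \<xi> y + c = vol \<xi> n + c'" if "\<xi> \<in> M \<inter> P'" for \<xi>
      using that g'(2) n by (auto simp: M_def)
    then have "y = n" using affine_unique_interior[OF ne] by blast
    moreover have "x \<in> M \<inter> P'" using x interior_subset by blast
    ultimately have "c = c'" using eq by auto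
    have "(\<lambda>\<xi>. vol \<xi> y + c) \<noteq> g'"
      using f P P' facet affine_function_vol_add[of y c] fP g' unfolding strictly_convex_PL_def by blast
    then show False using n \<open>y = n\<close> \<open>c = c'\<close> by auto
  qed
  have "S \<inter> P = S \<inter> interior P"
  proof -
    have "z \<in> interior P" if z: "z \<in> S" "z \<in> P" for z
    proof (rule interiorI)
      show "open (interior M - C)" using \<open>closed C\<close> by auto
      show "z \<in> interior M - C" using z inC by (auto simp: S_def)
      have "interior M \<subseteq> Q" using interior_subset by (auto simp: M_def)
      then show "interior M - C \<subseteq> P" using un P by (auto simp: C_def)
    qed
    then show ?thesis using interior_subset by blast
  qed
  then have "openin (top_of_set S) (S \<inter> P)" by (simp add: openin_open_Int)
  moreover have "closedin (top_of_set S) (S \<inter> P)" using cl(1)[OF P] by (simp add: closedin_closed_Int)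
  ultimately have "S \<inter> P = {} \<or> S \<inter> P = S" using \<open>connected S\<close> unfolding connected_clopen by blast
  then show False
  proof
    assume "S \<inter> P = {}"
    then have "interior P \<subseteq> Z" using intM interior_subset by (auto simp: S_def)
    then have "finite (interior P)" using \<open>finite Z\<close> finite_subset by blast
    then show False using cl(3)[OF P] finite_imp_not_open open_interior by blast
  next
    assume "S \<inter> P = S"
    then have "interior M - P \<subseteq> Z" by (auto simp: S_def)
    then have "finite (interior M - P)" using \<open>finite Z\<close> finite_subset by blast
    moreover have "open (interior M - P)" using cl(1)[OF P] by auto
    ultimately have "interior M \<subseteq> P" using finite_imp_not_open by blast
    then have "closure (interior M) \<subseteq> P" using cl(1)[OF P] by (rule closure_minimal)
    moreover have "interior M \<noteq> {}" using intM cl(3)[OF P] by blast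
    ultimately have "M \<subseteq> P" using convex_closure_interior[OF \<open>convex M\<close>] \<open>closed M\<close> by simp
    then show False using notin xi0 by (auto simp: M_def)
  qed
qed

lemma argmax_piece:
  assumes "convex_polygon Q" "polygonal_subdivision Q PP" "strictly_convex_PL Q PP f"
    and P: "P \<in> PP" and fP: "\<And>\<xi>. \<xi> \<in> P \<Longrightarrow> f \<xi> = vol \<xi> y + c"
  shows "argmax_on Q (\<lambda>\<xi>. vol \<xi> y - f \<xi>) = P"
proof -
  have PQ: "P \<subseteq> Q" and int: "interior P \<noteq> {}"
    using assms(2) P by (auto simp: polygonal_subdivision_def convex_polygon_def)
  have cf: "convex_on Q f" using assms(3) by (simp add: strictly_convex_PL_def)
  have le: "vol \<xi> y - f \<xi> \<le> - c" if "\<xi> \<in> Q" for \<xi>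
    using PL_piece_le[OF cf PQ int, of y c \<xi>] fP that by fastforce
  have eq: "\<xi> \<in> P \<longleftrightarrow> vol \<xi> y - f \<xi> = - c" if "\<xi> \<in> Q" for \<xi>
    using PL_piece_strict[OF assms(1-4), of y c \<xi>] fP that by fastforce
  obtain \<xi>0 where "\<xi>0 \<in> P" using int interior_subset by blast
  then show ?thesis using le eq PQ unfolding argmax_on_def by force
qed

end

section \<open>Realizations of graphs with legs\<close>

lemma edge_ends:
  assumes "landau_type_graph G" "e \<in> edges G"
  shows "ends G e = {start G e, finish G e}" "start G e \<noteq> finish G e"
proof -
  have "card (ends G e) = 2" using assms by (auto simp: landau_type_graph_def)
  then obtain v w where vw: "ends G e = {v, w}" "v \<noteq> w" by (auto simp: card_2_iff)
  have 1: "start G e \<in> ends G e" unfolding start_def by (rule someI[of _ v]) (simp add: vw)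
  then have "\<exists>x. x \<in> ends G e - {start G e}" using vw by auto
  then have "finish G e \<in> ends G e - {start G e}" unfolding finish_def by (rule someI_ex)
  then show "ends G e = {start G e, finish G e}" "start G e \<noteq> finish G e" using 1 vw by auto
qed

lemma leg_ends:
  assumes "landau_type_graph G" "l \<in> legs G"
  shows "ends G l = {start G l}"
proof -
  have "card (ends G l) = 1" using assms by (auto simp: landau_type_graph_def)
  then obtain v where v: "ends G l = {v}" by (auto simp: card_1_singleton_iff)
  have "start G l \<in> ends G l" unfolding start_def by (rule someI[of _ v]) (simp add: v)
  then show ?thesis using v by simp
qed

lemma landau_type_ends:
  assumes "landau_type_graph G" "e \<in> edges G \<union> legs G"
  shows "ends G e \<subseteq> verts G" "start G e \<in> ends G e"
proof -
  show "ends G e \<subseteq> verts G" using assms by (auto simp: landau_type_graph_def)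
  show "start G e \<in> ends G e"
    using assms(2) edge_ends(1)[OF assms(1), of e] leg_ends[OF assms(1), of e] by auto
qed

lemma landau_type_incident:
  assumes "landau_type_graph G" "v \<in> verts G"
  obtains e where "e \<in> edges G \<union> legs G" "v \<in> ends G e"
proof -
  have "3 \<le> card {e \<in> edges G \<union> legs G. v \<in> ends G e}" using assms by (simp add: landau_type_graph_def)
  then have "{e \<in> edges G \<union> legs G. v \<in> ends G e} \<noteq> {}" by (metis card.empty not_numeral_le_zero)
  then show ?thesis using that by blast
qed

lemma realization_points_cases:
  assumes G: "landau_type_graph G" and p: "p \<in> realization_points G"
  obtains (vertex) v where "v \<in> verts G" "p = Inl v"
    | (edge) e t where "e \<in> edges G" "0 < t" "t < 1" "p = Inr (e, t)"
    | (leg) l t where "l \<in> legs G" "l \<notin> edges G" "0 < t" "p = Inr (l, t)"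
proof -
  consider "p \<in> Inl ` verts G" | e t where "e \<in> edges G \<union> legs G" "t \<in> cell_domain G e" "p = cell G e t"
    using p by (auto simp: realization_points_def)
  then show ?thesis
  proof cases
    case 1
    then show ?thesis using vertex by blast
  next
    case 2
    have st: "start G e \<in> verts G" using landau_type_ends[OF G 2(1)] by blast
    show ?thesis
    proof (cases "e \<in> edges G")
      case True
      then have "finish G e \<in> verts G" using landau_type_ends[OF G 2(1)] edge_ends(1)[OF G True] by auto
      then show ?thesis
        using 2 True st vertex edge[OF True, of t] by (auto simp: cell_def cell_domain_def le_less split: if_splits)
    next
      case False
      then show ?thesis
        using 2 st vertex leg[of e t] by (auto simp: cell_def cell_domain_def le_less split: if_splits)
    qed
  qed
qed

lemma vertex_on_cell:
  assumes G: "landau_type_graph G" and v: "v \<in> verts G"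
  obtains e t where "e \<in> edges G \<union> legs G" "t \<in> cell_domain G e" "cell G e t = Inl v"
proof -
  obtain e where e: "e \<in> edges G \<union> legs G" "v \<in> ends G e" using landau_type_incident[OF G v] .
  show ?thesis
  proof (cases "v = start G e")
    case True
    then show ?thesis using that[of e 0] e by (auto simp: cell_def cell_domain_def)
  next
    case False
    then have "e \<in> edges G" using e leg_ends[OF G, of e] by auto
    then have "v = finish G e" using False e edge_ends(1)[OF G] by auto
    then show ?thesis using that[of e 1] e \<open>e \<in> edges G\<close> by (auto simp: cell_def cell_domain_def)
  qed
qed

lemma closed_cell_domain: "closed (cell_domain G e)"
  by (auto simp: cell_domain_def)

text \<open>An injective continuous closed map is an embedding. Closedness holds because each cell
  domain is closed in the line, a nonconstant affine map of the line sends closed sets to closed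
  sets, and there are finitely many cells; this covers the unbounded legs as well.\<close>

lemma graph_embedding_iff_inj:
  fixes \<phi> :: "'v + 'e \<times> real \<Rightarrow> 'a::euclidean_space"
  assumes G: "landau_type_graph G" and aff: "piecewise_affine G \<phi>" and W: "\<phi> ` realization_points G \<subseteq> W"
  shows "graph_embedding W G \<phi> \<longleftrightarrow> inj_on \<phi> (realization_points G)"
proof
  assume "graph_embedding W G \<phi>"
  then show "inj_on \<phi> (realization_points G)"
    using homeomorphic_imp_injective_map topspace_realization
    unfolding graph_embedding_def embedding_map_def by metis
next
  assume inj: "inj_on \<phi> (realization_points G)"
  let ?C = "edges G \<union> legs G"
  have cellp: "cell G e t \<in> realization_points G" if "e \<in> ?C" "t \<in> cell_domain G e" for e t
    using that by (auto simp: realization_points_def)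
  have "\<forall>e\<in>?C. \<exists>a d. \<forall>t \<in> cell_domain G e. \<phi> (cell G e t) = a + t *\<^sub>R d"
    using aff by (simp add: piecewise_affine_def)
  then obtain a d where ad: "\<And>e t. e \<in> ?C \<Longrightarrow> t \<in> cell_domain G e \<Longrightarrow> \<phi> (cell G e t) = a e + t *\<^sub>R d e"
    by metis
  have d0: "d e \<noteq> 0" if e: "e \<in> ?C" for e
  proof
    assume "d e = 0"
    moreover have dom: "0 \<in> cell_domain G e" "1/2 \<in> cell_domain G e" by (auto simp: cell_domain_def)
    ultimately have "\<phi> (cell G e 0) = \<phi> (cell G e (1/2))" using ad[OF e] by simp
    then have "cell G e 0 = cell G e (1/2)" using inj_onD[OF inj] cellp[OF e] dom by blast
    then show False by (auto simp: cell_def)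
  qed
  have "continuous_map (realization G) (top_of_set W) \<phi>"
    unfolding continuous_map_def
  proof (intro conjI allI impI)
    show "\<phi> \<in> topspace (realization G) \<rightarrow> topspace (top_of_set W)"
      using W by (auto simp: topspace_realization)
  next
    fix U assume "openin (top_of_set W) U"
    then obtain T where T: "open T" "U = W \<inter> T" by (auto simp: openin_open)
    show "openin (realization G) {x \<in> topspace (realization G). \<phi> x \<in> U}"
      unfolding openin_realization topspace_realization
    proof (intro conjI ballI)
      fix e assume e: "e \<in> ?C"
      have "{t \<in> cell_domain G e. cell G e t \<in> {x \<in> realization_points G. \<phi> x \<in> U}} =
          cell_domain G e \<inter> (\<lambda>t. a e + t *\<^sub>R d e) -` T"
        using cellp[OF e] W ad[OF e] T(2) by auto
      moreover have "openin (top_of_set (cell_domain G e)) (cell_domain G e \<inter> (\<lambda>t. a e + t *\<^sub>R d e) -` T)"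
        by (intro openin_open_Int open_vimage T continuous_intros)
      ultimately show "openin (top_of_set (cell_domain G e))
          {t \<in> cell_domain G e. cell G e t \<in> {x \<in> realization_points G. \<phi> x \<in> U}}" by simp
    qed auto
  qed
  moreover have "closed_map (realization G) (top_of_set W) \<phi>"
    unfolding closed_map_def
  proof (intro allI impI)
    fix U assume U: "closedin (realization G) U"
    then have UR: "U \<subseteq> realization_points G"
      using closedin_subset topspace_realization by metis
    let ?T = "\<lambda>e. {t \<in> cell_domain G e. cell G e t \<in> U}"
    have closedT: "closed (?T e)" if e: "e \<in> ?C" for e
    proof -
      have "openin (realization G) (realization_points G - U)"
        using U topspace_realization unfolding closedin_def by metis
      then have "openin (top_of_set (cell_domain G e)) {t \<in> cell_domain G e. cell G e t \<in> realization_points G - U}"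
        using e unfolding openin_realization by blast
      moreover have "{t \<in> cell_domain G e. cell G e t \<in> realization_points G - U} = cell_domain G e - ?T e"
        using cellp[OF e] by auto
      ultimately have "openin (top_of_set (cell_domain G e)) (cell_domain G e - ?T e)" by (simp only:)
      then have "closedin (top_of_set (cell_domain G e)) (?T e)"
        unfolding closedin_def topspace_euclidean_subtopology by blast
      then show ?thesis by (rule closedin_closed_trans[OF _ closed_cell_domain])
    qed
    have "\<phi> ` U = (\<Union>e\<in>?C. (\<lambda>t. a e + t *\<^sub>R d e) ` ?T e)"
    proof (intro set_eqI iffI)
      fix y assume "y \<in> \<phi> ` U"
      then obtain p where p: "p \<in> U" "y = \<phi> p" by blast
      have "\<exists>e t. e \<in> ?C \<and> t \<in> cell_domain G e \<and> cell G e t = p"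
      proof (cases "p \<in> Inl ` verts G")
        case True
        then show ?thesis using vertex_on_cell[OF G] by blast
      next
        case False
        moreover have "p \<in> realization_points G" using p(1) UR by blast
        ultimately have "p \<in> (\<Union>e\<in>?C. cell G e ` cell_domain G e)"
          unfolding realization_points_def by (metis UnE)
        then show ?thesis by (elim UN_E imageE) auto
      qed
      then obtain e t where et: "e \<in> ?C" "t \<in> cell_domain G e" "cell G e t = p" by blast
      then have "t \<in> ?T e" "y = a e + t *\<^sub>R d e" using p ad[OF et(1,2)] by simp_all
      then show "y \<in> (\<Union>e\<in>?C. (\<lambda>t. a e + t *\<^sub>R d e) ` ?T e)" using et(1) by blast
    next
      fix y assume "y \<in> (\<Union>e\<in>?C. (\<lambda>t. a e + t *\<^sub>R d e) ` ?T e)"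
      then obtain e t where et: "e \<in> ?C" "t \<in> cell_domain G e" "cell G e t \<in> U" "y = a e + t *\<^sub>R d e" by blast
      then have "y = \<phi> (cell G e t)" using ad by simp
      then show "y \<in> \<phi> ` U" using et by blast
    qed
    moreover have "closed (\<Union>e\<in>?C. (\<lambda>t. a e + t *\<^sub>R d e) ` ?T e)"
    proof (intro closed_UN ballI)
      show "finite ?C" using G by (simp add: landau_type_graph_def)
    qed (intro closed_affine_image d0 closedT)
    ultimately have "closed (\<phi> ` U)" by simp
    moreover have "\<phi> ` U \<subseteq> W" using UR W by blast
    ultimately show "closedin (top_of_set W) (\<phi> ` U)" by (simp add: closed_subset)
  qed
  ultimately show "graph_embedding W G \<phi>"
    unfolding graph_embedding_def
    using inj by (intro injective_closed_imp_embedding_map) (simp_all add: topspace_realization)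
qed

section \<open>Landau graphs in the plane\<close>

text \<open>The Landau graph with its diagram after transport to the plane of \<open>vol\<close>.
  Injectivity is left out so that it can be the hypothesis in one direction and the conclusion in
  the other.\<close>

locale landau_plane = area_plane vol for vol :: "'b::euclidean_space \<Rightarrow> 'b \<Rightarrow> real" +
  fixes G :: "('v, 'e) legged_graph" and \<psi> :: "'v + 'e \<times> real \<Rightarrow> 'b" and \<tau> :: "'v \<Rightarrow> 'e \<Rightarrow> 'b"
  assumes G: "landau_type_graph G"
    and edge_point: "e \<in> edges G \<Longrightarrow> t \<in> {0..1} \<Longrightarrow>
      \<psi> (cell G e t) = (1 - t) *\<^sub>R \<psi> (Inl (start G e)) + t *\<^sub>R \<psi> (Inl (finish G e))"
    and leg_point: "l \<in> legs G \<Longrightarrow> \<exists>s>0. \<forall>t\<ge>0. \<psi> (cell G l t) = \<psi> (Inl (start G l)) + (s * t) *\<^sub>R \<tau> (start G l) l"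
    and edge_direction: "e \<in> edges G \<Longrightarrow> ends G e = {v, w} \<Longrightarrow> positive_multiple (\<tau> v e) (\<psi> (Inl w) - \<psi> (Inl v))"
    and edge_antisym: "e \<in> edges G \<Longrightarrow> ends G e = {v, w} \<Longrightarrow> \<tau> v e = - \<tau> w e"
    and star_balanced: "v \<in> verts G \<Longrightarrow> (\<Sum>e\<in>{e \<in> edges G \<union> legs G. v \<in> ends G e}. \<tau> v e) = 0"
begin

lemma legs_not_edges: "l \<in> legs G \<Longrightarrow> l \<notin> edges G"
  using G by (auto simp: landau_type_graph_def)

lemma cell_in: "e \<in> edges G \<union> legs G \<Longrightarrow> t \<in> cell_domain G e \<Longrightarrow> cell G e t \<in> realization_points G"
  by (auto simp: realization_points_def)

text \<open>The inverse of the factor in the collinearity condition. It is fixed from the start of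
  the edge; by antisymmetry the same number serves from the other end.\<close>

definition edge_len :: "'e \<Rightarrow> real" where
  "edge_len e = (SOME l. l > 0 \<and> \<psi> (Inl (finish G e)) = \<psi> (Inl (start G e)) + l *\<^sub>R \<tau> (start G e) e)"

lemma edge_len:
  assumes "e \<in> edges G"
  shows "edge_len e > 0" "\<psi> (Inl (finish G e)) = \<psi> (Inl (start G e)) + edge_len e *\<^sub>R \<tau> (start G e) e"
proof -
  obtain c where c: "c > 0" "\<tau> (start G e) e = c *\<^sub>R (\<psi> (Inl (finish G e)) - \<psi> (Inl (start G e)))"
    using edge_direction[OF assms edge_ends(1)[OF G assms]] by (auto simp: positive_multiple_def)
  then have "1 / c > 0 \<and> \<psi> (Inl (finish G e)) = \<psi> (Inl (start G e)) + (1 / c) *\<^sub>R \<tau> (start G e) e"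
    by simp
  from someI[of "\<lambda>l. l > 0 \<and> \<psi> (Inl (finish G e)) = \<psi> (Inl (start G e)) + l *\<^sub>R \<tau> (start G e) e", OF this]
  show "edge_len e > 0" "\<psi> (Inl (finish G e)) = \<psi> (Inl (start G e)) + edge_len e *\<^sub>R \<tau> (start G e) e"
    unfolding edge_len_def by blast+
qed

lemma edge_len':
  assumes e: "e \<in> edges G" and vw: "v \<noteq> w" "ends G e = {v, w}"
  shows "\<psi> (Inl w) = \<psi> (Inl v) + edge_len e *\<^sub>R \<tau> v e" "\<tau> w e = - \<tau> v e"
proof -
  show anti: "\<tau> w e = - \<tau> v e" using edge_antisym[OF e vw(2)] by simp
  have "(v = start G e \<and> w = finish G e) \<or> (w = start G e \<and> v = finish G e)"
    using edge_ends[OF G e] vw by (metis doubleton_eq_iff)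
  then show "\<psi> (Inl w) = \<psi> (Inl v) + edge_len e *\<^sub>R \<tau> v e"
    using edge_len(2)[OF e] anti by auto
qed

text \<open>Dictionary from the momentum parametrisation at an end to the cell parameter:
  \<open>s / edge_len e\<close> from the start, its complement to 1 from the finish, and a rescaling
  on a leg.\<close>

lemma arm_point:
  assumes e: "e \<in> edges G \<union> legs G" and v: "v \<in> ends G e" and s: "0 < s" "e \<in> edges G \<Longrightarrow> s < edge_len e"
  obtains t where "Inr (e, t) \<in> realization_points G" "\<psi> (Inr (e, t)) = \<psi> (Inl v) + s *\<^sub>R \<tau> v e"
proof (cases "e \<in> edges G")
  case True
  define t where "t = s / edge_len e"
  have t: "0 < t" "t < 1" "s = t * edge_len e" using s True edge_len(1)[OF True] by (auto simp: t_def)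
  have cell: "cell G e r = Inr (e, r)" if "0 < r" "r < 1" for r using that by (simp add: cell_def)
  show ?thesis
  proof (cases "v = start G e")
    case v: True
    have "\<psi> (cell G e t) = \<psi> (Inl v) + s *\<^sub>R \<tau> v e"
      using edge_point[OF True, of t] t edge_len(2)[OF True] v by (simp add: algebra_simps)
    then show ?thesis using that[of t] cell_in[OF e, of t] cell t True by (simp add: cell_domain_def)
  next
    case False
    then have v: "v = finish G e" using v edge_ends(1)[OF G True] by auto
    have "\<tau> v e = - \<tau> (start G e) e"
      using edge_antisym[OF True edge_ends(1)[OF G True]] v by simp
    then have "\<psi> (cell G e (1 - t)) = \<psi> (Inl v) + s *\<^sub>R \<tau> v e"
      using edge_point[OF True, of "1 - t"] t edge_len(2)[OF True] v by (simp add: algebra_simps)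
    then show ?thesis using that[of "1 - t"] cell_in[OF e, of "1 - t"] cell[of "1 - t"] t True by (simp add: cell_domain_def)
  qed
next
  case False
  then have l: "e \<in> legs G" using e by blast
  obtain r where r: "r > 0" "\<And>t. t \<ge> 0 \<Longrightarrow> \<psi> (cell G e t) = \<psi> (Inl (start G e)) + (r * t) *\<^sub>R \<tau> (start G e) e"
    using leg_point[OF l] by blast
  have v: "v = start G e" using leg_ends[OF G l] v by simp
  have "cell G e (s / r) = Inr (e, s / r)" using s r(1) False by (simp add: cell_def)
  moreover have "\<psi> (cell G e (s / r)) = \<psi> (Inl v) + s *\<^sub>R \<tau> v e" using r(2)[of "s / r"] r(1) s v by simp
  moreover have "s / r \<in> cell_domain G e" using s r(1) False by (simp add: cell_domain_def)
  ultimately show ?thesis using that[of "s / r"] cell_in[OF e, of "s / r"] by simp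
qed

text \<open>Through \<open>arm_point\<close> every condition forbidding an overlap becomes an
  instance of injectivity; so does the nonvanishing of momenta, since a zero momentum would send a
  point of the arm to the vertex.\<close>

lemma embedded_plane_graph:
  assumes inj: "inj_on \<psi> (realization_points G)"
  shows "plane_graph vol (verts G) (edges G) (legs G) (ends G) (\<lambda>v. \<psi> (Inl v)) \<tau> edge_len"
proof (unfold_locales, goal_cases)
  case (5)
  then show ?case using G by (auto simp: landau_type_graph_def)
next
  case (6 e)
  then show ?case using landau_type_ends[OF G] by blast
next
  case (7 e)
  then show ?case using edge_ends[OF G] by blast
next
  case (8 e)
  then show ?case using leg_ends[OF G] by blast
next
  case (9 e v w)
  then show ?case using edge_len' edge_len(1) by blast
next
  case (10 v)
  then show ?case by (rule star_balanced)
next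
  case (11 v)
  then show ?case using G by (simp add: landau_type_graph_def)
next
  case (12 e v)
  show ?case
  proof
    assume 0: "\<tau> v e = 0"
    define s where "s = (if e \<in> edges G then edge_len e / 2 else 1)"
    have s: "0 < s" "e \<in> edges G \<Longrightarrow> s < edge_len e" using edge_len(1)[of e] by (auto simp: s_def)
    obtain t where "Inr (e, t) \<in> realization_points G" "\<psi> (Inr (e, t)) = \<psi> (Inl v) + s *\<^sub>R \<tau> v e"
      using arm_point[OF 12 s] .
    then have t: "Inr (e, t) \<in> realization_points G" "\<psi> (Inr (e, t)) = \<psi> (Inl v)" using 0 by simp_all
    have "Inl v \<in> realization_points G" using 12 landau_type_ends[OF G 12(1)] by (auto simp: realization_points_def)
    then show False using inj_onD[OF inj t(2) t(1)] by simp
  qed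
next
  case 13
  show ?case
  proof (rule inj_onI)
    fix v w assume "v \<in> verts G" "w \<in> verts G" "\<psi> (Inl v) = \<psi> (Inl w)"
    then show "v = w"
      using inj_onD[OF inj, of "Inl v" "Inl w"] by (simp add: realization_points_def)
  qed
next
  case (14 e v w s)
  obtain t where t: "Inr (e, t) \<in> realization_points G" "\<psi> (Inr (e, t)) = \<psi> (Inl v) + s *\<^sub>R \<tau> v e"
    using arm_point[OF 14(1,2,4,5)] .
  have "Inl w \<in> realization_points G" using 14 by (auto simp: realization_points_def)
  then show ?case using inj_onD[OF inj _ t(1), of "Inl w"] t(2) by auto
next
  case (15 e v s e' v' s')
  obtain t where t: "Inr (e, t) \<in> realization_points G" "\<psi> (Inr (e, t)) = \<psi> (Inl v) + s *\<^sub>R \<tau> v e"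
    using arm_point[OF 15(1-4)] .
  obtain t' where t': "Inr (e', t') \<in> realization_points G" "\<psi> (Inr (e', t')) = \<psi> (Inl v') + s' *\<^sub>R \<tau> v' e'"
    using arm_point[OF 15(5-8)] .
  have "\<psi> (Inr (e, t)) = \<psi> (Inr (e', t'))" using t t' 15(9) by simp
  then show ?case using inj_onD[OF inj _ t(1) t'(1)] by simp
qed (use G in \<open>auto simp: landau_type_graph_def connected_legged_graph_def\<close>)

text \<open>A point of the graph is recovered from the set of slopes at which its linear functional
  minus the PL-function is maximal: that set is the polygon or side dual to the cell of the point.\<close>

lemma polygonal_imp_inj:
  assumes Q: "convex_polygon Q" and sub: "polygonal_subdivision Q PP" and f: "strictly_convex_PL Q PP f"
    and iso: "legged_graph_iso G (dual_graph Q PP) P F"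
    and lin: "\<And>v. v \<in> verts G \<Longrightarrow> \<exists>c. \<forall>\<xi> \<in> P v. f \<xi> = vol \<xi> (\<psi> (Inl v)) + c"
    and normal: "\<And>e v a b. e \<in> edges G \<union> legs G \<Longrightarrow> v \<in> ends G e \<Longrightarrow> F e = closed_segment a b \<Longrightarrow>
      boundary_oriented vol (P v) a b \<Longrightarrow> \<tau> v e = b - a"
  shows "inj_on \<psi> (realization_points G)"
proof -
  have bij: "bij_betw P (verts G) PP"
    "bij_betw F (edges G) {F. (\<exists>P \<in> PP. F facet_of P) \<and> \<not> F \<subseteq> frontier Q}"
    "bij_betw F (legs G) {F. (\<exists>P \<in> PP. F facet_of P) \<and> F \<subseteq> frontier Q}"
    and ends: "\<And>e. e \<in> edges G \<union> legs G \<Longrightarrow> {P' \<in> PP. F e \<subseteq> P'} = P ` ends G e"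
    using iso by (auto simp: legged_graph_iso_def dual_graph_def)
  have PP: "P v \<in> PP" if "v \<in> verts G" for v using bij(1) that by (auto simp: bij_betw_def)
  have poly: "convex_polygon P'" if "P' \<in> PP" for P' using sub that by (simp add: polygonal_subdivision_def)
  have PQ: "P' \<subseteq> Q" if "P' \<in> PP" for P' using sub that by (auto simp: polygonal_subdivision_def)
  let ?R = "\<lambda>p. argmax_on Q (\<lambda>\<xi>. vol \<xi> (\<psi> p) - f \<xi>)"
  have R_vertex: "?R (Inl v) = P v" if v: "v \<in> verts G" for v
  proof -
    obtain c where "\<forall>\<xi> \<in> P v. f \<xi> = vol \<xi> (\<psi> (Inl v)) + c" using lin[OF v] by blast
    then show ?thesis using argmax_piece[OF Q sub f PP[OF v], of "\<psi> (Inl v)" c] by blast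
  qed
  have cellF: "\<exists>P'\<in>PP. F e facet_of P'" if "e \<in> edges G \<union> legs G" for e
    using bij(2,3) that by (auto simp: bij_betw_def)
  have facetE: "\<exists>v\<in>ends G e. F e facet_of P v" if e: "e \<in> edges G \<union> legs G" for e
  proof -
    obtain P' where P': "P' \<in> PP" "F e facet_of P'" using cellF[OF e] by blast
    then have "P' \<in> P ` ends G e" using ends[OF e] facet_of_imp_subset by blast
    then show ?thesis using P' by blast
  qed
  have R_edge: "?R (Inr (e, t)) = F e" if e: "e \<in> edges G" and t: "0 < t" "t < 1" for e t
  proof -
    have eC: "e \<in> edges G \<union> legs G" using e by blast
    define v w where "v = start G e" and "w = finish G e"
    have vw: "ends G e = {v, w}" "v \<noteq> w" using edge_ends[OF G e] by (auto simp: v_def w_def)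
    have V: "v \<in> verts G" "w \<in> verts G" using landau_type_ends(1)[OF G eC] vw by auto
    have Pne: "P v \<noteq> P w" using bij(1) V vw(2) by (auto simp: bij_betw_def inj_on_def)
    \<comment> \<open>\<open>F e\<close> is known to be a facet of only one of the two polygons. It
      lies in both, and their intersection is a proper face, so both have dimension one and
      coincide.\<close>
    have int: "F e = P v \<inter> P w"
    proof -
      have FP: "F e \<subseteq> P v \<inter> P w" using ends[OF eC] vw by blast
      obtain u where u: "u \<in> {v, w}" "F e facet_of P u" using facetE[OF eC] vw by blast
      have uV: "u \<in> verts G" using u(1) V by blast
      have fc: "(P v \<inter> P w) face_of P u" "P v \<inter> P w \<noteq> P u"
        using sub PP V Pne u(1) unfolding polygonal_subdivision_def by blast+
      have P_u: "convex (P u)" "interior (P u) \<noteq> {}"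
        using poly[OF PP[OF uV]] polytope_imp_convex by (auto simp: convex_polygon_def)
      have "aff_dim (P v \<inter> P w) < 2"
        using face_of_aff_dim_lt[OF P_u(1) fc] aff_dim_interior[OF P_u(2)] by simp
      moreover have "aff_dim (F e) = 1" using u(2) aff_dim_interior[OF P_u(2)] by (simp add: facet_of_def)
      moreover have "F e face_of (P v \<inter> P w)"
        using face_of_subset[OF facet_of_imp_face_of[OF u(2)] FP face_of_imp_subset[OF fc(1)]] .
      ultimately show ?thesis
        using face_of_aff_dim_lt[OF face_of_imp_convex[OF fc(1)], of "F e"] by fastforce
    qed
    have "cell G e t = Inr (e, t)" using t by (simp add: cell_def)
    then have pt: "\<psi> (Inr (e, t)) = (1 - t) *\<^sub>R \<psi> (Inl v) + t *\<^sub>R \<psi> (Inl w)"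
      using edge_point[OF e, of t] t by (simp add: v_def w_def)
    have "F e \<noteq> {}" using cellF[OF eC] by (auto simp: facet_of_def)
    then have "argmax_on Q (\<lambda>\<xi>. (1 - t) * (vol \<xi> (\<psi> (Inl v)) - f \<xi>) + t * (vol \<xi> (\<psi> (Inl w)) - f \<xi>)) = P v \<inter> P w"
      using argmax_on_add[of "1 - t" t Q "\<lambda>\<xi>. vol \<xi> (\<psi> (Inl v)) - f \<xi>" "\<lambda>\<xi>. vol \<xi> (\<psi> (Inl w)) - f \<xi>"]
        t R_vertex[OF V(1)] R_vertex[OF V(2)] int by simp
    moreover have "vol \<xi> (\<psi> (Inr (e, t))) - f \<xi> =
        (1 - t) * (vol \<xi> (\<psi> (Inl v)) - f \<xi>) + t * (vol \<xi> (\<psi> (Inl w)) - f \<xi>)" for \<xi>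
      by (simp only: pt vol.add_right vol.scaleR_right real_scaleR_def) (simp add: algebra_simps)
    ultimately show ?thesis using int by simp
  qed
  \<comment> \<open>The side of a leg lies in the frontier of \<open>Q\<close>, so the supporting
    line of \<open>Q\<close> at its midpoint is the line of the side: the momentum is an outer
    normal for all of \<open>Q\<close>, not only for the adjacent polygon.\<close>
  have leg_normal: "\<tau> v l \<noteq> 0 \<and> (\<exists>k. F l = {\<xi> \<in> P v. vol \<xi> (\<tau> v l) = k} \<and> (\<forall>\<xi> \<in> Q. vol \<xi> (\<tau> v l) \<le> k))"
    if l: "l \<in> legs G" and v: "ends G l = {v}" for l v
  proof -
    have lC: "l \<in> edges G \<union> legs G" using l by blast
    have vV: "v \<in> verts G" using landau_type_ends(1)[OF G lC] v by auto
    have facet: "F l facet_of P v" using facetE[OF lC] v by auto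
    obtain a b where ab: "F l = closed_segment a b" "a \<noteq> b" "boundary_oriented vol (P v) a b"
      "\<And>\<xi>. \<xi> \<in> P v \<Longrightarrow> vol (\<xi> - a) (b - a) \<le> 0" "F l = {\<xi> \<in> P v. vol (\<xi> - a) (b - a) = 0}"
      using polygon_facet_segment[OF poly[OF PP[OF vV]] facet] by blast
    have tau: "\<tau> v l = b - a" using normal[OF lC _ ab(1,3)] v by simp
    have cQ: "convex Q" "interior Q \<noteq> {}" using Q polytope_imp_convex by (auto simp: convex_polygon_def)
    have FQ: "F l \<subseteq> Q" using facet_of_imp_subset[OF facet] PQ[OF PP[OF vV]] by blast
    have Ffr: "F l \<subseteq> frontier Q" using bij(3) l by (auto simp: bij_betw_def)
    define m where "m = (1 - 1/2) *\<^sub>R a + (1/2) *\<^sub>R b"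
    have mF: "m \<in> F l" unfolding ab(1) m_def in_segment by (intro exI[of _ "1/2::real"]) auto
    obtain n where n0: "n \<noteq> 0" and n: "\<And>y. y \<in> Q \<Longrightarrow> vol m n \<le> vol y n"
      using supporting_vol[OF cQ(1) subsetD[OF FQ mF] subsetD[OF Ffr mF] cQ(2)] by blast
    have "a \<in> Q" "b \<in> Q" using FQ ab(1) by auto
    then have "vol m n \<le> vol a n" "vol m n \<le> vol b n" using n by auto
    moreover have mid: "vol m x = (vol a x + vol b x) / 2" for x by (simp add: m_def vol_simps)
    ultimately have "vol (b - a) n = 0" by (simp add: vol.diff_left)
    then have "vol n (b - a) = 0" using vol_skew[of n] by simp
    then obtain k where k: "n = k *\<^sub>R (b - a)" using parallel_if_vol_zero[of n "b - a"] ab(2) by auto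
    have same: "vol b (b - a) = vol a (b - a)" using vol_skew[of a b] by (simp add: vol.diff_right)
    then have ma: "vol m (b - a) = vol a (b - a)" by (simp add: mid)
    have kle: "k * vol (\<xi> - a) (b - a) \<ge> 0" if "\<xi> \<in> Q" for \<xi>
      using n[OF that] ma by (simp add: k vol.scaleR_right vol.diff_left right_diff_distrib)
    \<comment> \<open>\<open>n\<close> is minimal on the side and hence points inwards, whereas the
      oriented side \<open>b - a\<close> is positive outwards; an interior point of
      \<open>P v\<close> tells the signs apart.\<close>
    have "k < 0"
    proof (rule ccontr)
      assume "\<not> k < 0"
      moreover have "k \<noteq> 0" using k n0 by auto
      ultimately have "k > 0" by simp
      obtain x where x: "x \<in> interior (P v)" using poly[OF PP[OF vV]] by (auto simp: convex_polygon_def)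
      then have "vol (x - a) (b - a) < 0"
        using ab(3) unfolding boundary_oriented_def by (simp add: vol.diff_left)
      moreover have "x \<in> Q" using x interior_subset PQ[OF PP[OF vV]] by blast
      ultimately show False using kle[of x] \<open>k > 0\<close> by (simp add: zero_le_mult_iff)
    qed
    then have "vol \<xi> (b - a) \<le> vol a (b - a)" if "\<xi> \<in> Q" for \<xi>
      using kle[OF that] by (simp add: zero_le_mult_iff vol.diff_left)
    moreover have "F l = {\<xi> \<in> P v. vol \<xi> (b - a) = vol a (b - a)}"
      using ab(5) by (simp add: vol.diff_left)
    ultimately show ?thesis using tau ab(2) by auto
  qed
  have R_leg: "?R (Inr (l, t)) = F l" if l: "l \<in> legs G" and t: "0 < t" for l t
  proof -
    define v where "v = start G l"
    have v: "ends G l = {v}" using leg_ends[OF G l] by (simp add: v_def)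
    have lC: "l \<in> edges G \<union> legs G" using l by blast
    have vV: "v \<in> verts G" using landau_type_ends(1)[OF G lC] v by auto
    obtain k where k: "F l = {\<xi> \<in> P v. vol \<xi> (\<tau> v l) = k}" "\<forall>\<xi> \<in> Q. vol \<xi> (\<tau> v l) \<le> k"
      using leg_normal[OF l v] by blast
    obtain s where s: "s > 0" "\<And>t. t \<ge> 0 \<Longrightarrow> \<psi> (cell G l t) = \<psi> (Inl v) + (s * t) *\<^sub>R \<tau> v l"
      using leg_point[OF l] unfolding v_def by blast
    have "cell G l t = Inr (l, t)" using t legs_not_edges[OF l] by (simp add: cell_def)
    then have pt: "\<psi> (Inr (l, t)) = \<psi> (Inl v) + (s * t) *\<^sub>R \<tau> v l" using s(2)[of t] t by simp
    have "F l \<noteq> {}" using cellF[OF lC] by (auto simp: facet_of_def)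
    then obtain \<xi>0 where x0: "\<xi>0 \<in> P v" "vol \<xi>0 (\<tau> v l) = k" using k(1) by blast
    then have "\<xi>0 \<in> Q" using PQ[OF PP[OF vV]] by blast
    then have "argmax_on Q (\<lambda>\<xi>. vol \<xi> (\<tau> v l)) = {\<xi> \<in> Q. vol \<xi> (\<tau> v l) = k}"
      using k(2) x0(2) unfolding argmax_on_def by (auto intro: antisym)
    then have 1: "argmax_on Q (\<lambda>\<xi>. vol \<xi> (\<psi> (Inl v)) - f \<xi>) \<inter> argmax_on Q (\<lambda>\<xi>. vol \<xi> (\<tau> v l)) = F l"
      unfolding R_vertex[OF vV] k(1) using PQ[OF PP[OF vV]] by auto
    have "argmax_on Q (\<lambda>\<xi>. 1 * (vol \<xi> (\<psi> (Inl v)) - f \<xi>) + (s * t) * vol \<xi> (\<tau> v l)) = F l"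
      using argmax_on_add[of 1 "s * t" Q "\<lambda>\<xi>. vol \<xi> (\<psi> (Inl v)) - f \<xi>" "\<lambda>\<xi>. vol \<xi> (\<tau> v l)"] s(1) t 1 \<open>F l \<noteq> {}\<close>
      by simp
    then show ?thesis by (simp add: pt vol.add_right vol.scaleR_right algebra_simps)
  qed
  \<comment> \<open>Polygons have dimension two and sides dimension one.\<close>
  have P_F: "P v \<noteq> F e" if v: "v \<in> verts G" and e: "e \<in> edges G \<union> legs G" for v e
  proof
    assume eq: "P v = F e"
    obtain P' where P': "P' \<in> PP" "F e facet_of P'" using cellF[OF e] by blast
    have "interior (P v) \<noteq> {}" "interior P' \<noteq> {}"
      using poly PP[OF v] P'(1) by (auto simp: convex_polygon_def)
    then show False using P'(2) eq aff_dim_interior by (auto simp: facet_of_def)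
  qed
  \<comment> \<open>\<open>F\<close> is injective on edges and on legs separately; lying in the
    frontier of \<open>Q\<close> distinguishes the two kinds.\<close>
  have F_inj: "e = e'" if "e \<in> edges G \<union> legs G" "e' \<in> edges G \<union> legs G" "F e = F e'" for e e'
  proof -
    have "F e \<subseteq> frontier Q \<longleftrightarrow> e \<notin> edges G" if "e \<in> edges G \<union> legs G" for e
    proof (cases "e \<in> edges G")
      case True
      then show ?thesis using bij_betwE[OF bij(2)] by blast
    next
      case False
      then show ?thesis using bij_betwE[OF bij(3)] that by blast
    qed
    then have "(e \<in> edges G \<and> e' \<in> edges G) \<or> (e \<in> legs G \<and> e' \<in> legs G)" using that by auto
    then show ?thesis using that(3) bij(2,3) unfolding bij_betw_def inj_on_def by blast
  qed
  show ?thesis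
  proof (rule inj_onI)
    fix p p' assume p: "p \<in> realization_points G" and p': "p' \<in> realization_points G" and eq: "\<psi> p = \<psi> p'"
    then have R: "?R p = ?R p'" by simp
    from G p show "p = p'"
    proof (cases rule: realization_points_cases)
      case (vertex v)
      from G p' show ?thesis
      proof (cases rule: realization_points_cases)
        case v': (vertex v')
        then have "P v = P v'" using R vertex R_vertex by simp
        then show ?thesis using bij(1) vertex v' by (auto simp: bij_betw_def inj_on_def)
      next
        case (edge e t)
        then show ?thesis using R vertex R_vertex R_edge P_F by auto
      next
        case (leg e t)
        then show ?thesis using R vertex R_vertex R_leg P_F by auto
      qed
    next
      case edge: (edge e t)
      from G p' show ?thesis
      proof (cases rule: realization_points_cases)
        case (vertex v)
        then show ?thesis using R edge R_vertex R_edge P_F by (metis UnI1)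
      next
        case edge': (edge e' t')
        then have e': "e = e'" using R edge R_edge F_inj by auto
        have "cell G e t = p" "cell G e t' = p'" using edge edge' e' by (auto simp: cell_def)
        then have "(1 - t) *\<^sub>R \<psi> (Inl (start G e)) + t *\<^sub>R \<psi> (Inl (finish G e)) =
            (1 - t') *\<^sub>R \<psi> (Inl (start G e)) + t' *\<^sub>R \<psi> (Inl (finish G e))"
          using eq edge_point[OF edge(1), of t] edge_point[OF edge(1), of t'] edge edge' by auto
        then have "(t - t') *\<^sub>R (\<psi> (Inl (finish G e)) - \<psi> (Inl (start G e))) = 0"
          by (simp add: algebra_simps)
        moreover have "\<psi> (Inl (finish G e)) \<noteq> \<psi> (Inl (start G e))"
        proof
          assume "\<psi> (Inl (finish G e)) = \<psi> (Inl (start G e))"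
          moreover have V: "start G e \<in> verts G" "finish G e \<in> verts G"
            using landau_type_ends(1)[OF G, of e] edge_ends(1)[OF G edge(1)] edge(1) by auto
          ultimately have "P (finish G e) = P (start G e)" using R_vertex by metis
          then show False using bij(1) V edge_ends(2)[OF G edge(1)] by (auto simp: bij_betw_def inj_on_def)
        qed
        ultimately show ?thesis using edge edge' e' by auto
      next
        case leg: (leg e' t')
        then have "e = e'" using R edge R_edge R_leg F_inj by auto
        then show ?thesis using leg edge by auto
      qed
    next
      case leg: (leg e t)
      from G p' show ?thesis
      proof (cases rule: realization_points_cases)
        case (vertex v)
        then show ?thesis using R leg R_vertex R_leg P_F by (metis UnI2)
      next
        case edge: (edge e' t')
        then have "e = e'" using R leg R_edge R_leg F_inj by auto
        then show ?thesis using leg edge by auto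
      next
        case leg': (leg e' t')
        then have e': "e = e'" using R leg R_leg F_inj by auto
        have c: "cell G e t = p" "cell G e t' = p'" using leg leg' e' by (auto simp: cell_def)
        obtain s where s: "s > 0" "\<And>t. t \<ge> 0 \<Longrightarrow> \<psi> (cell G e t) = \<psi> (Inl (start G e)) + (s * t) *\<^sub>R \<tau> (start G e) e"
          using leg_point[OF leg(1)] by blast
        have "\<tau> (start G e) e \<noteq> 0" using leg_normal[OF leg(1) leg_ends[OF G leg(1)]] by blast
        moreover have "(s * t) *\<^sub>R \<tau> (start G e) e = (s * t') *\<^sub>R \<tau> (start G e) e"
          using s(2)[of t] s(2)[of t'] c eq leg(3) leg'(3) by simp
        ultimately show ?thesis using leg leg' e' s(1) by simp
      qed
    qed
  qed
qed

end

section \<open>Transport from the momentum plane to its dual\<close>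

lemma dual_evaluation_linear:
  assumes W: "subspace W" and ev: "dual_evaluation W ev" and x: "x \<in> W" and y: "y \<in> W"
  shows "ev \<xi> (a *\<^sub>R x + b *\<^sub>R y) = a * ev \<xi> x + b * ev \<xi> y"
proof -
  have "restrict (ev \<xi>) W \<in> dual_space W"
    using ev by (auto simp: dual_evaluation_def bij_betw_def)
  then have add: "\<And>x y. x \<in> W \<Longrightarrow> y \<in> W \<Longrightarrow> restrict (ev \<xi>) W (x + y) = restrict (ev \<xi>) W x + restrict (ev \<xi>) W y"
    and scale: "\<And>c x. x \<in> W \<Longrightarrow> restrict (ev \<xi>) W (c *\<^sub>R x) = c * restrict (ev \<xi>) W x"
    by (auto simp: dual_space_def)
  have "a *\<^sub>R x \<in> W" "b *\<^sub>R y \<in> W" "a *\<^sub>R x + b *\<^sub>R y \<in> W"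
    using W x y by (auto intro: subspace_add subspace_scale)
  then show ?thesis
    using add[of "a *\<^sub>R x" "b *\<^sub>R y"] scale[OF x, of a] scale[OF y, of b] x y by simp
qed

text \<open>\<open>K\<close> realises the identification of the dual plane with \<open>W\<close> by
  contraction with the area form. It is written in a basis of \<open>W\<close> and the dual basis,
  which also shows that the type of the dual plane has dimension two.\<close>

lemma dual_evaluation_plane:
  fixes W :: "'a::euclidean_space set" and ev :: "'b::euclidean_space \<Rightarrow> 'a \<Rightarrow> real"
  assumes W: "subspace W" "dim W = 2" and ev: "dual_evaluation W ev" and vol: "area_form vol"
  obtains K where "area_plane vol" "linear K" "inj K" "range K = W" "\<And>\<xi> \<eta>. ev \<xi> (K \<eta>) = vol \<xi> \<eta>"
proof -
  obtain B where B: "B \<subseteq> W" "independent B" "W \<subseteq> span B" "card B = dim W"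
    using basis_exists[of W] by blast
  have "card B = 2" using B W by simp
  then obtain w1 w2 where w: "B = {w1, w2}" "w1 \<noteq> w2" by (auto simp: card_2_iff)
  have wW: "w1 \<in> W" "w2 \<in> W" using B w by auto
  have comb: "a *\<^sub>R w1 + b *\<^sub>R w2 \<in> W" for a b using W(1) wW by (auto intro: subspace_add subspace_scale)
  have span: "\<exists>a b. x = a *\<^sub>R w1 + b *\<^sub>R w2" if "x \<in> W" for x
    using B(3) w that span_pairE by (metis subsetD)
  note evlin = dual_evaluation_linear[OF W(1) ev]
  have evw: "ev \<xi> (a *\<^sub>R w1 + b *\<^sub>R w2) = a * ev \<xi> w1 + b * ev \<xi> w2" for \<xi> a b
    by (rule evlin[OF wW])
  have lin: "linear (\<lambda>\<xi>. ev \<xi> x)" if "x \<in> W" for x using ev that by (simp add: dual_evaluation_def)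
  have bij: "bij_betw (\<lambda>\<xi>. restrict (ev \<xi>) W) UNIV (dual_space W)" using ev by (simp add: dual_evaluation_def)
  have ext: "\<xi> = \<xi>'" if "ev \<xi> w1 = ev \<xi>' w1" "ev \<xi> w2 = ev \<xi>' w2" for \<xi> \<xi>'
  proof -
    have "ev \<xi> x = ev \<xi>' x" if "x \<in> W" for x
    proof -
      obtain a b where "x = a *\<^sub>R w1 + b *\<^sub>R w2" using span[OF \<open>x \<in> W\<close>] by blast
      then show ?thesis using evw \<open>ev \<xi> w1 = ev \<xi>' w1\<close> \<open>ev \<xi> w2 = ev \<xi>' w2\<close> by simp
    qed
    then have "restrict (ev \<xi>) W = restrict (ev \<xi>') W" by (auto simp: restrict_def)
    then show ?thesis using bij by (auto simp: bij_betw_def inj_on_def)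
  qed
  \<comment> \<open>A functional with prescribed values on the basis is built from coordinates and
    lies in the range of the evaluation, by surjectivity onto the dual space.\<close>
  have ex: "\<exists>\<xi>. ev \<xi> w1 = \<alpha> \<and> ev \<xi> w2 = \<beta>" for \<alpha> \<beta>
  proof -
    let ?r = "representation B"
    define g where "g = restrict (\<lambda>x. \<alpha> * ?r x w1 + \<beta> * ?r x w2) W"
    have sub: "x \<in> span B" if "x \<in> W" for x using that B(3) by blast
    have "g \<in> dual_space W"
      unfolding dual_space_def
    proof (intro CollectI conjI ballI allI)
      fix x y assume "x \<in> W" "y \<in> W"
      then show "g (x + y) = g x + g y"
        using W(1) subspace_add[of W x y] representation_add[OF B(2) sub sub, of x y]
        by (simp add: g_def algebra_simps)
    next
      fix c x assume "x \<in> W"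
      then show "g (c *\<^sub>R x) = c * g x"
        using W(1) subspace_scale[of W x c] representation_scale[OF B(2) sub, of x c]
        by (simp add: g_def algebra_simps)
    qed (simp add: g_def)
    then have "g \<in> range (\<lambda>\<xi>. restrict (ev \<xi>) W)" using bij by (simp add: bij_betw_def)
    then obtain \<xi> where xi: "restrict (ev \<xi>) W = g" by (elim rangeE) (rule that, rule sym)
    have "?r w1 w1 = 1" "?r w1 w2 = 0" "?r w2 w1 = 0" "?r w2 w2 = 1"
      using representation_basis[OF B(2)] w by auto
    then have "g w1 = \<alpha>" "g w2 = \<beta>" using wW by (simp_all add: g_def)
    moreover have "ev \<xi> w1 = g w1" "ev \<xi> w2 = g w2" using wW by (simp_all flip: xi)
    ultimately have "ev \<xi> w1 = \<alpha>" "ev \<xi> w2 = \<beta>" by simp_all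
    then show ?thesis by blast
  qed
  obtain e1 where e1: "ev e1 w1 = 1" "ev e1 w2 = 0" using ex by blast
  obtain e2 where e2: "ev e2 w1 = 0" "ev e2 w2 = 1" using ex by blast
  have lin1: "ev (a *\<^sub>R e1 + b *\<^sub>R e2) x = a * ev e1 x + b * ev e2 x" if "x \<in> W" for a b x
    using linear_add[OF lin[OF that]] linear_scale[OF lin[OF that]] by simp
  have dec: "\<xi> = ev \<xi> w1 *\<^sub>R e1 + ev \<xi> w2 *\<^sub>R e2" for \<xi>
    by (rule ext) (simp_all add: lin1 wW e1 e2)
  interpret vol: bounded_bilinear vol by (rule area_form_bounded_bilinear[OF vol])
  have "e1 \<noteq> e2" using e1 e2 by auto
  have ind: "independent {e1, e2}"
  proof -
    have "e2 \<noteq> 0"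
    proof
      assume "e2 = 0"
      then have "ev e2 w2 = 0" using linear_0[OF lin[OF wW(2)]] by simp
      then show False using e2 by simp
    qed
    moreover have "e1 \<notin> span {e2}"
    proof
      assume "e1 \<in> span {e2}"
      then obtain k where "e1 = k *\<^sub>R e2" by (auto simp: span_singleton)
      then have "ev e1 w1 = k * ev e2 w1" using linear_scale[OF lin[OF wW(1)]] by simp
      then show False using e1 e2 by simp
    qed
    ultimately show ?thesis using \<open>e1 \<noteq> e2\<close> by (simp add: independent_insert)
  qed
  have "UNIV \<subseteq> span {e1, e2}"
  proof
    fix \<xi> :: 'b
    show "\<xi> \<in> span {e1, e2}" by (subst dec) (intro span_add span_scale span_base; simp)
  qed
  then have "dim (UNIV :: 'b set) = card {e1, e2}" using dim_unique[OF _ _ ind, of UNIV] by simp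
  then have "DIM('b) = 2" using \<open>e1 \<noteq> e2\<close> by (simp add: dim_UNIV)
  then interpret area_plane vol using vol by unfold_locales
  define m where "m = vol e1 e2"
  have m: "vol e2 e1 = - m" unfolding m_def by (rule vol_skew)
  have "m \<noteq> 0"
  proof
    assume "m = 0"
    have "vol \<xi> \<eta> = 0" for \<xi> \<eta>
    proof -
      have "vol \<xi> \<eta> = vol (ev \<xi> w1 *\<^sub>R e1 + ev \<xi> w2 *\<^sub>R e2) (ev \<eta> w1 *\<^sub>R e1 + ev \<eta> w2 *\<^sub>R e2)"
        by (simp only: dec[symmetric])
      also have "\<dots> = 0" using \<open>m = 0\<close> m by (simp add: vol_simps m_def)
      finally show ?thesis .
    qed
    then show False using vol by (simp add: area_form_def)
  qed
  define K where "K \<eta> = vol e1 \<eta> *\<^sub>R w1 + vol e2 \<eta> *\<^sub>R w2" for \<eta>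
  have evK: "ev \<xi> (K \<eta>) = vol \<xi> \<eta>" for \<xi> \<eta>
  proof -
    have "vol \<xi> \<eta> = vol (ev \<xi> w1 *\<^sub>R e1 + ev \<xi> w2 *\<^sub>R e2) \<eta>" by (simp only: dec[symmetric])
    then show ?thesis unfolding K_def evw by (simp add: vol.add_left vol.scaleR_left mult.commute)
  qed
  have "linear K" unfolding K_def by (intro linearI) (simp_all add: vol_simps algebra_simps)
  moreover have "inj K"
  proof (rule injI)
    fix \<eta> \<eta>' assume "K \<eta> = K \<eta>'"
    then have "vol \<xi> \<eta> = vol \<xi> \<eta>'" for \<xi> using evK by metis
    then show "\<eta> = \<eta>'" by (rule vol_separates)
  qed
  moreover have "range K = W"
  proof
    show "range K \<subseteq> W" using comb by (auto simp: K_def)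
    show "W \<subseteq> range K"
    proof
      fix x assume "x \<in> W"
      then obtain a b where x: "x = a *\<^sub>R w1 + b *\<^sub>R w2" using span by blast
      \<comment> \<open>The preimage comes from \<open>K e2 = m w1\<close> and
        \<open>K e1 = - m w2\<close>.\<close>
      have "x = K ((a / m) *\<^sub>R e2 - (b / m) *\<^sub>R e1)"
        using \<open>m \<noteq> 0\<close> by (simp add: x K_def vol_simps m flip: m_def)
      then show "x \<in> range K" by blast
    qed
  qed
  ultimately show ?thesis using that area_plane_axioms evK by blast
qed

context area_plane
begin

text \<open>Along a segment the integrand is the constant \<open>vol x (b - a)\<close>, and the
  orientation singles out the order of the end points, so the description in \<open>THE\<close> has
  one solution.\<close>

lemma weighted_normal_eq:
  assumes K: "range K = W" "\<And>\<xi> \<eta>. ev \<xi> (K \<eta>) = vol \<xi> \<eta>"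
    and P: "interior P \<noteq> {}" and F: "F = closed_segment a b" "boundary_oriented vol P a b"
  shows "weighted_normal W ev vol P F = K (b - a)"
  unfolding weighted_normal_def
proof (rule the_equality)
  have "\<forall>x. ev x (K (b - a)) = integral {0..1} (\<lambda>t. vol x (vector_derivative (linepath a b) (at t)))"
    by (simp add: K(2))
  then show "K (b - a) \<in> W \<and> (\<exists>a' b'. F = closed_segment a' b' \<and> boundary_oriented vol P a' b' \<and>
      (\<forall>x. ev x (K (b - a)) = integral {0..1} (\<lambda>t. vol x (vector_derivative (linepath a' b') (at t)))))"
    using F K(1) by blast
next
  fix u
  assume u: "u \<in> W \<and> (\<exists>a b. F = closed_segment a b \<and> boundary_oriented vol P a b \<and>
        (\<forall>x. ev x u = integral {0..1} (\<lambda>t. vol x (vector_derivative (linepath a b) (at t)))))"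
  then obtain a' b' where ab: "F = closed_segment a' b'" "boundary_oriented vol P a' b'"
    "\<And>x. ev x u = vol x (b' - a')" by auto
  have "a = a'" "b = b'" using boundary_oriented_unique[OF P, of a b a' b'] F ab(1,2) by auto
  moreover obtain \<eta> where "u = K \<eta>" using u K(1) by blast
  ultimately have "vol x \<eta> = vol x (b - a)" for x using ab(3)[of x] K(2) by simp
  then show "u = K (b - a)" using vol_separates \<open>u = K \<eta>\<close> by blast
qed

lemma linear_part_eq:
  assumes K: "range K = W" "\<And>\<xi> \<eta>. ev \<xi> (K \<eta>) = vol \<xi> \<eta>"
    and P: "interior P \<noteq> {}" and f: "\<And>\<xi>. \<xi> \<in> P \<Longrightarrow> f \<xi> = vol \<xi> y + c"
  shows "linear_part W ev f P = K y"
  unfolding linear_part_def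
proof (rule the_equality, intro conjI)
  show "K y \<in> W" using K(1) by blast
  show "\<exists>c. \<forall>x\<in>P. f x = ev x (K y) + c" using f K(2) by auto
next
  fix w assume w: "w \<in> W \<and> (\<exists>c. \<forall>x\<in>P. f x = ev x w + c)"
  then obtain \<eta> where "w = K \<eta>" using K(1) by blast
  then obtain c' where eta: "w = K \<eta>" "\<forall>x\<in>P. f x = vol x \<eta> + c'" using w K(2) by auto
  have eq: "vol \<xi> \<eta> + c' = vol \<xi> y + c" if "\<xi> \<in> P" for \<xi> using f[OF that] eta(2) that by simp
  show "w = K y" using affine_unique_interior[OF P eq] eta(1) by blast
qed

end

lemma linear_positive_multiple:
  assumes "linear K" "inj K" "positive_multiple (K x) (K y)"
  shows "positive_multiple x y"
proof -
  obtain c where c: "c > 0" "K x = c *\<^sub>R K y" using assms(3) by (auto simp: positive_multiple_def)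
  then have "K x = K (c *\<^sub>R y)" using assms(1) by (simp add: linear_scale)
  then show ?thesis using c(1) assms(2) by (auto simp: positive_multiple_def dest: injD)
qed

text \<open>All conditions on the transported data are linear, so each is checked after applying
  \<open>K\<close> and then cancelled by injectivity.\<close>

lemma landau_plane_pullback:
  assumes plane: "area_plane vol" and K: "linear K" "inj K"
    and G: "landau_type_graph G" and aff: "piecewise_affine G \<phi>"
    and \<phi>: "\<And>p. p \<in> realization_points G \<Longrightarrow> K (\<psi> p) = \<phi> p"
    and scat: "scattering_diagram W G \<sigma>" and coll: "collinear_diagram G \<phi> \<sigma>"
    and \<tau>: "\<And>e v. e \<in> edges G \<union> legs G \<Longrightarrow> v \<in> ends G e \<Longrightarrow> K (\<tau> v e) = \<sigma> v e"
  shows "landau_plane vol G \<psi> \<tau>"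
proof -
  interpret area_plane vol by (rule plane)
  have inl: "Inl v \<in> realization_points G" if "v \<in> verts G" for v using that by (simp add: realization_points_def)
  have cellp: "cell G e t \<in> realization_points G" if "e \<in> edges G \<union> legs G" "t \<in> cell_domain G e" for e t
    using that by (auto simp: realization_points_def)
  have affine: "\<exists>a d. \<forall>t\<in>cell_domain G e. \<phi> (cell G e t) = a + t *\<^sub>R d" if "e \<in> edges G \<union> legs G" for e
    using aff that by (simp add: piecewise_affine_def)
  have ends2: "v \<in> verts G" "w \<in> verts G" "v \<in> ends G e" "w \<in> ends G e"
    if "e \<in> edges G" "ends G e = {v, w}" for e v w
    using landau_type_ends(1)[OF G, of e] that by auto
  show ?thesis
  proof (unfold_locales, goal_cases)
    case 1
    then show ?case by (rule G)
  next
    case (2 e t)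
    then have e: "e \<in> edges G \<union> legs G" by blast
    obtain a d where ad: "\<And>t. t \<in> {0..1} \<Longrightarrow> \<phi> (cell G e t) = a + t *\<^sub>R d"
      using affine[OF e] 2(1) by (auto simp: cell_domain_def)
    have c01: "cell G e 0 = Inl (start G e)" "cell G e 1 = Inl (finish G e)" using 2(1) by (auto simp: cell_def)
    have se: "start G e \<in> verts G" "finish G e \<in> verts G"
      using ends2[OF 2(1) edge_ends(1)[OF G 2(1)]] by auto
    have "K (\<psi> (cell G e t)) = \<phi> (cell G e t)" using \<phi> cellp[OF e] 2 by (simp add: cell_domain_def)
    also have "\<dots> = (1 - t) *\<^sub>R \<phi> (Inl (start G e)) + t *\<^sub>R \<phi> (Inl (finish G e))"
      using ad[OF 2(2)] ad[of 0] ad[of 1] c01 by (simp add: algebra_simps)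
    also have "\<dots> = K ((1 - t) *\<^sub>R \<psi> (Inl (start G e)) + t *\<^sub>R \<psi> (Inl (finish G e)))"
      using K(1) \<phi>[OF inl[OF se(1)]] \<phi>[OF inl[OF se(2)]] by (simp add: linear_add linear_scale)
    finally show ?case using K(2) by (rule injD[rotated])
  next
    case (3 l)
    then have l: "l \<in> edges G \<union> legs G" "l \<notin> edges G" using G by (auto simp: landau_type_graph_def)
    let ?v = "start G l"
    obtain a d where ad: "\<And>t. t \<ge> 0 \<Longrightarrow> \<phi> (cell G l t) = a + t *\<^sub>R d"
      using affine[OF l(1)] l(2) by (auto simp: cell_domain_def)
    have v: "ends G l = {?v}" by (rule leg_ends[OF G 3])
    have vV: "?v \<in> verts G" using landau_type_ends(1)[OF G l(1)] v by auto
    have c0: "cell G l 0 = Inl ?v" by (simp add: cell_def)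
    have "positive_multiple (\<sigma> ?v l) (\<phi> (cell G l 1) - \<phi> (Inl ?v))"
      using coll 3 v unfolding collinear_diagram_def by blast
    then obtain c where c: "c > 0" "\<sigma> ?v l = c *\<^sub>R (\<phi> (cell G l 1) - \<phi> (Inl ?v))"
      by (auto simp: positive_multiple_def)
    have sd: "\<sigma> ?v l = c *\<^sub>R d" using c(2) ad[of 0] ad[of 1] c0 by simp
    \<comment> \<open>The leg advances by \<open>d\<close> per unit of its parameter and the
      momentum is \<open>c\<close> times \<open>d\<close>, so the speed in units of the momentum is
      \<open>1 / c\<close>.\<close>
    have "\<psi> (cell G l t) = \<psi> (Inl ?v) + (1 / c * t) *\<^sub>R \<tau> ?v l" if t: "t \<ge> 0" for t
    proof -
      have "K (\<psi> (cell G l t)) = \<phi> (cell G l t)" using \<phi> cellp[OF l(1)] t l(2) by (simp add: cell_domain_def)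
      also have "\<dots> = \<phi> (Inl ?v) + (1 / c * t) *\<^sub>R \<sigma> ?v l" using ad[OF t] ad[of 0] c0 c(1) sd by simp
      also have "\<dots> = K (\<psi> (Inl ?v) + (1 / c * t) *\<^sub>R \<tau> ?v l)"
        using K(1) \<phi>[OF inl[OF vV]] \<tau>[OF l(1), of ?v] v by (simp add: linear_add linear_scale)
      finally show ?thesis using K(2) by (rule injD[rotated])
    qed
    then show ?case using c(1) by (intro exI[of _ "1 / c"]) simp
  next
    case (4 e v w)
    note vw = ends2[OF 4]
    have "positive_multiple (\<sigma> v e) (\<phi> (Inl w) - \<phi> (Inl v))"
      using coll 4 by (auto simp: collinear_diagram_def)
    moreover have "\<sigma> v e = K (\<tau> v e)" using \<tau>[of e v] vw(3) 4(1) by simp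
    moreover have "\<phi> (Inl w) - \<phi> (Inl v) = K (\<psi> (Inl w) - \<psi> (Inl v))"
      using K(1) \<phi>[OF inl[OF vw(1)]] \<phi>[OF inl[OF vw(2)]] by (simp add: linear_diff)
    ultimately show ?case using linear_positive_multiple[OF K] by simp
  next
    case (5 e v w)
    note vw = ends2[OF 5]
    have "\<sigma> v e = - \<sigma> w e" using scat 5 by (auto simp: scattering_diagram_def)
    then have "K (\<tau> v e) = K (- \<tau> w e)" using \<tau>[of e v] \<tau>[of e w] vw(3,4) 5(1) K(1) by (simp add: linear_neg)
    then show ?case using K(2) by (rule injD[rotated])
  next
    case (6 v)
    have "K (\<Sum>e\<in>{e \<in> edges G \<union> legs G. v \<in> ends G e}. \<tau> v e) = (\<Sum>e\<in>{e \<in> edges G \<union> legs G. v \<in> ends G e}. \<sigma> v e)"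
      using \<tau> by (simp add: linear_sum[OF K(1)])
    also have "\<dots> = 0" using scat 6 by (simp add: scattering_diagram_def)
    also have "\<dots> = K 0" using K(1) by (simp add: linear_0)
    finally show ?case using K(2) by (rule injD[rotated])
  qed
qed

theorem proposition7p1:
  fixes B :: "'a::euclidean_space \<Rightarrow> 'a \<Rightarrow> real"
    and W :: "'a set"
    and ev :: "'b::euclidean_space \<Rightarrow> 'a \<Rightarrow> real"
    and vol :: "'b \<Rightarrow> 'b \<Rightarrow> real"
    and G :: "('v, 'e) legged_graph"
    and \<phi> :: "'v + 'e \<times> real \<Rightarrow> 'a"
    and \<sigma> :: "'v \<Rightarrow> 'e \<Rightarrow> 'a"
    and m :: "'e \<Rightarrow> real"
  assumes "nondegenerate_scalar_product B"
    and "euclidean_signature B \<or> lorentzian_signature B"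
    and "subspace W" and "dim W = 2"
    and "dual_evaluation W ev"
    and "area_form vol"
    and "real_landau_singularity B W G \<phi> \<sigma> m"
  shows "polygonal_singularity W ev vol G \<phi> \<sigma> \<longleftrightarrow> graph_embedding W G \<phi>"
proof -
  have G: "landau_type_graph G" and W: "\<phi> ` realization_points G \<subseteq> W" and aff: "piecewise_affine G \<phi>"
    and scat: "scattering_diagram W G \<sigma>" and coll: "collinear_diagram G \<phi> \<sigma>"
    using assms(7) by (auto simp: real_landau_singularity_def real_landau_graph_def)
  obtain K where plane: "area_plane vol" and K: "linear K" "inj K" "range K = W" "\<And>\<xi> \<eta>. ev \<xi> (K \<eta>) = vol \<xi> \<eta>"
    using dual_evaluation_plane[OF assms(3-6)] by metis
  \<comment> \<open>\<open>inv K\<close> is meaningful only on \<open>W\<close>, which contains the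
    images of realization points and the momenta at incident pairs; the values elsewhere are
    arbitrary and never compared with \<open>\<phi>\<close> or \<open>\<sigma>\<close>.\<close>
  define \<psi> where "\<psi> p = inv K (\<phi> p)" for p
  define \<tau> where "\<tau> v e = inv K (\<sigma> v e)" for v e
  have \<phi>: "K (\<psi> p) = \<phi> p" if "p \<in> realization_points G" for p
    using W K(3) that unfolding \<psi>_def by (metis f_inv_into_f image_subset_iff)
  have \<tau>: "K (\<tau> v e) = \<sigma> v e" if "e \<in> edges G \<union> legs G" "v \<in> ends G e" for v e
    using scat K(3) that unfolding \<tau>_def scattering_diagram_def by (metis f_inv_into_f)
  interpret landau_plane vol G \<psi> \<tau>
    by (rule landau_plane_pullback[OF plane K(1,2) G aff \<phi> scat coll \<tau>])
  have inj_iff: "inj_on \<phi> (realization_points G) \<longleftrightarrow> inj_on \<psi> (realization_points G)"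
    using \<phi> K(2) by (metis (no_types, lifting) inj_on_def \<psi>_def injD)
  note WN = weighted_normal_eq[OF K(3,4)] and LP = linear_part_eq[OF K(3,4)]
  have inl: "Inl v \<in> realization_points G" if "v \<in> verts G" for v using that by (simp add: realization_points_def)
  have "polygonal_singularity W ev vol G \<phi> \<sigma> \<longleftrightarrow> inj_on \<psi> (realization_points G)"
  proof
    assume "inj_on \<psi> (realization_points G)"
    then interpret pg: plane_graph vol "verts G" "edges G" "legs G" "ends G" "\<lambda>v. \<psi> (Inl v)" \<tau> edge_len
      by (rule embedded_plane_graph)
    let ?PP = "pg.tile ` verts G"
    show "polygonal_singularity W ev vol G \<phi> \<sigma>"
      unfolding polygonal_singularity_def
    proof (intro exI[of _ pg.dual_polygon] exI[of _ ?PP] exI[of _ pg.dual_function]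
        exI[of _ pg.tile] exI[of _ pg.side] conjI ballI)
      show "regular_subdivision pg.dual_polygon ?PP"
        using pg.dual_subdivision pg.dual_function_strictly_convex by (auto simp: regular_subdivision_def)
      show "legged_graph_iso G (dual_graph pg.dual_polygon ?PP) pg.tile pg.side"
        using pg.dual_graph_iso by (simp add: legged_graph_iso_def)
    next
      fix e v assume e: "e \<in> edges G \<union> legs G" and v: "v \<in> ends G e"
      then have V: "v \<in> verts G" using landau_type_ends(1)[OF G] by blast
      obtain a b where "pg.side e = closed_segment a b" "b - a = \<tau> v e"
        "boundary_oriented vol (pg.tile v) a b"
        using pg.side_oriented[OF e v] .
      then show "\<sigma> v e = weighted_normal W ev vol (pg.tile v) (pg.side e)"
        using WN[OF pg.cell_interior[OF V]] \<tau>[OF e v] by simp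
    next
      fix v assume v: "v \<in> verts G"
      show "\<phi> (Inl v) = linear_part W ev pg.dual_function (pg.tile v)"
        using LP[OF pg.cell_interior[OF v], of pg.dual_function "\<psi> (Inl v)" "- pg.potential (\<psi> (Inl v))"]
          pg.dual_function_cell[OF v] \<phi>[OF inl[OF v]] by simp
    qed (rule pg.dual_polygon_convex_polygon pg.dual_function_strictly_convex)+
  next
    assume "polygonal_singularity W ev vol G \<phi> \<sigma>"
    then obtain Q PP f P F where Q: "convex_polygon Q" and sub: "polygonal_subdivision Q PP"
      and f: "strictly_convex_PL Q PP f" and iso: "legged_graph_iso G (dual_graph Q PP) P F"
      and normal: "\<And>e v. e \<in> edges G \<union> legs G \<Longrightarrow> v \<in> ends G e \<Longrightarrow> \<sigma> v e = weighted_normal W ev vol (P v) (F e)"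
      and lin: "\<And>v. v \<in> verts G \<Longrightarrow> \<phi> (Inl v) = linear_part W ev f (P v)"
      unfolding polygonal_singularity_def regular_subdivision_def by blast
    have PP: "P v \<in> PP" if "v \<in> verts G" for v
      using iso that by (auto simp: legged_graph_iso_def dual_graph_def bij_betw_def)
    then have int: "interior (P v) \<noteq> {}" if "v \<in> verts G" for v
      using sub that by (auto simp: polygonal_subdivision_def convex_polygon_def)
    show "inj_on \<psi> (realization_points G)"
    proof (rule polygonal_imp_inj[OF Q sub f iso])
      fix v assume v: "v \<in> verts G"
      obtain g where g: "affine_function g" "\<forall>\<xi> \<in> P v. f \<xi> = g \<xi>"
        using f PP[OF v] by (auto simp: strictly_convex_PL_def)
      obtain n c where "\<And>\<xi>. g \<xi> = vol \<xi> n + c" using affine_function_vol[OF g(1)] by blast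
      then have n: "\<And>\<xi>. \<xi> \<in> P v \<Longrightarrow> f \<xi> = vol \<xi> n + c" using g(2) by simp
      have "K (\<psi> (Inl v)) = K n" using LP[OF int[OF v] n] lin[OF v] \<phi>[OF inl[OF v]] by simp
      then have "\<psi> (Inl v) = n" using K(2) by (rule injD[rotated])
      then show "\<exists>c. \<forall>\<xi> \<in> P v. f \<xi> = vol \<xi> (\<psi> (Inl v)) + c" using n by blast
    next
      fix e v a b assume e: "e \<in> edges G \<union> legs G" and v: "v \<in> ends G e"
        and F: "F e = closed_segment a b" "boundary_oriented vol (P v) a b"
      then have V: "v \<in> verts G" using landau_type_ends(1)[OF G] by blast
      have "K (\<tau> v e) = K (b - a)" using WN[OF int[OF V] F] normal[OF e v] \<tau>[OF e v] by simp
      then show "\<tau> v e = b - a" using K(2) by (rule injD[rotated])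
    qed
  qed
  then show ?thesis using graph_embedding_iff_inj[OF G aff W] inj_iff by simp
qed

end
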